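(* Consider the renewal risk model with 2-order phase-type interclaim times and exponential claim sizes described in the context. Let $(b_1^*,b_2^* )$ be optimal phase-wise barriers with corresponding value functions $f_1^*,f_2^*$. If $0<b_1^*<b_2^*$, then $f_2^*$ is concave on $[b_1^*,+\infty)$.
   Context: **Model.** Here $n=2$. Fix $c>0$, $\beta>0$, $\delta>0$, and $\pi_1,\pi_2\ge0$ with $\pi_1+\pi_2=1$. For $i\in\{1,2\}$ and $j\in\{1,2,3\}$, $j\ne i$, let $\lambda_{ij}\ge 0$ be transition intensities, and put $\lambda_i=\sum_{j=1,j\ne i}^{3}\lambda_{ij}>0$. A continuous-time Markov process $\bar J$ on $\{1,2,3\}$ has these intensities; $3$ is absorbing and the states $1,2$ (the phases) are transient. The observed phase process $J$ moves like $\bar J$ on $\{1,2\}$; each time state $3$ is entered a claim occurs and the process immediately restarts in phase $i$ with probability $\pi_i$, independently of the past. $N_t$ is the number of claims up to time $t$. Claim sizes $Y_1,Y_2,\dots$ are i.i.d. with distribution function $1-e^{-\beta y}$, $y\ge 0$, and independent of $J$. With cumulative dividends $D_t$ and initial capital $x\ge 0$ the surplus is $X_t^D=x+ct-\sum_{k=1}^{N_t}Y_k-D_t$, with ruin time $\tau=\inf\{t: X_t^D<0\}$. No dividends are paid after ruin. **Phase-wise barrier strategy.** For $b=(b_1,b_2)\in[0,\infty)^2$, the phase-wise barrier strategy with barriers $b$ is: whenever the current phase is $i$, all capital above $b_i$ is immediately paid as dividend; while the surplus equals $b_i$ in phase $i$ all incoming premium is paid as dividend (at rate $c$) until the next jump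 of the phase process; while the surplus is below $b_i$ no dividend is paid. Its value is $$f_i^b(x)=\mathbb E\Big[\int_{0-}^{\tau-}e^{-\delta t}\,\mathrm dD_t\,\Big|\,J_0=i,\ X_{0-}^D=x\Big],\quad x\ge 0,$$ where the integral includes an immediate lump sum at time $0$. **Optimal phase-wise barriers.** A vector $b^*=(b_1^*,b_2^* )\in[0,\infty)^2$ is called a vector of optimal phase-wise barriers if for every $i$ and every $x\in[0,b_i^*]$, $f_i^{b^*}(x)=\sup_{b\in[0,\infty)^2}f_i^{b}(x)$. Put $f_i^*:=f_i^{b^*}$. *)

theory Defs
  imports "HOL-Probability.Probability"
begin

text \<open>
  The observed phase process together with the claim epochs is given by the jump chain and the
  holding times of the Markov process that is restarted whenever it enters the absorbing state
  \<open>3\<close>. An \<^emph>\<open>event\<close> is a jump of that process, including the jumps into \<open>3\<close> that restart in the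
  phase they left:

  \<^item> \<open>Z n\<close> is the phase occupied after \<open>n\<close> events, \<open>S n\<close> the time spent there;
  \<^item> \<open>E n \<in> {1, 2, 3}\<close> is the state entered by the event that ends this stay. If \<open>E n = 3\<close>, the event
    is a claim and \<open>Z (Suc n)\<close> is drawn from \<open>\<pi>\<close>; otherwise \<open>Z (Suc n) = E n\<close>;
  \<^item> \<open>Y k\<close>, for \<open>k \<ge> 1\<close>, is the size of the \<open>k\<close>-th claim.

  \<open>P i\<close> is the law given that the initial phase is \<open>i\<close>.
\<close>

locale phase_type_risk_model =
  fixes c \<beta> \<delta> :: real
    and \<pi> :: "nat \<Rightarrow> real"
    and lam :: "nat \<Rightarrow> nat \<Rightarrow> real"
    and P :: "nat \<Rightarrow> 'w measure"
    and Z :: "nat \<Rightarrow> 'w \<Rightarrow> nat"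
    and S :: "nat \<Rightarrow> 'w \<Rightarrow> real"
    and E :: "nat \<Rightarrow> 'w \<Rightarrow> nat"
    and Y :: "nat \<Rightarrow> 'w \<Rightarrow> real"
  assumes c_pos: "c > 0" and beta_pos: "\<beta> > 0" and delta_pos: "\<delta> > 0"
    and restart_nonneg: "\<pi> 1 \<ge> 0" "\<pi> 2 \<ge> 0"
    and restart_sum: "\<pi> 1 + \<pi> 2 = 1"
    and intensity_nonneg: "\<And>i j. i \<in> {1, 2} \<Longrightarrow> j \<in> {1, 2, 3} - {i} \<Longrightarrow> lam i j \<ge> 0"
    and exit_rate_pos: "\<And>i. i \<in> {1, 2} \<Longrightarrow> (\<Sum>j\<in>{1, 2, 3} - {i}. lam i j) > 0"
    and prob_space_P: "\<And>i. i \<in> {1, 2} \<Longrightarrow> prob_space (P i)"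
    and measurable_Z: "\<And>i n. i \<in> {1, 2} \<Longrightarrow> Z n \<in> measurable (P i) (count_space UNIV)"
    and measurable_S: "\<And>i n. i \<in> {1, 2} \<Longrightarrow> S n \<in> borel_measurable (P i)"
    and measurable_E: "\<And>i n. i \<in> {1, 2} \<Longrightarrow> E n \<in> measurable (P i) (count_space UNIV)"
    \<comment> \<open>joint law of jump chain and holding times: a stay in phase \<open>i\<close> is exponential with the total
      rate of \<open>i\<close>, and independently of its length \<open>j\<close> is entered with probability \<open>lam i j\<close>
      divided by that rate\<close>
    and chain_law: "\<And>i n ph st t. \<lbrakk>i \<in> {1, 2}; \<forall>m\<le>n. ph m \<in> {1, 2};
        \<forall>m<n. st m \<in> {1, 2, 3} - {ph m}; \<forall>m<n. t m \<ge> 0\<rbrakk> \<Longrightarrow>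
        measure (P i) {\<omega> \<in> space (P i).
            (\<forall>m<n. Z m \<omega> = ph m \<and> S m \<omega> > t m \<and> E m \<omega> = st m) \<and> Z n \<omega> = ph n} =
          of_bool (ph 0 = i) *
          (\<Prod>m<n. exp (- (\<Sum>j\<in>{1, 2, 3} - {ph m}. lam (ph m) j) * t m) *
                  (lam (ph m) (st m) / (\<Sum>j\<in>{1, 2, 3} - {ph m}. lam (ph m) j)) *
                  (if st m = 3 then \<pi> (ph (Suc m)) else of_bool (ph (Suc m) = st m)))"
    and claims_indep: "\<And>i. i \<in> {1, 2} \<Longrightarrow> prob_space.indep_vars (P i) (\<lambda>_. borel) Y {1..}"
    and claims_exponential: "\<And>i k. i \<in> {1, 2} \<Longrightarrow> k \<ge> 1 \<Longrightarrow>
        distributed (P i) lborel (Y k) (exponential_density \<beta>)"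
    and claims_indep_phases: "\<And>i. i \<in> {1, 2} \<Longrightarrow> prob_space.indep_set (P i)
        (sets (vimage_algebra (space (P i)) (\<lambda>\<omega> n. (Z n \<omega>, S n \<omega>, E n \<omega>))
          (\<Pi>\<^sub>M n\<in>UNIV. count_space UNIV \<Otimes>\<^sub>M (borel \<Otimes>\<^sub>M count_space UNIV))))
        (sets (vimage_algebra (space (P i)) (\<lambda>\<omega>. \<lambda>k\<in>{1..}. Y k \<omega>) (\<Pi>\<^sub>M k\<in>{1..}. borel)))"
begin

definition epoch :: "'w \<Rightarrow> nat \<Rightarrow> real" where
  "epoch \<omega> n = (\<Sum>k<n. S k \<omega>)"

definition events :: "'w \<Rightarrow> real \<Rightarrow> nat" where
  "events \<omega> t = card {n. epoch \<omega> (Suc n) \<le> t}"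

text \<open>Number of claims among the first \<open>n\<close> events.\<close>

definition claims :: "'w \<Rightarrow> nat \<Rightarrow> nat" where
  "claims \<omega> n = card {k. k < n \<and> E k \<omega> = 3}"

definition J :: "real \<Rightarrow> 'w \<Rightarrow> nat" where
  "J t \<omega> = Z (events \<omega> t) \<omega>"

definition N :: "real \<Rightarrow> 'w \<Rightarrow> nat" where
  "N t \<omega> = claims \<omega> (events \<omega> t)"

text \<open>
  \<open>paid_before b x \<omega> n\<close> is the total dividend paid strictly before the \<open>n\<close>-th event epoch, and
  \<open>ruined b x \<omega> n\<close> says that ruin has occurred up to and including it. During the \<open>n\<close>-th stay the
  surplus without further dividends would be \<open>x + c t - (claims) - paid_before b x \<omega> n\<close>, which is
  increasing in \<open>t\<close>, while the barrier \<open>b (Z n \<omega>)\<close> is fixed. Hence the dividends of that stay up to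
  time \<open>t\<close>, i.e. the lump sum at its beginning plus the premiums received while the surplus is at
  the barrier, are the excess of this quantity over the barrier. As the surplus increases between
  claims, ruin happens at event epochs only.
\<close>

fun paid_before :: "(nat \<Rightarrow> real) \<Rightarrow> real \<Rightarrow> 'w \<Rightarrow> nat \<Rightarrow> real"
  and ruined :: "(nat \<Rightarrow> real) \<Rightarrow> real \<Rightarrow> 'w \<Rightarrow> nat \<Rightarrow> bool" where
  "paid_before b x \<omega> 0 = 0"
| "paid_before b x \<omega> (Suc n) = paid_before b x \<omega> n +
     (if ruined b x \<omega> n then 0
      else max 0 (x + c * epoch \<omega> (Suc n) - (\<Sum>k=1..claims \<omega> n. Y k \<omega>)
                  - paid_before b x \<omega> n - b (Z n \<omega>)))"
| "ruined b x \<omega> 0 \<longleftrightarrow> x < 0"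
| "ruined b x \<omega> (Suc n) \<longleftrightarrow> ruined b x \<omega> n \<or>
     x + c * epoch \<omega> (Suc n) - (\<Sum>k=1..claims \<omega> (Suc n). Y k \<omega>) - paid_before b x \<omega> (Suc n) < 0"

text \<open>
  Cumulative dividends of the phase-wise barrier strategy with barriers \<open>b 1\<close> and \<open>b 2\<close>. They vanish
  for negative times, so that a lump sum at time \<open>0\<close> is an atom of the Stieltjes measure below.
\<close>

definition D :: "(nat \<Rightarrow> real) \<Rightarrow> real \<Rightarrow> real \<Rightarrow> 'w \<Rightarrow> real" where
  "D b x t \<omega> = (if t < 0 then 0 else
     paid_before b x \<omega> (events \<omega> t) +
     (if ruined b x \<omega> (events \<omega> t) then 0
      else max 0 (x + c * t - (\<Sum>k=1..N t \<omega>. Y k \<omega>)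
                  - paid_before b x \<omega> (events \<omega> t) - b (J t \<omega>))))"

definition X :: "(nat \<Rightarrow> real) \<Rightarrow> real \<Rightarrow> real \<Rightarrow> 'w \<Rightarrow> real" where
  "X b x t \<omega> = x + c * t - (\<Sum>k=1..N t \<omega>. Y k \<omega>) - D b x t \<omega>"

definition ruin_time :: "(nat \<Rightarrow> real) \<Rightarrow> real \<Rightarrow> 'w \<Rightarrow> ereal" where
  "ruin_time b x \<omega> = (INF t\<in>{t. 0 \<le> t \<and> X b x t \<omega> < 0}. ereal t)"

text \<open>
  The value of the strategy. The integrands are nonnegative, hence the extended nonnegative
  integral; the value is at most \<open>x + c / \<delta>\<close> and in particular finite.
\<close>

definition f :: "(nat \<Rightarrow> real) \<Rightarrow> nat \<Rightarrow> real \<Rightarrow> ennreal" where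
  "f b i x = (\<integral>\<^sup>+\<omega>. (\<integral>\<^sup>+t\<in>{t. 0 \<le> t \<and> ereal t < ruin_time b x \<omega>}. ennreal (exp (- \<delta> * t))
                    \<partial>interval_measure (\<lambda>t. D b x t \<omega>)) \<partial>P i)"

text \<open>Only the values of \<open>b\<close> at the phases \<open>1\<close> and \<open>2\<close> matter.\<close>

definition optimal_barriers :: "(nat \<Rightarrow> real) \<Rightarrow> bool" where
  "optimal_barriers b \<longleftrightarrow> b \<in> {1, 2} \<rightarrow> {0..} \<and>
     (\<forall>i\<in>{1, 2}. \<forall>x\<in>{0..b i}. f b i x = (SUP b'\<in>{1, 2} \<rightarrow> {0..}. f b' i x))"

end

end

(*
The value of a barrier strategy is the expected sum, over the stays in the phases, of the discounted
dividends of a stay. As the surplus seen at the event epochs is Markovian, the value is the fixed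
point of the operator that adds one stay, a contraction with factor max (lam_i / (lam_i + delta)).
Hence replacing one barrier for a single stay is a policy improvement: if this does not decrease the
value function f of b anywhere, then the new barriers are at least as good as the modified function.

On (b 1, b 2) the function f_1 is affine with slope 1, so f = f_2 satisfies c f' = q f - H with an
explicit H, f'(b 2) = 1 and c f''(b 2) = q - H'(b 2). If H'(b 2) > q, raising the barrier b 2 a little
is an improvement, so f''(b 2) >= 0. If f'' > 0 on some [y, b 2), then f' < 1 there, and lowering the
barrier to y is an improvement. Finally f'' solves a second-order linear equation with real
characteristic roots r, s, and exp (- r x) f''(x) is monotone; together with the two facts at the end
point b 2 this leaves only f'' <= 0 on [b 1, b 2].
*)

theory Submission
  imports Defs "HOL-Real_Asymp.Real_Asymp"
begin

text \<open>Optimality compares stationary strategies only, whereas changing a barrier for one stay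
  and then returning to \<open>b\<close> is not stationary. A change is therefore used only when it
  dominates the old value at every surplus, and then it is iterated. Domination is easy to test:
  below the barrier the value of a stay, times the integrating factor
  \<open>exp (- q * u / c)\<close>, is a fixed function of the surplus plus a constant that carries
  all dependence on the barrier. Comparing barriers there amounts to comparing numbers, and a strict
  gain already shows at surplus 0, which lies in the range where \<open>optimal_barriers\<close>
  speaks. The equation for the second derivative closes because an exponential claim convolution
  satisfies a first-order equation, so one more differentiation eliminates the integral. Values are
  unbounded in the surplus; the contraction is run on a half-line containing both barriers, where
  the surplus lies after every event. Dividends are discounted by integrating their cumulated amount
  against an exponential clock of rate \<delta>, so that Stieltjes integrals disappear after one use
  of Fubini.\<close>

section \<open>The equations for the barriers\<close>

text \<open>Value of a stay begun at surplus \<open>u\<close> under the barrier \<open>y\<close>,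
  when \<open>q\<close> is the exit rate plus the discount rate and events at surplus
  \<open>z\<close> bring in value at rate \<open>H z\<close>. At the barrier the income
  \<open>c + H y\<close> flows until the end of the stay and is worth \<open>(c + H y) / q\<close>.
  Below it, time is replaced by the surplus \<open>z = u + c * t\<close>, whence the division by
  \<open>c\<close>, until \<open>y\<close> is reached after time \<open>(y - u) / c\<close>.\<close>

definition barrier_value :: "real \<Rightarrow> real \<Rightarrow> (real \<Rightarrow> real) \<Rightarrow> real \<Rightarrow> real \<Rightarrow> real" where
  "barrier_value c q H y u = (if y \<le> u then u - y + (c + H y) / q
     else integral {u..y} (\<lambda>z. exp (- q * (z - u) / c) * H z / c) + exp (- q * (y - u) / c) * ((c + H y) / q))"

text \<open>Multiplying by \<open>exp (- q * u / c)\<close> separates the variables: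
  \<open>u\<close> enters only through an indefinite integral and \<open>y\<close> only through a
  constant. Continuity in \<open>u\<close> and the comparison of barriers both rest on this
  form.\<close>

lemma barrier_value_integral:
  assumes "c \<noteq> 0" "0 \<le> u" "u \<le> y"
    and int: "(\<lambda>z. exp (- q * z / c) * H z / c) integrable_on {0..y}"
  shows "exp (- q * u / c) * barrier_value c q H y u =
    integral {0..y} (\<lambda>z. exp (- q * z / c) * H z / c) - integral {0..u} (\<lambda>z. exp (- q * z / c) * H z / c) +
    exp (- q * y / c) * ((c + H y) / q)"
    (is "_ = integral _ ?K - _ + _")
proof (cases "u = y")
  case True
  then show ?thesis
    by (simp add: barrier_value_def)
next
  case False
  have combine: "integral {0..u} ?K + integral {u..y} ?K =
      integral {0..y} ?K"
    using assms by (intro Henstock_Kurzweil_Integration.integral_combine) auto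
  have shift: "exp (- q * u / c) * exp (- q * (z - u) / c) = exp (- q * z / c)" for z
  proof -
    have "- q * u / c + - q * (z - u) / c = - q * z / c"
      using assms by (simp add: field_simps)
    then show ?thesis
      by (simp only: flip: exp_add)
  qed
  have "exp (- q * u / c) * integral {u..y} (\<lambda>z. exp (- q * (z - u) / c) * H z / c) =
      integral {u..y} ?K"
    by (subst integral_mult_right[symmetric]) (simp only: times_divide_eq_right mult.assoc[symmetric] shift)
  moreover have "exp (- q * u / c) * (exp (- q * (y - u) / c) * ((c + H y) / q)) = exp (- q * y / c) * ((c + H y) / q)"
    by (simp only: mult.assoc[symmetric] shift)
  moreover have "\<not> y \<le> u"
    using False assms by simp
  ultimately show ?thesis
    using combine by (simp only: barrier_value_def if_False distrib_left)
qed

text \<open>The analytic part, isolated from the probability. \<open>F1\<close> and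
  \<open>F2\<close> stand for the values in the two phases, \<open>q\<close> for the exit rate of
  phase 2 plus \<delta>, \<open>a\<close> and \<open>l\<close> for its intensities of a phase change
  and of a claim, \<open>W\<close> for the expected value after a claim. Optimality survives only as
  \<open>no_improvement\<close>, whose conclusion concerns the single surplus 0.\<close>

locale barrier_equations =
  fixes c \<beta> q a l p1 p2 b1 b2 :: real and F1 F2 W H :: "real \<Rightarrow> real"
  assumes pos: "c > 0" "\<beta> > 0" "q > 0"
    and lp2: "l * p2 < q"
    and b1: "0 < b1" and b12: "b1 < b2"
    and F1_cont: "continuous_on {0..} F1" and F2_cont: "continuous_on {0..} F2"
    and F1_linear: "\<And>u. b1 \<le> u \<Longrightarrow> F1 u = F1 b1 + (u - b1)"
    and W_eq: "\<And>z. 0 \<le> z \<Longrightarrow> W z = integral {0..z} (\<lambda>v. \<beta> * exp (- \<beta> * (z - v)) * (p1 * F1 v + p2 * F2 v))"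
    and H_eq: "\<And>z. 0 \<le> z \<Longrightarrow> H z = a * F1 z + l * W z"
    and F2_eq: "\<And>u. 0 \<le> u \<Longrightarrow> F2 u = barrier_value c q H b2 u"
    and no_improvement: "\<And>y. 0 \<le> y \<Longrightarrow> (\<And>u. 0 \<le> u \<Longrightarrow> F2 u \<le> barrier_value c q H y u) \<Longrightarrow>
      barrier_value c q H y 0 \<le> F2 0"
begin

text \<open>\<open>\<phi>\<close> is the mean value after a restart, \<open>h\<close> the derivative
  of \<open>H\<close> to the right of \<open>b1\<close>, \<open>E\<close> the integrating factor,
  and \<open>\<kappa> y\<close> the part of the value that depends on the barrier \<open>y\<close>.
  \<open>p\<close> and \<open>g\<close> are the first and second derivatives of \<open>F2\<close>
  between \<open>b1\<close> and \<open>b2\<close>, written through the equation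
  \<open>c * F2' = q * F2 - H\<close> so that they are defined and continuous on all of
  \<open>{0..}\<close>.\<close>

definition \<phi> where "\<phi> v = p1 * F1 v + p2 * F2 v"
definition h where "h x = a + l * (\<beta> * (\<phi> x - W x))"
definition E where "E x = exp (- q * x / c)"
definition \<Phi> where "\<Phi> x = - integral {0..x} (\<lambda>z. E z * H z / c)"
definition \<kappa> where "\<kappa> y = E y * ((c + H y) / q) - \<Phi> y"
definition p where "p x = (q * F2 x - H x) / c"
definition g where "g x = (q * p x - h x) / c"

lemma E_pos: "E x > 0"
  by (simp add: E_def)

lemma \<phi>_cont: "continuous_on {0..} \<phi>"
  unfolding \<phi>_def[abs_def] by (intro continuous_intros F1_cont F2_cont)

section \<open>Regularity of the convolution, of \<open>H\<close> and of the barrier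
  constant\<close>

lemma continuous_on_atLeast_imp_isCont:
  fixes f :: "real \<Rightarrow> real"
  assumes "continuous_on {0..} f" "x > 0"
  shows "isCont f x"
proof -
  have "continuous_on {0<..} f"
    using assms(1) by (rule continuous_on_subset) auto
  then show ?thesis
    using assms(2) by (simp add: continuous_on_eq_continuous_at)
qed

lemma integral_has_derivative_interior:
  fixes f :: "real \<Rightarrow> real"
  assumes "continuous_on {0..} f" "x > 0"
  shows "((\<lambda>x. integral {0..x} f) has_real_derivative f x) (at x)"
proof -
  have "continuous_on {0..x + 1} f"
    using assms(1) by (rule continuous_on_subset) auto
  then have "((\<lambda>x. integral {0..x} f) has_real_derivative f x) (at x within {0..x + 1})"
    using assms(2) by (intro integral_has_real_derivative) auto
  moreover have "at x within {0..x + 1} = at x"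
    using assms(2) by (intro at_within_interior) auto
  ultimately show ?thesis by simp
qed

lemma integral_continuous:
  fixes f :: "real \<Rightarrow> real"
  assumes "continuous_on {0..} f"
  shows "continuous_on {0..} (\<lambda>x. integral {0..x} f)"
  unfolding continuous_on_eq_continuous_within
proof
  fix x :: real assume x: "x \<in> {0..}"
  have "continuous_on {0..x + 1} f"
    using assms by (rule continuous_on_subset) auto
  then have "continuous_on {0..x + 1} (\<lambda>x. integral {0..x} f)"
    by (intro indefinite_integral_continuous_1 integrable_continuous_real)
  then have "continuous (at x within {0..x + 1}) (\<lambda>x. integral {0..x} f)"
    using x by (simp add: continuous_on_eq_continuous_within)
  moreover have "at x within {0..x + 1} = at x within {0..}"
    using x by (intro at_within_nhd[of _ "{..<x + 1}"]) auto
  ultimately show "continuous (at x within {0..}) (\<lambda>x. integral {0..x} f)"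
    by simp
qed

text \<open>The exponential claim density factors into a function of \<open>z\<close> and one of
  \<open>v\<close>. Hence \<open>W\<close> can be differentiated by the product rule, with the
  first-order equation \<open>W' = \<beta> * (\<phi> - W)\<close> as the result.\<close>

lemma W_eq': "0 \<le> z \<Longrightarrow> W z = exp (- \<beta> * z) * integral {0..z} (\<lambda>v. \<beta> * exp (\<beta> * v) * \<phi> v)"
  unfolding W_eq \<phi>_def
  by (subst integral_mult_right[symmetric])
     (auto intro!: integral_cong simp: algebra_simps simp flip: exp_add)

lemma W_cont: "continuous_on {0..} W"
proof -
  have "continuous_on {0..} (\<lambda>z. exp (- \<beta> * z) * integral {0..z} (\<lambda>v. \<beta> * exp (\<beta> * v) * \<phi> v))"
    by (intro continuous_intros integral_continuous \<phi>_cont)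
  then show ?thesis
    by (rule continuous_on_eq) (simp add: W_eq')
qed

lemma W_deriv:
  assumes "x > 0"
  shows "(W has_real_derivative \<beta> * (\<phi> x - W x)) (at x)"
proof -
  let ?W = "\<lambda>z. exp (- \<beta> * z) * integral {0..z} (\<lambda>v. \<beta> * exp (\<beta> * v) * \<phi> v)"
  let ?D = "exp (- \<beta> * x) * (\<beta> * exp (\<beta> * x) * \<phi> x) + - \<beta> * exp (- \<beta> * x) * integral {0..x} (\<lambda>v. \<beta> * exp (\<beta> * v) * \<phi> v)"
  have "(?W has_real_derivative
      ?D) (at x)"
    by (rule DERIV_cong[OF DERIV_mult[OF _ integral_has_derivative_interior[OF _ assms]]])
       (auto intro!: derivative_eq_intros continuous_intros \<phi>_cont)
  moreover have "?D
      = \<beta> * (\<phi> x - W x)"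
    using assms by (simp add: W_eq' algebra_simps exp_minus)
  ultimately have "(?W has_real_derivative \<beta> * (\<phi> x - W x)) (at x)"
    by simp
  then show ?thesis
  proof (rule has_field_derivative_transform_within_open)
    show "exp (- \<beta> * z) * integral {0..z} (\<lambda>v. \<beta> * exp (\<beta> * v) * \<phi> v) = W z" if "z \<in> {0<..}" for z
      using that by (simp add: W_eq')
  qed (use assms in auto)
qed

lemma H_cont: "continuous_on {0..} H"
proof -
  have "continuous_on {0..} (\<lambda>z. a * F1 z + l * W z)"
    by (intro continuous_intros F1_cont W_cont)
  then show ?thesis
    by (rule continuous_on_eq) (simp add: H_eq)
qed

lemma h_cont: "continuous_on {0..} h"
  unfolding h_def[abs_def] by (intro continuous_intros \<phi>_cont W_cont)

lemma F1_deriv: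
  assumes "b1 < x"
  shows "(F1 has_real_derivative 1) (at x)"
proof -
  have "((\<lambda>u. F1 b1 + (u - b1)) has_real_derivative 1) (at x)"
    by (auto intro!: derivative_eq_intros)
  then show ?thesis
  proof (rule has_field_derivative_transform_within_open)
    show "F1 b1 + (u - b1) = F1 u" if "u \<in> {b1<..}" for u
      using that F1_linear[of u] by simp
  qed (use assms in auto)
qed

lemma H_deriv:
  assumes "b1 < x"
  shows "(H has_real_derivative h x) (at x)"
proof -
  have "((\<lambda>z. a * F1 z + l * W z) has_real_derivative h x) (at x)"
    unfolding h_def using F1_deriv[OF assms] W_deriv[of x] assms b1
    by (auto intro!: derivative_eq_intros)
  then show ?thesis
  proof (rule has_field_derivative_transform_within_open)
    show "a * F1 z + l * W z = H z" if "z \<in> {b1<..}" for z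
      using that b1 by (simp add: H_eq)
  qed (use assms in auto)
qed

lemma E_deriv: "(E has_real_derivative - q / c * E x) (at x)"
  unfolding E_def[abs_def] using pos by (auto intro!: derivative_eq_intros)

lemma E_cont: "continuous_on S E"
  unfolding E_def[abs_def] using pos by (intro continuous_intros) auto

lemma EH_cont: "continuous_on {0..} (\<lambda>z. E z * H z / c)"
  using pos by (intro continuous_intros E_cont H_cont) auto

lemma \<Phi>_cont: "continuous_on {0..} \<Phi>"
  unfolding \<Phi>_def[abs_def] by (intro continuous_intros integral_continuous EH_cont)

lemma \<Phi>_deriv: "x > 0 \<Longrightarrow> (\<Phi> has_real_derivative - (E x * H x / c)) (at x)"
  unfolding \<Phi>_def[abs_def] by (intro DERIV_minus integral_has_derivative_interior EH_cont)

text \<open>The terms with \<open>H\<close> cancel, so the sign of \<open>h - q\<close> alone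
  decides whether raising the barrier pays.\<close>

lemma \<kappa>_deriv:
  assumes "b1 < x"
  shows "(\<kappa> has_real_derivative E x * (h x - q) / q) (at x)"
proof -
  have "x > 0"
    using assms b1 by linarith
  have "((\<lambda>y. (c + H y) / q) has_real_derivative (0 + h x) / q) (at x)"
    by (intro DERIV_cdivide DERIV_add DERIV_const H_deriv assms)
  from DERIV_diff[OF DERIV_mult[OF E_deriv this] \<Phi>_deriv[OF \<open>x > 0\<close>]]
  have "(\<kappa> has_real_derivative - q / c * E x * ((c + H x) / q) + (0 + h x) / q * E x - - (E x * H x / c)) (at x)"
    unfolding \<kappa>_def[abs_def] .
  also have "- q / c * E x * ((c + H x) / q) + (0 + h x) / q * E x - - (E x * H x / c) = E x * (h x - q) / q"
    using pos by (simp add: field_simps)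
  finally show ?thesis .
qed

text \<open>All dependence on the barrier sits in \<open>\<kappa> y\<close>: at a surplus below two
  barriers, the one with the larger \<open>\<kappa>\<close> has the larger value.\<close>

lemma barrier_value_below:
  assumes "0 \<le> u" "u \<le> y"
  shows "E u * barrier_value c q H y u = \<Phi> u + \<kappa> y"
proof -
  have "(\<lambda>z. exp (- q * z / c) * H z / c) integrable_on {0..y}"
    unfolding E_def[symmetric] by (intro integrable_continuous_real continuous_on_subset[OF EH_cont]) auto
  from barrier_value_integral[OF _ assms this] show ?thesis
    using pos by (simp add: \<kappa>_def \<Phi>_def E_def)
qed

lemma F2_below: "0 \<le> u \<Longrightarrow> u \<le> b2 \<Longrightarrow> E u * F2 u = \<Phi> u + \<kappa> b2"
  by (simp add: F2_eq barrier_value_below)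

lemma F2_above: "b2 \<le> u \<Longrightarrow> F2 u = u - b2 + (c + H b2) / q"
  using b1 b12 by (simp add: F2_eq barrier_value_def)

lemma p_b2: "p b2 = 1"
  using pos by (simp add: p_def F2_above)

lemma F2_eq_quotient: "0 \<le> u \<Longrightarrow> u \<le> b2 \<Longrightarrow> F2 u = (\<Phi> u + \<kappa> b2) / E u"
  using F2_below[of u] E_pos[of u] by (simp add: field_simps)

text \<open>The quotient continues the lower branch of \<open>F2\<close> beyond \<open>b2\<close>.
  Being differentiable at \<open>b2\<close> itself, it later supplies the left derivative of
  \<open>F2\<close> there.\<close>

lemma quotient_deriv:
  assumes "0 < x" "x \<le> b2"
  shows "((\<lambda>u. (\<Phi> u + \<kappa> b2) / E u) has_real_derivative p x) (at x)"
proof -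
  have E0: "E x \<noteq> 0"
    using E_pos[of x] by simp
  have "((\<lambda>u. (\<Phi> u + \<kappa> b2) / E u) has_real_derivative
      ((- (E x * H x / c)) * E x - (\<Phi> x + \<kappa> b2) * (- q / c * E x)) / (E x * E x)) (at x)"
    by (rule derivative_eq_intros E_deriv \<Phi>_deriv[OF assms(1)] E0 refl)+ simp
  also have "((- (E x * H x / c)) * E x - (\<Phi> x + \<kappa> b2) * (- q / c * E x)) / (E x * E x) = p x"
    using pos E0 assms F2_below[of x, symmetric] by (simp add: p_def field_simps)
  finally show ?thesis .
qed

lemma F2_deriv_below:
  assumes "0 < x" "x < b2"
  shows "(F2 has_real_derivative p x) (at x)"
proof (rule has_field_derivative_transform_within_open[where S = "{0<..<b2}"])
  show "((\<lambda>u. (\<Phi> u + \<kappa> b2) / E u) has_real_derivative p x) (at x)"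
    using assms by (intro quotient_deriv) auto
qed (use assms F2_eq_quotient in auto)

section \<open>Consequences of optimality at the upper barrier\<close>

lemma no_raise: "h b2 \<le> q"
proof (rule ccontr)
  assume "\<not> h b2 \<le> q"
  then have "q < h b2" by simp
  have b2: "b2 > 0"
    using b1 b12 by linarith
  have "isCont h b2"
    using h_cont b2 by (rule continuous_on_atLeast_imp_isCont)
  then have "\<forall>\<^sub>F x in at b2. q < h x"
    using \<open>q < h b2\<close> by (intro order_tendstoD) (auto simp: isCont_def)
  then obtain d where d: "d > 0" "\<And>x. x \<noteq> b2 \<Longrightarrow> dist x b2 < d \<Longrightarrow> q < h x"
    by (auto simp: eventually_at)
  \<comment> \<open>Half the radius keeps the closed interval from \<open>b2\<close> to
    \<open>y\<close> inside the neighbourhood where \<open>h > q\<close>; there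
    \<open>\<kappa>\<close> increases strictly.\<close>
  define y where "y = b2 + d / 2"
  have y: "b2 < y"
    using d by (simp add: y_def)
  have h_gt: "q < h x" if "b2 \<le> x" "x \<le> y" for x
    using d(2)[of x] that \<open>q < h b2\<close> \<open>d > 0\<close> by (cases "x = b2") (auto simp: y_def dist_real_def)
  have \<kappa>_less: "\<kappa> u < \<kappa> v" if "b2 \<le> u" "u < v" "v \<le> y" for u v
  proof (rule DERIV_pos_imp_increasing[OF \<open>u < v\<close>])
    fix x assume "u \<le> x" "x \<le> v"
    then have "E x * (h x - q) / q > 0"
      using h_gt[of x] that E_pos pos by simp
    then show "\<exists>y. (\<kappa> has_real_derivative y) (at x) \<and> 0 < y"
      using \<kappa>_deriv[of x] \<open>u \<le> x\<close> that b12 by (intro exI conjI) auto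
  qed
  \<comment> \<open>The right side is the value of a barrier placed exactly at the present surplus
    \<open>u\<close>. As \<open>H u - q * u\<close> increases here, staying at \<open>u\<close>
    beats paying \<open>u - b2\<close> at once.\<close>
  have \<Gamma>: "F2 u \<le> (c + H u) / q" if "b2 \<le> u" "u \<le> y" for u
  proof -
    have "H b2 - q * b2 \<le> H u - q * u"
    proof (rule DERIV_nonneg_imp_nondecreasing[OF \<open>b2 \<le> u\<close>])
      fix x assume "b2 \<le> x" "x \<le> u"
      then have "((\<lambda>u. H u - q * u) has_real_derivative h x - q) (at x)"
        using b12 by (auto intro!: derivative_eq_intros H_deriv)
      then show "\<exists>y. ((\<lambda>u. H u - q * u) has_real_derivative y) (at x) \<and> 0 \<le> y"
        using h_gt[of x] \<open>b2 \<le> x\<close> \<open>x \<le> u\<close> that by (intro exI conjI) auto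
    qed
    then have "(u - b2) * q \<le> H u - H b2"
      by (simp add: algebra_simps)
    then have "u - b2 \<le> (H u - H b2) / q"
      using pos by (simp only: pos_le_divide_eq)
    then show ?thesis
      using that by (simp add: F2_above diff_divide_distrib add_divide_distrib)
  qed
  have "F2 u \<le> barrier_value c q H y u" if "0 \<le> u" for u
  proof -
    consider "u \<le> b2" | "b2 < u" "u \<le> y" | "y < u"
      by linarith
    then show ?thesis
    proof cases
      case 1
      then have "E u * F2 u \<le> E u * barrier_value c q H y u"
        using that y \<kappa>_less[of b2 y] by (simp add: F2_below barrier_value_below)
      then show ?thesis
        using E_pos[of u] by simp
    next
      case 2
      \<comment> \<open>Between the two barriers the comparison passes through the barrier
        \<open>u\<close> itself: its value dominates \<open>F2 u\<close> by \<open>\<Gamma>\<close>,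
        and moving it up to \<open>y\<close> raises \<open>\<kappa>\<close>.\<close>
      have "E u * ((c + H u) / q) = \<Phi> u + \<kappa> u"
        by (simp add: \<kappa>_def)
      also have "\<dots> \<le> E u * barrier_value c q H y u"
        using 2 that \<kappa>_less[of u y] by (cases "u = y") (auto simp: barrier_value_below)
      finally have "(c + H u) / q \<le> barrier_value c q H y u"
        using E_pos[of u] by (simp only: mult_le_cancel_left_pos)
      with \<Gamma>[of u] 2 show ?thesis by simp
    next
      case 3
      then show ?thesis
        using \<Gamma>[of y] y by (simp add: barrier_value_def F2_above)
    qed
  qed
  then have "barrier_value c q H y 0 \<le> F2 0"
    using y b2 by (intro no_improvement) auto
  moreover have "E 0 * F2 0 < E 0 * barrier_value c q H y 0"
    using y b2 \<kappa>_less[of b2 y] by (simp add: F2_below barrier_value_below)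
  ultimately show False
    using E_pos[of 0] by simp
qed

lemma p_deriv:
  assumes "b1 < x" "x < b2"
  shows "(p has_real_derivative g x) (at x)"
proof -
  have "((\<lambda>x. (q * F2 x - H x) / c) has_real_derivative (q * p x - h x) / c) (at x)"
    using assms b1 by (intro DERIV_cdivide DERIV_diff DERIV_cmult F2_deriv_below H_deriv) auto
  then show ?thesis
    unfolding p_def[abs_def, symmetric] g_def .
qed

lemma p_cont: "continuous_on {0..} p"
  unfolding p_def[abs_def] using pos by (intro continuous_intros F2_cont H_cont) auto

lemma g_cont: "continuous_on {0..} g"
  unfolding g_def[abs_def] using pos by (intro continuous_intros p_cont h_cont) auto

lemma no_lower:
  assumes "b1 \<le> y" "y < b2"
  shows "\<not> (\<forall>x\<in>{y..<b2}. g x > 0)"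
proof
  assume g_pos: "\<forall>x\<in>{y..<b2}. g x > 0"
  \<comment> \<open>A positive \<open>g\<close> makes \<open>p\<close> increase strictly up to its
    value 1 at \<open>b2\<close>.\<close>
  have p_less: "p x < 1" if "y \<le> x" "x < b2" for x
  proof -
    have "p x < p b2"
    proof (rule DERIV_pos_imp_increasing_open[OF \<open>x < b2\<close>])
      fix z assume "x < z" "z < b2"
      then show "\<exists>y. (p has_real_derivative y) (at z) \<and> 0 < y"
        using g_pos p_deriv[of z] that assms by (intro exI[of _ "g z"]) auto
    next
      show "continuous_on {x..b2} p"
        using p_cont by (rule continuous_on_subset) (use that assms b1 in auto)
    qed
    then show ?thesis by (simp add: p_b2)
  qed
  have y: "0 < y"
    using assms b1 by linarith
  \<comment> \<open>By the definition of \<open>p\<close>, a slope below 1 at \<open>y\<close> says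
    exactly that settling at the barrier \<open>y\<close> is worth more than \<open>F2 y\<close>. In
    terms of \<open>\<kappa>\<close>, lowering the barrier to \<open>y\<close> increases the
    constant.\<close>
  have \<Gamma>: "F2 y < (c + H y) / q"
    using p_less[of y] assms pos by (simp add: p_def field_simps)
  have "E y * F2 y < E y * ((c + H y) / q)"
    using \<Gamma> E_pos[of y] by (simp only: mult_less_cancel_left_pos)
  then have \<kappa>: "\<kappa> b2 < \<kappa> y"
    using F2_below[of y] y assms by (simp add: \<kappa>_def)
  \<comment> \<open>Above \<open>y\<close> the modified strategy pays the excess at once, so its
    value has slope 1, while \<open>F2\<close> has slope at most 1 there.\<close>
  have above: "F2 u \<le> F2 y + (u - y)" if "y \<le> u" for u
  proof -
    have le: "F2 v \<le> F2 y + (v - y)" if "y \<le> v" "v \<le> b2" for v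
    proof -
      have "F2 v - v \<le> F2 y - y"
      proof (rule DERIV_nonpos_imp_decreasing_open[OF \<open>y \<le> v\<close>])
        fix x assume x: "y < x" "x < v"
        then have "((\<lambda>u. F2 u - u) has_real_derivative p x - 1) (at x)"
          using that y by (auto intro!: derivative_eq_intros F2_deriv_below)
        then show "\<exists>y. ((\<lambda>u. F2 u - u) has_real_derivative y) (at x) \<and> y \<le> 0"
          using p_less[of x] x that by (intro exI conjI) auto
      next
        show "continuous_on {y..v} (\<lambda>u. F2 u - u)"
          using y by (intro continuous_intros continuous_on_subset[OF F2_cont]) auto
      qed
      then show ?thesis by simp
    qed
    show ?thesis
      using le[of u] le[of b2] that assms by (cases "u \<le> b2") (auto simp: F2_above)
  qed
  have "F2 u \<le> barrier_value c q H y u" if "0 \<le> u" for u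
  proof (cases "u \<le> y")
    case True
    then have "E u * F2 u \<le> E u * barrier_value c q H y u"
      using that assms \<kappa> by (simp add: F2_below barrier_value_below)
    then show ?thesis
      using E_pos[of u] by simp
  next
    case False
    then show ?thesis
      using above[of u] \<Gamma> by (simp add: barrier_value_def)
  qed
  then have "barrier_value c q H y 0 \<le> F2 0"
    using y by (intro no_improvement) auto
  moreover have "E 0 * F2 0 < E 0 * barrier_value c q H y 0"
    using y assms \<kappa> by (simp add: F2_below barrier_value_below)
  ultimately show False
    using E_pos[of 0] by simp
qed

text \<open>Differentiating \<open>h\<close> reproduces the combination
  \<open>\<phi> x - W x\<close>, and the definition of \<open>g\<close> expresses that combination
  through \<open>p\<close> and \<open>g\<close>. The claim integral drops out, \<open>F1\<close>
  contributes only its slope 1, and a linear equation with constant coefficients remains.\<close>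

lemma g_deriv:
  assumes "b1 < x" "x < b2"
  shows "(g has_real_derivative (q - c * \<beta>) / c * g x + \<beta> * (q - l * p2) / c * p x - \<beta> * (l * p1 + a) / c) (at x)"
proof -
  have x: "0 < x"
    using assms b1 by linarith
  have "(\<phi> has_real_derivative p1 * 1 + p2 * p x) (at x)"
    unfolding \<phi>_def[abs_def] using assms x by (intro DERIV_add DERIV_cmult F1_deriv F2_deriv_below)
  then have "(h has_real_derivative 0 + l * (\<beta> * (p1 * 1 + p2 * p x - \<beta> * (\<phi> x - W x)))) (at x)"
    unfolding h_def[abs_def] by (intro DERIV_add DERIV_const DERIV_cmult DERIV_diff W_deriv x)
  then have "(g has_real_derivative (q * g x - (0 + l * (\<beta> * (p1 * 1 + p2 * p x - \<beta> * (\<phi> x - W x))))) / c) (at x)"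
    unfolding g_def[abs_def] using assms
    by (intro DERIV_cdivide DERIV_diff DERIV_cmult p_deriv[unfolded g_def])
  moreover have "(q * g x - (0 + l * (\<beta> * (p1 * 1 + p2 * p x - \<beta> * (\<phi> x - W x))))) / c =
      (q - c * \<beta>) / c * g x + \<beta> * (q - l * p2) / c * p x - \<beta> * (l * p1 + a) / c"
  proof -
    have h: "l * (\<beta> * (\<phi> x - W x)) = q * p x - c * g x - a"
      using pos by (simp add: g_def h_def)
    have "q * g x - (0 + l * (\<beta> * (p1 * 1 + p2 * p x - \<beta> * (\<phi> x - W x)))) =
        q * g x - l * \<beta> * p1 - l * \<beta> * p2 * p x + \<beta> * (l * (\<beta> * (\<phi> x - W x)))"
      by (simp add: algebra_simps)
    also have "\<dots> = (q - c * \<beta>) * g x + \<beta> * (q - l * p2) * p x - \<beta> * (l * p1 + a)"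
      unfolding h by (simp add: algebra_simps)
    finally have eq: "q * g x - (0 + l * (\<beta> * (p1 * 1 + p2 * p x - \<beta> * (\<phi> x - W x)))) =
        (q - c * \<beta>) * g x + \<beta> * (q - l * p2) * p x - \<beta> * (l * p1 + a)" .
    show ?thesis
      unfolding eq using pos by (simp add: field_simps)
  qed
  ultimately show ?thesis
    by simp
qed

text \<open>Since \<open>l * p2 < q\<close>, the characteristic polynomial of the linear equation for the second
  derivative \<open>g\<close> has two real roots \<open>r\<close> and \<open>s\<close>. Hence the derivative of \<open>exp (- r * x) * g x\<close> is a
  multiple of an exponential function and \<open>g\<close> changes its sign at most once.\<close>

lemma g_sign:
  obtains r K s where
    "\<And>x. b1 < x \<Longrightarrow> x < b2 \<Longrightarrow> ((\<lambda>x. exp (- r * x) * g x) has_real_derivative K * exp (s * x)) (at x)"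
proof -
  define k where "k = (q - c * \<beta>) / c"
  define m where "m = \<beta> * (q - l * p2) / c"
  define n where "n = \<beta> * (l * p1 + a) / c"
  \<comment> \<open>\<open>r\<close> and \<open>s\<close> are the roots of
    \<open>X\<^sup>2 - k * X - m\<close>, real because \<open>m > 0\<close>; \<open>n / m\<close> is
    the stationary solution for \<open>p\<close>.\<close>
  define r where "r = (k + sqrt (k\<^sup>2 + 4 * m)) / 2"
  define s where "s = (k - sqrt (k\<^sup>2 + 4 * m)) / 2"
  have m: "m > 0"
    using pos lp2 by (simp add: m_def)
  have sum: "r + s = k"
    by (simp add: r_def s_def field_simps)
  have "sqrt (k\<^sup>2 + 4 * m) * sqrt (k\<^sup>2 + 4 * m) = k\<^sup>2 + 4 * m"
    using m by simp
  then have prod: "r * s = - m"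
    by (simp add: r_def s_def field_simps power2_eq_square)
  \<comment> \<open>This factors the second-order operator: with \<open>v = p - n / m\<close> the
    function \<open>z = v' - r * v\<close> is annihilated by the remaining factor, so
    \<open>z' = s * z\<close> and \<open>z\<close> is a pure exponential.\<close>
  define z where "z x = g x - r * (p x - n / m)" for x
  have g_deriv': "(g has_real_derivative r * g x + s * z x) (at x)" if "b1 < x" "x < b2" for x
  proof -
    have "k * g x + m * p x - n = (r + s) * g x - r * s * (p x - n / m)"
      using m by (simp add: sum prod field_simps)
    also have "\<dots> = r * g x + s * z x"
      by (simp add: z_def algebra_simps)
    finally show ?thesis
      using g_deriv[OF that] by (simp add: k_def m_def n_def)
  qed
  have z_cont: "continuous_on {b1..b2} z"
    unfolding z_def[abs_def] using b1
    by (intro continuous_intros continuous_on_subset[OF g_cont] continuous_on_subset[OF p_cont]) auto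
  have z_deriv: "((\<lambda>x. exp (- s * x) * z x) has_real_derivative 0) (at x)" if "b1 < x" "x < b2" for x
  proof -
    have "(z has_real_derivative (r * g x + s * z x) - r * (g x - 0)) (at x)"
      unfolding z_def[abs_def] using that
      by (intro DERIV_diff DERIV_cmult DERIV_const p_deriv g_deriv'[unfolded z_def])
    then have z: "(z has_real_derivative s * z x) (at x)"
      by simp
    have "((\<lambda>x. exp (- s * x)) has_real_derivative - s * exp (- s * x)) (at x)"
      by (auto intro!: derivative_eq_intros)
    from DERIV_mult[OF this z] show ?thesis
      by (simp add: algebra_simps)
  qed
  define K where "K = exp (- s * b1) * z b1"
  have z_eq: "z x = K * exp (s * x)" if "b1 < x" "x < b2" for x
  proof -
    have "exp (- s * x) * z x = exp (- s * b1) * z b1"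
      using that z_deriv z_cont
      by (intro DERIV_isconst2[OF b12]) (auto intro!: continuous_intros)
    then show ?thesis
      by (simp add: K_def exp_minus field_simps)
  qed
  show ?thesis
  proof (rule that[of r "s * K" "s - r"])
    fix x assume x: "b1 < x" "x < b2"
    have "((\<lambda>x. exp (- r * x)) has_real_derivative - r * exp (- r * x)) (at x)"
      by (auto intro!: derivative_eq_intros)
    from DERIV_mult[OF this g_deriv'[OF x]]
    have "((\<lambda>x. exp (- r * x) * g x) has_real_derivative s * z x * exp (- r * x)) (at x)"
      by (simp add: algebra_simps)
    also have "s * z x * exp (- r * x) = s * K * exp ((s - r) * x)"
      by (simp add: z_eq[OF x] left_diff_distrib exp_diff exp_minus field_simps)
    finally show "((\<lambda>x. exp (- r * x) * g x) has_real_derivative s * K * exp ((s - r) * x)) (at x)" .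
  qed
qed

text \<open>The exclusion of raising gives \<open>g b2 \<ge> 0\<close> and that of lowering gives
  \<open>g b2 \<le> 0\<close>, so \<open>g\<close> vanishes at \<open>b2\<close>. If
  \<open>K\<close> is nonnegative, \<open>exp (- r * x) * g x\<close> increases up to 0. If
  \<open>K\<close> is negative, it decreases strictly to 0 and \<open>g\<close> is positive on the
  whole of \<open>{b1..<b2}\<close>, which is excluded by lowering the barrier to
  \<open>b1\<close>.\<close>

lemma g_nonpos:
  assumes "b1 \<le> x" "x \<le> b2"
  shows "g x \<le> 0"
proof -
  obtain r K s where
    deriv: "\<And>x. b1 < x \<Longrightarrow> x < b2 \<Longrightarrow> ((\<lambda>x. exp (- r * x) * g x) has_real_derivative K * exp (s * x)) (at x)"
    using g_sign by blast
  have cont: "continuous_on {u..v} (\<lambda>x. exp (- r * x) * g x)" if "b1 \<le> u" for u v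
    using that b1 by (intro continuous_intros continuous_on_subset[OF g_cont]) auto
  have g_b2: "g b2 \<ge> 0"
    using no_raise pos by (simp add: g_def p_b2)
  have "g b2 \<le> 0"
  proof (rule ccontr)
    assume "\<not> g b2 \<le> 0"
    moreover have "isCont g b2"
      using g_cont b1 b12 by (intro continuous_on_atLeast_imp_isCont) auto
    ultimately have "\<forall>\<^sub>F x in at b2. 0 < g x"
      by (intro order_tendstoD) (auto simp: isCont_def)
    then obtain d where d: "d > 0" "\<And>x. x \<noteq> b2 \<Longrightarrow> dist x b2 < d \<Longrightarrow> 0 < g x"
      by (auto simp: eventually_at)
    \<comment> \<open>The maximum with \<open>b1\<close> keeps \<open>y\<close> in the range where
      \<open>p' = g\<close> is available.\<close>
    define y where "y = max b1 (b2 - d / 2)"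
    have "\<forall>x\<in>{y..<b2}. g x > 0"
      using d by (auto simp: y_def dist_real_def)
    then show False
      using no_lower[of y] d b12 by (auto simp: y_def)
  qed
  show ?thesis
  proof (cases "K \<ge> 0")
    case True
    have "exp (- r * x) * g x \<le> exp (- r * b2) * g b2"
    proof (rule DERIV_nonneg_imp_increasing_open[OF assms(2)])
      fix z assume "x < z" "z < b2"
      then show "\<exists>y. ((\<lambda>x. exp (- r * x) * g x) has_real_derivative y) (at z) \<and> 0 \<le> y"
        using True assms deriv[of z] by (intro exI[of _ "K * exp (s * z)"]) auto
    qed (rule cont[OF assms(1)])
    also have "\<dots> \<le> 0"
      using \<open>g b2 \<le> 0\<close> by (simp add: mult_le_0_iff)
    finally show ?thesis
      by (simp add: mult_le_0_iff)
  next
    case False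
    have "g y > 0" if y: "b1 \<le> y" "y < b2" for y
    proof -
      have "exp (- r * b2) * g b2 < exp (- r * y) * g y"
      proof (rule DERIV_neg_imp_decreasing_open[OF y(2)])
        fix z assume "y < z" "z < b2"
        then show "\<exists>w. ((\<lambda>x. exp (- r * x) * g x) has_real_derivative w) (at z) \<and> w < 0"
          using False y deriv[of z] by (intro exI[of _ "K * exp (s * z)"]) (auto simp: mult_less_0_iff)
      qed (rule cont[OF y(1)])
      moreover have "0 \<le> exp (- r * b2) * g b2"
        using g_b2 by simp
      ultimately have "0 < exp (- r * y) * g y"
        by linarith
      then show ?thesis
        by (simp add: zero_less_mult_iff)
    qed
    then show ?thesis
      using no_lower[of b1] b12 by auto
  qed
qed

text \<open>The two branches of \<open>F2\<close> fit smoothly at \<open>b2\<close>: the lower one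
  has slope \<open>p b2 = 1\<close> there, which is the slope of the upper one. As
  \<open>b1 > 0\<close>, the derivative is two-sided at the left end \<open>b1\<close> as
  well.\<close>

lemma F2_concave: "concave_on {b1..} F2"
proof -
  define F2' where "F2' x = (if x \<le> b2 then p x else 1)" for x
  have deriv: "(F2 has_real_derivative F2' x) (at x)" if "b1 \<le> x" for x
  proof -
    consider "x < b2" | "x = b2" | "b2 < x"
      by linarith
    then show ?thesis
    proof cases
      case 1
      then show ?thesis
        using F2_deriv_below[of x] that b1 by (simp add: F2'_def)
    next
      case 2
      have right: "((\<lambda>y. (F2 y - F2 b2) / (y - b2)) \<longlongrightarrow> 1) (at_right b2)"
      proof (rule tendsto_eventually)
        show "\<forall>\<^sub>F y in at_right b2. (F2 y - F2 b2) / (y - b2) = 1"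
          by (auto simp: eventually_at_filter F2_above intro!: eventuallyI)
      qed
      \<comment> \<open>The continued lower branch is differentiable at \<open>b2\<close>, and on
        the left its difference quotient is that of \<open>F2\<close>.\<close>
      have left: "((\<lambda>y. (F2 y - F2 b2) / (y - b2)) \<longlongrightarrow> p b2) (at_left b2)"
      proof -
        have "((\<lambda>u. (\<Phi> u + \<kappa> b2) / E u) has_real_derivative p b2) (at b2)"
          using b1 b12 by (intro quotient_deriv) auto
        then have "((\<lambda>y. ((\<Phi> y + \<kappa> b2) / E y - (\<Phi> b2 + \<kappa> b2) / E b2) / (y - b2)) \<longlongrightarrow> p b2) (at_left b2)"
          unfolding has_field_derivative_iff by (rule tendsto_within_subset) simp
        moreover have "\<forall>\<^sub>F y in at_left b2. 0 < y"
          using b1 b12 by (intro order_tendstoD(1)[OF tendsto_ident_at]) auto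
        then have "\<forall>\<^sub>F y in at_left b2. ((\<Phi> y + \<kappa> b2) / E y - (\<Phi> b2 + \<kappa> b2) / E b2) / (y - b2) = (F2 y - F2 b2) / (y - b2)"
          unfolding eventually_at_filter by eventually_elim (use b1 b12 F2_eq_quotient in auto)
        ultimately show ?thesis
          by (rule Lim_transform_eventually)
      qed
      show ?thesis
        using left right unfolding 2 has_field_derivative_iff
        by (intro filterlim_split_at_real) (auto simp: F2'_def p_b2)
    next
      case 3
      have "((\<lambda>u. u - b2 + (c + H b2) / q) has_real_derivative 1) (at x)"
        by (auto intro!: derivative_eq_intros)
      then have "(F2 has_real_derivative 1) (at x)"
        by (rule has_field_derivative_transform_within_open[where S = "{b2<..}"]) (use 3 F2_above in auto)
      then show ?thesis
        using 3 by (simp add: F2'_def)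
    qed
  qed
  have antimono: "F2' y \<le> F2' x" if "b1 \<le> x" "x \<le> y" for x y
  proof -
    have p: "p v \<le> p u" if "b1 \<le> u" "u \<le> v" "v \<le> b2" for u v
    proof (rule DERIV_nonpos_imp_decreasing_open[OF \<open>u \<le> v\<close>])
      fix z assume "u < z" "z < v"
      then show "\<exists>y. (p has_real_derivative y) (at z) \<and> y \<le> 0"
        using that p_deriv[of z] g_nonpos[of z] by (intro exI[of _ "g z"]) auto
    next
      show "continuous_on {u..v} p"
        using that b1 by (intro continuous_on_subset[OF p_cont]) auto
    qed
    show ?thesis
      using p[of x y] p[of x b2] that p_b2 by (auto simp: F2'_def)
  qed
  show ?thesis
    unfolding concave_on_def
    by (rule convex_on_realI[where f' = "\<lambda>x. - F2' x"]) (auto intro!: DERIV_minus deriv antimono)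
qed

end

section \<open>Integrals and product measures\<close>

lemma sets_PiM_greaterThan:
  assumes "finite I"
  shows "sets (\<Pi>\<^sub>M i\<in>I. borel :: real measure) =
    sigma_sets (I \<rightarrow>\<^sub>E UNIV) {\<Pi>\<^sub>E i\<in>I. {t i<..} |t. True}"
proof -
  have "sets (\<Pi>\<^sub>M i\<in>I. borel :: real measure) = sets (\<Pi>\<^sub>M i\<in>I. sigma UNIV (range greaterThan) :: real measure)"
    by (simp only: borel_Ioi[symmetric])
  also have "\<dots> = sets (sigma (I \<rightarrow>\<^sub>E UNIV) {Pi\<^sub>E I F |F. \<forall>i\<in>I. F i \<in> range greaterThan})"
  proof (subst sets_PiM_sigma[where J = "{I}"])
    fix i :: 'a
    show "\<exists>S \<subseteq> range greaterThan. countable S \<and> UNIV = \<Union>(S :: real set set)"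
    proof (intro exI[of _ "range (\<lambda>n. {- real n<..})"] conjI)
      show "UNIV = \<Union>(range (\<lambda>n. {- real n<..}))"
        using reals_Archimedean2 by (auto simp: minus_less_iff)
    qed auto
  qed (use assms in \<open>auto simp: Pi_iff PiE_def intro!: arg_cong[where f = sets] arg_cong2[where f = sigma]\<close>)
  also have "{Pi\<^sub>E I F |F. \<forall>i\<in>I. F i \<in> range greaterThan} = {\<Pi>\<^sub>E i\<in>I. {t i<..} |t. True}" (is "?A = ?B")
  proof (intro equalityI subsetI)
    fix X assume "X \<in> ?A"
    then obtain F where X: "X = Pi\<^sub>E I F" and "\<forall>i\<in>I. F i \<in> range greaterThan"
      by auto
    then have "\<forall>i\<in>I. \<exists>a. F i = {a<..}"
      by (metis rangeE)
    then obtain t where "\<forall>i\<in>I. F i = {t i<..}"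
      by metis
    then have "X = (\<Pi>\<^sub>E i\<in>I. {t i<..})"
      unfolding X by (intro PiE_cong) auto
    then show "X \<in> ?B"
      by auto
  qed auto
  finally show ?thesis
    by (subst (asm) sets_measure_of) (auto simp: PiE_def)
qed

text \<open>Boxes of upper rays form an intersection-stable generator. A finite measure is thus
  determined by joint survival probabilities, the form in which \<open>chain_law\<close> describes
  the holding times.\<close>

lemma measure_eqI_PiM_greaterThan:
  assumes "finite I" and sets: "sets M = sets (\<Pi>\<^sub>M i\<in>I. borel :: real measure)"
      "sets N = sets (\<Pi>\<^sub>M i\<in>I. borel :: real measure)"
    and finite: "finite_measure M"
    and eq: "\<And>t. emeasure M (\<Pi>\<^sub>E i\<in>I. {t i<..}) = emeasure N (\<Pi>\<^sub>E i\<in>I. {t i<..})"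
  shows "M = N"
proof (rule measure_eqI_generator_eq)
  let ?E = "{\<Pi>\<^sub>E i\<in>I. {t i<..} |t. True} :: ('a \<Rightarrow> real) set set"
  show "Int_stable ?E"
  proof (rule Int_stableI)
    fix a b assume "a \<in> ?E" "b \<in> ?E"
    then obtain s t where ab: "a = (\<Pi>\<^sub>E i\<in>I. {s i<..})" "b = (\<Pi>\<^sub>E i\<in>I. {t i<..})"
      by auto
    have "a \<inter> b = (\<Pi>\<^sub>E i\<in>I. {max (s i) (t i)<..})"
      unfolding ab PiE_Int by (rule PiE_cong) auto
    then show "a \<inter> b \<in> ?E"
      by auto
  qed
  show "?E \<subseteq> Pow (I \<rightarrow>\<^sub>E UNIV)"
    by (auto simp: PiE_def)
  show "sets M = sigma_sets (I \<rightarrow>\<^sub>E UNIV) ?E" "sets N = sigma_sets (I \<rightarrow>\<^sub>E UNIV) ?E"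
    using sets sets_PiM_greaterThan[OF assms(1)] by auto
  show "emeasure M X = emeasure N X" if "X \<in> ?E" for X
    using that eq by auto
  show "range (\<lambda>n. \<Pi>\<^sub>E i\<in>I. {- real n<..}) \<subseteq> ?E"
    by auto
  show "(\<Union>n. \<Pi>\<^sub>E i\<in>I. {- real n<..}) = I \<rightarrow>\<^sub>E UNIV"
  proof (intro equalityI subsetI)
    fix f :: "'a \<Rightarrow> real" assume f: "f \<in> I \<rightarrow>\<^sub>E UNIV"
    \<comment> \<open>Inserting 0 covers an empty index set.\<close>
    obtain n where n: "Max (insert 0 ((\<lambda>i. - f i) ` I)) < real n"
      using reals_Archimedean2 by blast
    have "- f i < real n" if "i \<in> I" for i
      using n that assms(1) by (subst (asm) Max_less_iff) auto
    then have "f \<in> (\<Pi>\<^sub>E i\<in>I. {- real n<..})"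
      using f by (auto simp: PiE_iff minus_less_iff)
    then show "f \<in> (\<Union>n. \<Pi>\<^sub>E i\<in>I. {- real n<..})"
      by blast
  qed (auto simp: PiE_def)
  show "emeasure M (\<Pi>\<^sub>E i\<in>I. {- real n<..}) \<noteq> \<infinity>" for n
    using finite_measure.emeasure_finite[OF finite] by simp
qed

text \<open>Continuity is deliberately not assumed: for the value functions it is itself derived
  from integral representations.\<close>

lemma bounded_measurable_integrable_on:
  fixes g :: "real \<Rightarrow> real"
  assumes [measurable]: "g \<in> borel_measurable borel" and "\<And>z. z \<in> {a..b} \<Longrightarrow> \<bar>g z\<bar> \<le> M"
  shows "g integrable_on {a..b}"
proof (rule set_borel_integral_eq_integral)
  show "set_integrable lborel {a..b} g"
    unfolding set_integrable_def
    by (rule integrableI_bounded_set_indicator[where B = M]) (use assms(2) in \<open>auto simp: emeasure_lborel_Icc_eq\<close>)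
qed

lemma nn_integral_exp_tail:
  assumes "q > 0"
  shows "(\<integral>\<^sup>+t. ennreal (q * exp (- q * t)) * indicator {a..} t \<partial>lborel) = ennreal (exp (- q * a))"
proof -
  have "((\<lambda>t. - exp (- q * t)) \<longlongrightarrow> 0) at_top"
    using assms by real_asymp
  then have "(\<integral>\<^sup>+t. ennreal (q * exp (- q * t)) * indicator {a..} t \<partial>lborel) = ennreal (0 - - exp (- q * a))"
    using assms by (intro nn_integral_FTC_atLeast) (auto intro!: derivative_eq_intros)
  then show ?thesis by simp
qed

text \<open>The minimum of two independent exponential times is exponential with the sum of the
  rates. In the application one of them is the length of a stay, the other the discounting clock of
  rate \<delta>.\<close>

lemma nn_integral_min_exponential:
  assumes "p > 0" "q > 0" and [measurable]: "g \<in> borel_measurable borel"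
  shows "(\<integral>\<^sup>+t. ennreal (p * exp (- p * t)) *
      (\<integral>\<^sup>+v. ennreal (q * exp (- q * v)) * g (min v t) * indicator {0..} v \<partial>lborel) * indicator {0..} t \<partial>lborel) =
    (\<integral>\<^sup>+s. ennreal ((p + q) * exp (- (p + q) * s)) * g s * indicator {0..} s \<partial>lborel)"
proof -
  let ?pe = "\<lambda>t. ennreal (p * exp (- p * t))"
  let ?p = "\<lambda>t. ?pe t * indicator {0..} t" and ?q = "\<lambda>v. ennreal (q * exp (- q * v)) * indicator {0..} v"
  let ?A = "\<lambda>t v. ?p t * ?q v * g v * indicator {..t} v"
  let ?B = "\<lambda>t v. ?p t * ?q v * g v * indicator {z. snd z \<le> fst z} (t, v)"
  have "(\<integral>\<^sup>+t. ?pe t *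
      (\<integral>\<^sup>+v. ennreal (q * exp (- q * v)) * g (min v t) * indicator {0..} v \<partial>lborel) * indicator {0..} t \<partial>lborel) =
    (\<integral>\<^sup>+t. (\<integral>\<^sup>+v. ?A t v \<partial>lborel) + ?p t * g t * (\<integral>\<^sup>+v. ?q v * indicator {t..} v \<partial>lborel) \<partial>lborel)"
  proof (rule nn_integral_cong)
    fix t
    have "?pe t *
        (\<integral>\<^sup>+v. ennreal (q * exp (- q * v)) * g (min v t) * indicator {0..} v \<partial>lborel) * indicator {0..} t =
      (\<integral>\<^sup>+v. ?p t * (ennreal (q * exp (- q * v)) * g (min v t) * indicator {0..} v) \<partial>lborel)"
      by (subst nn_integral_cmult) (simp_all add: mult_ac)
    also have "\<dots> = (\<integral>\<^sup>+v. ?A t v + ?p t * g t * (?q v * indicator {t..} v) \<partial>lborel)"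
    proof (rule nn_integral_cong_AE)
      \<comment> \<open>Both pieces contain the diagonal \<open>v = t\<close>, which is a null
        set.\<close>
      show "AE v in lborel. ?p t * (ennreal (q * exp (- q * v)) * g (min v t) * indicator {0..} v) =
          ?A t v + ?p t * g t * (?q v * indicator {t..} v)"
        using AE_lborel_singleton[of t] by eventually_elim (auto simp: indicator_def min_def mult_ac)
    qed
    also have "\<dots> = (\<integral>\<^sup>+v. ?A t v \<partial>lborel) + ?p t * g t * (\<integral>\<^sup>+v. ?q v * indicator {t..} v \<partial>lborel)"
    proof -
      have "(\<integral>\<^sup>+v. ?p t * g t * (?q v * indicator {t..} v) \<partial>lborel) = ?p t * g t * (\<integral>\<^sup>+v. ?q v * indicator {t..} v \<partial>lborel)"
        by (rule nn_integral_cmult) measurable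
      moreover have "(\<integral>\<^sup>+v. ?A t v + ?p t * g t * (?q v * indicator {t..} v) \<partial>lborel) =
          (\<integral>\<^sup>+v. ?A t v \<partial>lborel) + (\<integral>\<^sup>+v. ?p t * g t * (?q v * indicator {t..} v) \<partial>lborel)"
        by (rule nn_integral_add) measurable
      ultimately show ?thesis
        by (simp only:)
    qed
    finally show "?pe t *
        (\<integral>\<^sup>+v. ennreal (q * exp (- q * v)) * g (min v t) * indicator {0..} v \<partial>lborel) * indicator {0..} t =
      (\<integral>\<^sup>+v. ?A t v \<partial>lborel) + ?p t * g t * (\<integral>\<^sup>+v. ?q v * indicator {t..} v \<partial>lborel)" .
  qed
  also have "\<dots> = (\<integral>\<^sup>+t. (\<integral>\<^sup>+v. ?B t v \<partial>lborel) \<partial>lborel) +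
      (\<integral>\<^sup>+t. ?p t * g t * ennreal (exp (- q * t)) \<partial>lborel)"
  proof (subst nn_integral_add[symmetric])
    have tail: "?p t * g t * (\<integral>\<^sup>+v. ?q v * indicator {t..} v \<partial>lborel) = ?p t * g t * ennreal (exp (- q * t))" for t
    proof (cases "t \<ge> 0")
      case True
      then have "(\<integral>\<^sup>+v. ?q v * indicator {t..} v \<partial>lborel) = (\<integral>\<^sup>+v. ennreal (q * exp (- q * v)) * indicator {t..} v \<partial>lborel)"
        by (intro nn_integral_cong) (auto simp: indicator_def)
      then show ?thesis
        by (simp only: nn_integral_exp_tail[OF assms(2)])
    qed simp
    show "(\<integral>\<^sup>+t. (\<integral>\<^sup>+v. ?A t v \<partial>lborel) + ?p t * g t * (\<integral>\<^sup>+v. ?q v * indicator {t..} v \<partial>lborel) \<partial>lborel) =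
        (\<integral>\<^sup>+t. (\<integral>\<^sup>+v. ?B t v \<partial>lborel) + ?p t * g t * ennreal (exp (- q * t)) \<partial>lborel)"
      unfolding tail by (simp add: indicator_def)
  qed measurable
  also have "(\<integral>\<^sup>+t. (\<integral>\<^sup>+v. ?B t v \<partial>lborel) \<partial>lborel) =
      (\<integral>\<^sup>+v. (\<integral>\<^sup>+t. ?B t v \<partial>lborel) \<partial>lborel)"
    by (rule lborel_pair.Fubini') measurable
  also have "\<dots> = (\<integral>\<^sup>+v. ?q v * g v * ennreal (exp (- p * v)) \<partial>lborel)"
  proof (rule nn_integral_cong)
    fix v
    have "(\<integral>\<^sup>+t. ?B t v \<partial>lborel) =
        (\<integral>\<^sup>+t. ?q v * g v * (?pe t * indicator {v..} t) \<partial>lborel)"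
      by (intro nn_integral_cong) (auto simp: indicator_def mult_ac)
    also have "\<dots> = ?q v * g v * ennreal (exp (- p * v))"
      by (subst nn_integral_cmult) (simp, simp only: nn_integral_exp_tail[OF assms(1)])
    finally show "(\<integral>\<^sup>+t. ?B t v \<partial>lborel) = ?q v * g v * ennreal (exp (- p * v))" .
  qed
  also have "(\<integral>\<^sup>+v. ?q v * g v * ennreal (exp (- p * v)) \<partial>lborel) + (\<integral>\<^sup>+t. ?p t * g t * ennreal (exp (- q * t)) \<partial>lborel) =
      (\<integral>\<^sup>+s. ?q s * g s * ennreal (exp (- p * s)) + ?p s * g s * ennreal (exp (- q * s)) \<partial>lborel)"
    by (rule nn_integral_add[symmetric]) measurable
  also have "\<dots> = (\<integral>\<^sup>+s. ennreal ((p + q) * exp (- (p + q) * s)) * g s * indicator {0..} s \<partial>lborel)"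
  proof (rule nn_integral_cong)
    fix s
    have "(p + q) * exp (- (p + q) * s) = q * exp (- q * s) * exp (- p * s) + p * exp (- p * s) * exp (- q * s)"
      by (simp add: algebra_simps flip: exp_add)
    then have "ennreal ((p + q) * exp (- (p + q) * s)) =
        ennreal (q * exp (- q * s)) * ennreal (exp (- p * s)) + ennreal (p * exp (- p * s)) * ennreal (exp (- q * s))"
      using assms by (simp only: ennreal_plus ennreal_mult' mult_nonneg_nonneg exp_ge_zero less_imp_le)
    then show "?q s * g s * ennreal (exp (- p * s)) + ?p s * g s * ennreal (exp (- q * s)) =
        ennreal ((p + q) * exp (- (p + q) * s)) * g s * indicator {0..} s"
      by (simp only: distrib_left distrib_right mult_ac)
  qed
  finally show ?thesis .
qed

text \<open>With \<open>q * exp (- q * t)\<close> as the density of the first of event and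
  discounting clock, the first summand collects the dividends paid by then; the second is the value
  brought in at rate \<open>G\<close>. The time \<open>t0\<close> at which the barrier is reached
  splits the integral.\<close>

lemma nn_integral_barrier_value:
  assumes c: "c > 0" and q: "q > 0" and u: "0 \<le> u" and y: "0 \<le> y"
    and [measurable]: "G \<in> borel_measurable borel"
    and G: "\<And>z. 0 \<le> z \<Longrightarrow> z \<le> y \<Longrightarrow> G z = ennreal (H z)" and H: "\<And>z. 0 \<le> z \<Longrightarrow> z \<le> y \<Longrightarrow> H z \<ge> 0"
    and int: "(\<lambda>z. exp (- q * (z - u) / c) * H z / c) integrable_on {u..y}"
  shows "(\<integral>\<^sup>+t. ennreal (exp (- q * t)) * (ennreal (q * max 0 (u + c * t - y)) + G (min (u + c * t) y)) *
      indicator {0..} t \<partial>lborel) = ennreal (barrier_value c q H y u)"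
proof -
  define t0 where "t0 = max 0 ((y - u) / c)"
  \<comment> \<open>Chosen so that \<open>- exp (- q * t) * ?K t\<close> is an antiderivative of the
    integrand from \<open>t0\<close> on.\<close>
  let ?K = "\<lambda>t. u + c * t - y + (c + H y) / q"
  have t0: "t0 \<ge> 0"
    by (simp add: t0_def)
  have after: "y \<le> u + c * t \<longleftrightarrow> t0 \<le> t" if "0 \<le> t" for t
    using that c by (auto simp: t0_def field_simps)
  have lim: "((\<lambda>t. - exp (- q * t) * ?K t) \<longlongrightarrow> 0) at_top"
    using q by real_asymp
  have "(\<integral>\<^sup>+t. ennreal (exp (- q * t) * (q * (u + c * t - y) + H y)) * indicator {t0..} t \<partial>lborel) =
      ennreal (0 - - exp (- q * t0) * ?K t0)"
  proof (rule nn_integral_FTC_atLeast[OF _ _ _ lim])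
    show "0 \<le> exp (- q * t) * (q * (u + c * t - y) + H y)" if "t0 \<le> t" for t
      using that q t0 after[of t] H[OF y] by (intro mult_nonneg_nonneg add_nonneg_nonneg) auto
    show "((\<lambda>t. - exp (- q * t) * ?K t) has_real_derivative exp (- q * t) * (q * (u + c * t - y) + H y)) (at t)" for t
      using q by (auto intro!: derivative_eq_intros simp: field_simps)
  qed measurable
  then have second: "(\<integral>\<^sup>+t. ennreal (exp (- q * t) * (q * (u + c * t - y) + H y)) * indicator {t0..} t \<partial>lborel) =
      ennreal (exp (- q * t0) * ?K t0)"
    by simp
  have K_t0: "?K t0 \<ge> 0"
    using after[OF t0] H[OF y] c q by simp
  \<comment> \<open>The interval is open at \<open>y\<close> so that the pieces before
    \<open>t0\<close> and from \<open>t0\<close> on do not overlap; the closed interval gives the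
    same integral.\<close>
  let ?f = "\<lambda>z. ennreal (exp (- q * (z - u) / c) / c) * G z * indicator {u..<y} z"
  have "(\<integral>\<^sup>+z. ?f z \<partial>lborel) = (\<integral>\<^sup>+z. ennreal (exp (- q * (z - u) / c) * H z / c) * indicator {u..y} z \<partial>lborel)"
  proof (rule nn_integral_cong_AE)
    show "AE z in lborel. ?f z = ennreal (exp (- q * (z - u) / c) * H z / c) * indicator {u..y} z"
      using AE_lborel_singleton[of y]
      by eventually_elim (use u c G in \<open>auto simp: indicator_def simp flip: ennreal_mult'\<close>)
  qed
  also have "\<dots> = ennreal (integral {u..y} (\<lambda>z. exp (- q * (z - u) / c) * H z / c))"
    by (intro nn_integral_has_integral_lebesgue' integrable_integral int) (use u H c in auto)
  finally have first: "(\<integral>\<^sup>+z. ?f z \<partial>lborel) = ennreal (integral {u..y} (\<lambda>z. exp (- q * (z - u) / c) * H z / c))" .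
  have "(\<integral>\<^sup>+t. ennreal (exp (- q * t)) * (ennreal (q * max 0 (u + c * t - y)) + G (min (u + c * t) y)) *
      indicator {0..} t \<partial>lborel) =
    (\<integral>\<^sup>+t. ennreal c * ?f (u + c * t) + ennreal (exp (- q * t) * (q * (u + c * t - y) + H y)) * indicator {t0..} t \<partial>lborel)"
  proof (rule nn_integral_cong)
    fix t
    show "ennreal (exp (- q * t)) * (ennreal (q * max 0 (u + c * t - y)) + G (min (u + c * t) y)) * indicator {0..} t =
      ennreal c * ?f (u + c * t) + ennreal (exp (- q * t) * (q * (u + c * t - y) + H y)) * indicator {t0..} t"
    proof -
      consider "t < 0" | "0 \<le> t" "t < t0" | "t0 \<le> t"
        by linarith
      then show ?thesis
      proof cases
        case 1
        then have "c * t < 0"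
          using c by (simp add: mult_pos_neg)
        then show ?thesis
          using 1 t0 by simp
      next
        case 2
        then have "u + c * t < y" "0 \<le> c * t"
          using after[of t] c by auto
        then show ?thesis
          using 2 c by (simp add: mult.assoc[symmetric] flip: ennreal_mult')
      next
        case 3
        then have "y \<le> u + c * t" "0 \<le> t"
          using after[of t] t0 by auto
        then show ?thesis
          using 3 q H[OF y] y by (simp add: G ennreal_mult')
      qed
    qed
  qed
  also have "\<dots> = ennreal c * (\<integral>\<^sup>+t. ?f (u + c * t) \<partial>lborel) + ennreal (exp (- q * t0) * ?K t0)"
    by (subst nn_integral_add, measurable, subst nn_integral_cmult, measurable, simp only: second)
  also have "ennreal c * (\<integral>\<^sup>+t. ?f (u + c * t) \<partial>lborel) = (\<integral>\<^sup>+z. ?f z \<partial>lborel)"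
    using c by (subst (2) nn_integral_real_affine[where c = c and t = u]) simp_all
  also have "(\<integral>\<^sup>+z. ?f z \<partial>lborel) + ennreal (exp (- q * t0) * ?K t0) = ennreal (barrier_value c q H y u)"
  proof (cases "y \<le> u")
    case True
    then have "t0 = 0" "(\<integral>\<^sup>+z. ?f z \<partial>lborel) = 0"
      using c by (auto simp: t0_def divide_nonpos_pos)
    then show ?thesis
      using True by (simp add: barrier_value_def)
  next
    case False
    then have "t0 = (y - u) / c" "?K t0 = (c + H y) / q"
      using c by (simp_all add: t0_def)
    then have eq: "exp (- q * t0) * ?K t0 = exp (- q * (y - u) / c) * ((c + H y) / q)"
      by simp
    have "0 \<le> integral {u..y} (\<lambda>z. exp (- q * (z - u) / c) * H z / c)"
      using u H c by (intro integral_nonneg int) auto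
    then have "(\<integral>\<^sup>+z. ?f z \<partial>lborel) + ennreal (exp (- q * t0) * ?K t0) =
        ennreal (integral {u..y} (\<lambda>z. exp (- q * (z - u) / c) * H z / c) + exp (- q * t0) * ?K t0)"
      unfolding first using K_t0 by (intro ennreal_plus[symmetric] mult_nonneg_nonneg) simp_all
    then show ?thesis
      using False by (simp only: eq barrier_value_def if_False)
  qed
  finally show ?thesis .
qed

context phase_type_risk_model
begin

section \<open>Pathwise dividends\<close>

text \<open>Until ruin this is the surplus just after \<open>n\<close> events, before the lump sum
  that may open the next stay.\<close>

definition level :: "(nat \<Rightarrow> real) \<Rightarrow> real \<Rightarrow> 'w \<Rightarrow> nat \<Rightarrow> real" where
  "level b x \<omega> n = x + c * epoch \<omega> n - (\<Sum>k=1..claims \<omega> n. Y k \<omega>) - paid_before b x \<omega> n"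

text \<open>Frozen at its final amount once the stay is over, so that the cumulative dividends are
  the sum of these functions over all stays.\<close>

definition stay_dividends :: "(nat \<Rightarrow> real) \<Rightarrow> real \<Rightarrow> 'w \<Rightarrow> nat \<Rightarrow> real \<Rightarrow> real" where
  "stay_dividends b x \<omega> n s = (if s < epoch \<omega> n \<or> ruined b x \<omega> n then 0
     else max 0 (level b x \<omega> n + c * min (s - epoch \<omega> n) (S n \<omega>) - b (Z n \<omega>)))"

text \<open>Discounted dividends of a stay of length \<open>t\<close> begun at \<open>u\<close> with
  barrier \<open>h\<close>, after integration by parts: the amount paid up to \<open>v\<close> is
  integrated against the exponential density of rate \<delta>, and \<open>min v t\<close> freezes it
  at the end of the stay.\<close>

definition stay_value :: "real \<Rightarrow> real \<Rightarrow> real \<Rightarrow> ennreal" where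
  "stay_value h u t = (\<integral>\<^sup>+v. ennreal (\<delta> * exp (- \<delta> * v)) * ennreal (max 0 (u + c * min v t - h)) *
     indicator {0..} v \<partial>lborel)"

definition regular :: "'w \<Rightarrow> bool" where
  "regular \<omega> \<longleftrightarrow> (\<forall>n. Z n \<omega> \<in> {1, 2} \<and> S n \<omega> > 0) \<and> filterlim (epoch \<omega>) at_top sequentially"

section \<open>Recursions along the event epochs\<close>

lemma epoch_0 [simp]: "epoch \<omega> 0 = 0"
  by (simp add: epoch_def)

lemma epoch_Suc [simp]: "epoch \<omega> (Suc n) = epoch \<omega> n + S n \<omega>"
  by (simp add: epoch_def)

lemma claims_0 [simp]: "claims \<omega> 0 = 0"
  by (simp add: claims_def)

lemma claims_Suc: "claims \<omega> (Suc n) = claims \<omega> n + (if E n \<omega> = 3 then 1 else 0)"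
proof -
  have "{k. k < Suc n \<and> E k \<omega> = 3} = {k. k < n \<and> E k \<omega> = 3} \<union> (if E n \<omega> = 3 then {n} else {})"
    by (auto simp: less_Suc_eq)
  then show ?thesis
    by (simp add: claims_def)
qed

lemma level_0 [simp]: "level b x \<omega> 0 = x"
  by (simp add: level_def)

lemma ruined_Suc: "ruined b x \<omega> (Suc n) \<longleftrightarrow> ruined b x \<omega> n \<or> level b x \<omega> (Suc n) < 0"
  by (simp add: level_def)

lemma paid_before_Suc: "paid_before b x \<omega> (Suc n) = paid_before b x \<omega> n +
    (if ruined b x \<omega> n then 0 else max 0 (level b x \<omega> n + c * S n \<omega> - b (Z n \<omega>)))"
  by (simp add: level_def algebra_simps)

lemma level_Suc:
  assumes "\<not> ruined b x \<omega> n"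
  shows "level b x \<omega> (Suc n) = min (level b x \<omega> n + c * S n \<omega>) (b (Z n \<omega>)) -
    (if E n \<omega> = 3 then Y (Suc (claims \<omega> n)) \<omega> else 0)"
  unfolding level_def[of b x \<omega> "Suc n"] paid_before_Suc
  using assms by (simp add: claims_Suc level_def algebra_simps min_def max_def)

lemma not_ruined_level: "\<not> ruined b x \<omega> n \<Longrightarrow> level b x \<omega> n \<ge> 0"
  by (cases n) (auto simp: ruined_Suc simp del: ruined.simps(2))

lemma ruined_mono: "m \<le> n \<Longrightarrow> ruined b x \<omega> m \<Longrightarrow> ruined b x \<omega> n"
  by (induction n rule: dec_induct) auto

lemma stay_dividends_nonneg: "stay_dividends b x \<omega> n s \<ge> 0"
  by (simp add: stay_dividends_def)

context
  fixes b :: "nat \<Rightarrow> real" and x :: real and \<omega> :: 'w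
  assumes b_nonneg: "b 1 \<ge> 0" "b 2 \<ge> 0" and x_nonneg: "x \<ge> 0" and regular: "regular \<omega>"
begin

abbreviation "paid_in \<equiv> stay_dividends b x \<omega>"
abbreviation "is_ruined \<equiv> ruined b x \<omega>"
abbreviation "lev \<equiv> level b x \<omega>"

lemma S_pos: "S n \<omega> > 0" and b_Z_nonneg: "b (Z n \<omega>) \<ge> 0"
proof -
  have "Z n \<omega> \<in> {1, 2}" "S n \<omega> > 0"
    using regular by (auto simp: regular_def)
  then show "S n \<omega> > 0" "b (Z n \<omega>) \<ge> 0"
    using b_nonneg by auto
qed

lemma strict_mono_epoch: "strict_mono (epoch \<omega>)"
  by (rule strict_monoI_Suc) (simp add: S_pos)

lemma epoch_less_iff: "epoch \<omega> m < epoch \<omega> n \<longleftrightarrow> m < n"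
  by (rule strict_mono_less[OF strict_mono_epoch])

lemma epoch_le_iff: "epoch \<omega> m \<le> epoch \<omega> n \<longleftrightarrow> m \<le> n"
  by (rule strict_mono_less_eq[OF strict_mono_epoch])

lemma epoch_unbounded: "\<exists>n. t < epoch \<omega> n"
proof -
  have "\<forall>\<^sub>F n in sequentially. t < epoch \<omega> n"
    using regular by (auto simp: regular_def filterlim_at_top_dense)
  then show ?thesis
    by (auto simp: eventually_sequentially)
qed

lemma events_eq:
  assumes "epoch \<omega> n \<le> t" "t < epoch \<omega> (Suc n)"
  shows "events \<omega> t = n"
proof -
  have "epoch \<omega> (Suc k) \<le> t \<longleftrightarrow> k < n" for k
  proof
    assume "epoch \<omega> (Suc k) \<le> t"
    then have "epoch \<omega> (Suc k) < epoch \<omega> (Suc n)"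
      using assms by linarith
    then show "k < n"
      unfolding epoch_less_iff by simp
  next
    assume "k < n"
    then have "epoch \<omega> (Suc k) \<le> epoch \<omega> n"
      unfolding epoch_le_iff by simp
    then show "epoch \<omega> (Suc k) \<le> t"
      using assms by linarith
  qed
  then have "{k. epoch \<omega> (Suc k) \<le> t} = {..<n}"
    by auto
  then show ?thesis
    unfolding events_def by simp
qed

lemma stay_exists:
  assumes "t \<ge> 0"
  obtains n where "epoch \<omega> n \<le> t" "t < epoch \<omega> (Suc n)"
proof -
  define m where "m = (LEAST n. t < epoch \<omega> n)"
  have m: "t < epoch \<omega> m"
    unfolding m_def using epoch_unbounded by (rule LeastI_ex)
  then obtain n where n: "m = Suc n"
    using assms by (cases m) (auto simp del: epoch_Suc)
  have "\<not> t < epoch \<omega> n"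
    using not_less_Least[of n "\<lambda>n. t < epoch \<omega> n"] n unfolding m_def by simp
  with m n that[of n] show ?thesis
    by simp
qed

lemma D_stay:
  assumes "t \<ge> 0" "epoch \<omega> n \<le> t" "t < epoch \<omega> (Suc n)"
  shows "D b x t \<omega> = paid_before b x \<omega> n + paid_in n t"
  using assms events_eq[OF assms(2,3)]
  by (auto simp: D_def J_def N_def stay_dividends_def level_def algebra_simps)

lemma epoch_nonneg: "epoch \<omega> n \<ge> 0"
  using epoch_le_iff[of 0 n] by simp

lemma sum_stay_dividends:
  "(\<Sum>m<n. paid_in m t) = (if t < epoch \<omega> n then D b x t \<omega> else paid_before b x \<omega> n)"
proof (induction n)
  case 0
  then show ?case
    by (simp add: D_def)
next
  case (Suc n)
  consider "t < epoch \<omega> n" | "epoch \<omega> n \<le> t" "t < epoch \<omega> (Suc n)" | "epoch \<omega> (Suc n) \<le> t"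
    by linarith
  then show ?case
  proof cases
    case 1
    then show ?thesis
      using Suc S_pos[of n] by (simp add: stay_dividends_def)
  next
    case 2
    then have "t \<ge> 0"
      using epoch_nonneg[of n] by linarith
    with 2 show ?thesis
      using Suc by (simp add: D_stay)
  next
    case 3
    then have "epoch \<omega> n \<le> t" "min (t - epoch \<omega> n) (S n \<omega>) = S n \<omega>"
      using S_pos[of n] by auto
    with 3 show ?thesis
      using Suc unfolding paid_before_Suc by (simp add: stay_dividends_def)
  qed
qed

text \<open>One finite sum represents \<open>D\<close> at all times before a given epoch. This
  reduces path properties of \<open>D\<close> to properties of single stays.\<close>

lemma D_eq_sum: "t < epoch \<omega> n \<Longrightarrow> D b x t \<omega> = (\<Sum>m<n. paid_in m t)"
  using sum_stay_dividends[of t n] by simp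

section \<open>Monotonicity and right continuity of the dividend path\<close>

lemma stay_dividends_mono:
  assumes "s \<le> t"
  shows "paid_in m s \<le> paid_in m t"
proof -
  have "c * min (s - epoch \<omega> m) (S m \<omega>) \<le> c * min (t - epoch \<omega> m) (S m \<omega>)"
    using assms c_pos by (intro mult_left_mono) auto
  with assms show ?thesis
    unfolding stay_dividends_def by auto
qed

lemma D_mono:
  assumes "s \<le> t"
  shows "D b x s \<omega> \<le> D b x t \<omega>"
proof -
  obtain n where n: "t < epoch \<omega> n"
    using epoch_unbounded by blast
  with assms show ?thesis
    by (simp add: D_eq_sum[of _ n] sum_mono stay_dividends_mono)
qed

lemma stay_dividends_right_continuous: "continuous (at_right t) (paid_in m)"
proof (cases "t < epoch \<omega> m")
  case True
  have "\<forall>\<^sub>F s in at_right t. s < epoch \<omega> m"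
    using True by (rule order_tendstoD(2)[OF tendsto_ident_at])
  then have "\<forall>\<^sub>F s in at_right t. paid_in m s = 0"
    by eventually_elim (simp add: stay_dividends_def)
  then have "(paid_in m \<longlongrightarrow> 0) (at_right t)"
    by (rule tendsto_eventually)
  with True show ?thesis
    by (simp add: continuous_within stay_dividends_def)
next
  case False
  define h where "h s = (if is_ruined m then 0
     else max 0 (lev m + c * min (s - epoch \<omega> m) (S m \<omega>) - b (Z m \<omega>)))" for s
  have "\<forall>\<^sub>F s in at_right t. paid_in m s = h s"
    unfolding eventually_at_filter using False by (auto simp: stay_dividends_def h_def)
  moreover have "(h \<longlongrightarrow> h t) (at_right t)"
    unfolding h_def by (cases "is_ruined m") (auto intro!: tendsto_intros)
  moreover have "h t = paid_in m t"
    using False by (simp add: stay_dividends_def h_def)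
  ultimately show ?thesis
    unfolding continuous_within using filterlim_cong by force
qed

lemma D_right_continuous: "continuous (at_right t) (\<lambda>t. D b x t \<omega>)"
proof -
  obtain n where n: "t < epoch \<omega> n"
    using epoch_unbounded by blast
  have "\<forall>\<^sub>F s in at_right t. s < epoch \<omega> n"
    using n by (rule order_tendstoD(2)[OF tendsto_ident_at])
  then have ev: "\<forall>\<^sub>F s in at_right t. D b x s \<omega> = (\<Sum>m<n. paid_in m s)"
    by eventually_elim (rule D_eq_sum)
  have "((\<lambda>s. \<Sum>m<n. paid_in m s) \<longlongrightarrow> (\<Sum>m<n. paid_in m t)) (at_right t)"
    using stay_dividends_right_continuous by (intro tendsto_sum) (simp add: continuous_within)
  then show ?thesis
    unfolding continuous_within D_eq_sum[OF n] using filterlim_cong[OF refl refl ev] by simp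
qed

section \<open>The Stieltjes measure of the dividends\<close>

abbreviation (input) \<mu> where "\<mu> \<equiv> interval_measure (\<lambda>t. D b x t \<omega>)"

lemma emeasure_atMost: "emeasure \<mu> {..t} = ennreal (D b x t \<omega>)"
proof -
  \<comment> \<open>The additional 1 makes every left end negative, also for \<open>n = 0\<close>,
    so that \<open>D\<close> vanishes there.\<close>
  have "(\<Union>n. {- real n - 1<..t}) = {..t}"
  proof safe
    fix s assume "s \<le> t"
    obtain n where "- s < real n"
      using reals_Archimedean2 by blast
    then show "s \<in> (\<Union>n. {- real n - 1<..t})"
      using \<open>s \<le> t\<close> by (intro UN_I[of n]) auto
  qed auto
  moreover have "(\<lambda>n. emeasure \<mu> {- real n - 1<..t}) \<longlonglongrightarrow> emeasure \<mu> (\<Union>n. {- real n - 1<..t})"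
    by (rule Lim_emeasure_incseq) (auto simp: incseq_def)
  moreover have "emeasure \<mu> {- real n - 1<..t} = ennreal (D b x t \<omega>)" for n
  proof (cases "- real n - 1 \<le> t")
    case True
    then show ?thesis
      by (subst emeasure_interval_measure_Ioc) (auto simp: D_mono D_right_continuous D_def[of b x "- real n - 1"])
  next
    case False
    then have "t < 0" by linarith
    with False show ?thesis
      by (simp add: D_def)
  qed
  ultimately show ?thesis
    by (simp add: LIMSEQ_const_iff)
qed

text \<open>Fubini for \<open>exp (- \<delta> * t)\<close> written as the integral of \<open>\<delta> * exp (- \<delta> * s)\<close> over \<open>s \<ge> t\<close>.\<close>

lemma nn_integral_discount:
  "(\<integral>\<^sup>+t. ennreal (exp (- \<delta> * t)) \<partial>\<mu>) = (\<integral>\<^sup>+s. ennreal (\<delta> * exp (- \<delta> * s)) * ennreal (D b x s \<omega>) \<partial>lborel)"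
proof -
  interpret I: sigma_finite_measure \<mu>
    by (rule sigma_finite_interval_measure) (auto simp: D_mono D_right_continuous)
  interpret pair_sigma_finite \<mu> lborel ..
  have "(\<integral>\<^sup>+t. ennreal (exp (- \<delta> * t)) \<partial>\<mu>) =
      (\<integral>\<^sup>+t. (\<integral>\<^sup>+s. ennreal (\<delta> * exp (- \<delta> * s)) * indicator {t..} s \<partial>lborel) \<partial>\<mu>)"
    by (simp only: nn_integral_exp_tail[OF delta_pos])
  also have "\<dots> = (\<integral>\<^sup>+t. (\<integral>\<^sup>+s. ennreal (\<delta> * exp (- \<delta> * s)) * indicator {z. fst z \<le> snd z} (t, s) \<partial>lborel) \<partial>\<mu>)"
    by (intro nn_integral_cong) (auto simp: indicator_def)
  also have "\<dots> = (\<integral>\<^sup>+s. (\<integral>\<^sup>+t. ennreal (\<delta> * exp (- \<delta> * s)) * indicator {z. fst z \<le> snd z} (t, s) \<partial>\<mu>) \<partial>lborel)"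
    by (rule Fubini'[symmetric]) measurable
  also have "\<dots> = (\<integral>\<^sup>+s. (\<integral>\<^sup>+t. ennreal (\<delta> * exp (- \<delta> * s)) * indicator {..s} t \<partial>\<mu>) \<partial>lborel)"
    by (intro nn_integral_cong) (auto simp: indicator_def)
  also have "\<dots> = (\<integral>\<^sup>+s. ennreal (\<delta> * exp (- \<delta> * s)) * ennreal (D b x s \<omega>) \<partial>lborel)"
    by (subst nn_integral_cmult) (auto simp: emeasure_atMost)
  finally show ?thesis .
qed

text \<open>There is no atom at a ruin epoch: a stay that pays dividends began strictly earlier, and
  its contribution can jump only at its beginning.\<close>

lemma tendsto_D_at_left_ruin:
  assumes "is_ruined n"
  shows "((\<lambda>t. D b x t \<omega>) \<longlongrightarrow> D b x (epoch \<omega> n) \<omega>) (at_left (epoch \<omega> n))"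
proof -
  have less: "epoch \<omega> n < epoch \<omega> (Suc n)"
    by (simp add: S_pos)
  have "((\<lambda>t. paid_in m t) \<longlongrightarrow> paid_in m (epoch \<omega> n)) (at_left (epoch \<omega> n))" for m
  proof (cases "is_ruined m")
    case True
    then show ?thesis
      by (simp add: stay_dividends_def)
  next
    case False
    define h where "h s = max 0 (lev m + c * min (s - epoch \<omega> m) (S m \<omega>) - b (Z m \<omega>))" for s
    from False have m: "epoch \<omega> m < epoch \<omega> n"
      unfolding epoch_less_iff using ruined_mono[of n m b x \<omega>] assms by (meson not_less)
    have "\<forall>\<^sub>F s in at_left (epoch \<omega> n). epoch \<omega> m < s"
      using m by (rule order_tendstoD(1)[OF tendsto_ident_at])
    then have "\<forall>\<^sub>F s in at_left (epoch \<omega> n). paid_in m s = h s"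
      by eventually_elim (use False in \<open>simp add: stay_dividends_def h_def\<close>)
    moreover have "(h \<longlongrightarrow> h (epoch \<omega> n)) (at_left (epoch \<omega> n))"
      unfolding h_def by (auto intro!: tendsto_intros)
    moreover have "h (epoch \<omega> n) = paid_in m (epoch \<omega> n)"
      using m False by (simp add: stay_dividends_def h_def)
    ultimately show ?thesis
      using filterlim_cong by force
  qed
  then have "((\<lambda>t. \<Sum>m<Suc n. paid_in m t) \<longlongrightarrow> D b x (epoch \<omega> n) \<omega>) (at_left (epoch \<omega> n))"
    unfolding D_eq_sum[OF less] by (rule tendsto_sum)
  moreover have "\<forall>\<^sub>F s in at_left (epoch \<omega> n). D b x s \<omega> = (\<Sum>m<Suc n. paid_in m s)"
    unfolding eventually_at_filter using D_eq_sum[OF less_trans[OF _ less]]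
    by (auto simp del: sum.lessThan_Suc intro!: eventuallyI)
  ultimately show ?thesis
    using filterlim_cong by force
qed

lemma D_after_ruin:
  assumes "is_ruined n" "epoch \<omega> n \<le> t"
  shows "D b x t \<omega> = D b x (epoch \<omega> n) \<omega>"
proof -
  obtain k where k: "t < epoch \<omega> k"
    using epoch_unbounded by blast
  have "paid_in m t = paid_in m (epoch \<omega> n)" for m
  proof (cases "n \<le> m")
    case True
    then show ?thesis
      using ruined_mono[OF True assms(1)] by (simp add: stay_dividends_def)
  next
    case False
    then have "epoch \<omega> (Suc m) \<le> epoch \<omega> n"
      unfolding epoch_le_iff by simp
    then have "min (t - epoch \<omega> m) (S m \<omega>) = S m \<omega>" "min (epoch \<omega> n - epoch \<omega> m) (S m \<omega>) = S m \<omega>"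
        "epoch \<omega> m < epoch \<omega> n"
      using assms S_pos[of m] by auto
    then show ?thesis
      using assms by (simp add: stay_dividends_def)
  qed
  then show ?thesis
    using k assms(2) by (simp add: D_eq_sum[of _ k])
qed

lemma X_stay:
  assumes "epoch \<omega> n \<le> t" "t < epoch \<omega> (Suc n)" "\<not> is_ruined n"
  shows "X b x t \<omega> = min (lev n + c * (t - epoch \<omega> n)) (b (Z n \<omega>))"
proof -
  have "t \<ge> 0"
    using epoch_nonneg[of n] assms by linarith
  then show ?thesis
    using assms events_eq[OF assms(1,2)]
    by (simp add: X_def D_stay N_def stay_dividends_def level_def algebra_simps min_def max_def)
qed

lemma X_nonneg:
  assumes "t \<ge> 0" "\<And>n. epoch \<omega> n \<le> t \<Longrightarrow> \<not> is_ruined n"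
  shows "X b x t \<omega> \<ge> 0"
proof -
  obtain n where n: "epoch \<omega> n \<le> t" "t < epoch \<omega> (Suc n)"
    using stay_exists assms(1) by blast
  then show ?thesis
    using assms(2)[of n] not_ruined_level[of b x \<omega> n] b_Z_nonneg[of n] c_pos
    by (simp add: X_stay)
qed

text \<open>The measure gives no mass to negative times, where \<open>D\<close> is 0, none to the
  ruin epoch, where \<open>D\<close> is left continuous, and none to later times, where
  \<open>D\<close> is constant.\<close>

lemma AE_before_ruin: "AE t in \<mu>. 0 \<le> t \<and> ereal t < ruin_time b x \<omega>"
proof -
  have "AE t in \<mu>. \<forall>n. \<not> t \<le> - 1 / real (Suc n)"
    unfolding AE_all_countable
  proof
    fix n
    have "- 1 / real (Suc n) < 0"
      by (simp add: field_simps)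
    then have "{..- 1 / real (Suc n)} \<in> null_sets \<mu>"
      using emeasure_atMost[of "- 1 / real (Suc n)"] by (auto simp: D_def)
    then show "AE t in \<mu>. \<not> t \<le> - 1 / real (Suc n)"
      by (rule AE_I') auto
  qed
  then have nonneg: "AE t in \<mu>. 0 \<le> t"
  proof eventually_elim
    case (elim t)
    show ?case
    proof (rule ccontr)
      assume "\<not> 0 \<le> t"
      then obtain n where "1 / real (Suc n) < - t"
        using reals_Archimedean[of "- t"] by (auto simp: inverse_eq_divide)
      with elim[rule_format, of n] show False
        by simp
    qed
  qed
  show ?thesis
  proof (cases "\<exists>n. is_ruined n")
    case False
    \<comment> \<open>Without ruin the infimum runs over the empty set and the ruin time is
      infinite.\<close>
    then have empty: "{t. 0 \<le> t \<and> X b x t \<omega> < 0} = {}"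
      using X_nonneg by force
    have "ruin_time b x \<omega> = \<infinity>"
      unfolding ruin_time_def empty by (simp add: top_ereal_def)
    with nonneg show ?thesis
      by simp
  next
    case True
    define n where "n = (LEAST n. is_ruined n)"
    have n: "is_ruined n"
      unfolding n_def using True by (rule LeastI_ex)
    have before: "\<not> is_ruined m" if "m < n" for m
      using that not_less_Least unfolding n_def by blast
    have "ereal (epoch \<omega> n) \<le> ruin_time b x \<omega>"
      unfolding ruin_time_def
    proof (rule INF_greatest)
      fix t assume t: "t \<in> {t. 0 \<le> t \<and> X b x t \<omega> < 0}"
      then obtain m where "epoch \<omega> m \<le> t" "is_ruined m"
        using X_nonneg[of t] by force
      moreover have "n \<le> m"
        using before[of m] \<open>is_ruined m\<close> by (meson not_less)
      ultimately show "ereal (epoch \<omega> n) \<le> ereal t"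
        using epoch_le_iff[of n m] by simp
    qed
    moreover have "AE t in \<mu>. t < epoch \<omega> n"
    proof -
      \<comment> \<open>The atom is squeezed by half-open intervals ending at the ruin epoch, whose
        mass tends to 0.\<close>
      have sing: "emeasure \<mu> {epoch \<omega> n} \<le> 0"
      proof (rule tendsto_lowerbound)
        have "((\<lambda>t. D b x (epoch \<omega> n) \<omega> - D b x t \<omega>) \<longlongrightarrow> D b x (epoch \<omega> n) \<omega> - D b x (epoch \<omega> n) \<omega>) (at_left (epoch \<omega> n))"
          by (intro tendsto_intros tendsto_D_at_left_ruin n)
        then show "((\<lambda>t. ennreal (D b x (epoch \<omega> n) \<omega> - D b x t \<omega>)) \<longlongrightarrow> 0) (at_left (epoch \<omega> n))"
          using tendsto_ennrealI by force
        have "emeasure \<mu> {epoch \<omega> n} \<le> ennreal (D b x (epoch \<omega> n) \<omega> - D b x t \<omega>)" if "t < epoch \<omega> n" for t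
        proof -
          have "emeasure \<mu> {epoch \<omega> n} \<le> emeasure \<mu> {t<..epoch \<omega> n}"
            using that by (intro emeasure_mono) auto
          also have "\<dots> = ennreal (D b x (epoch \<omega> n) \<omega> - D b x t \<omega>)"
            using that by (intro emeasure_interval_measure_Ioc) (auto simp: D_mono D_right_continuous)
          finally show ?thesis .
        qed
        then show "\<forall>\<^sub>F t in at_left (epoch \<omega> n). emeasure \<mu> {epoch \<omega> n} \<le> ennreal (D b x (epoch \<omega> n) \<omega> - D b x t \<omega>)"
          by (auto simp: eventually_at_filter)
      qed simp
      then have "{epoch \<omega> n} \<in> null_sets \<mu>"
        by auto
      then have 1: "AE t in \<mu>. t \<noteq> epoch \<omega> n"
        by (rule AE_I') auto
      have "AE t in \<mu>. \<forall>k. t \<notin> {epoch \<omega> n<..epoch \<omega> n + real k}"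
        unfolding AE_all_countable
      proof
        fix k
        have "emeasure \<mu> {epoch \<omega> n<..epoch \<omega> n + real k} = 0"
          using D_after_ruin[OF n, of "epoch \<omega> n + real k"]
          by (subst emeasure_interval_measure_Ioc) (auto simp: D_mono D_right_continuous)
        then have "{epoch \<omega> n<..epoch \<omega> n + real k} \<in> null_sets \<mu>"
          by auto
        then show "AE t in \<mu>. t \<notin> {epoch \<omega> n<..epoch \<omega> n + real k}"
          by (rule AE_not_in)
      qed
      with 1 show ?thesis
      proof eventually_elim
        case (elim t)
        show ?case
        proof (rule ccontr)
          assume "\<not> t < epoch \<omega> n"
          moreover obtain k where "t - epoch \<omega> n < real k"
            using reals_Archimedean2 by blast
          ultimately show False
            using elim(1) elim(2)[rule_format, of k] by auto
        qed
      qed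
    qed
    ultimately have ruin: "AE t in \<mu>. ereal t < ruin_time b x \<omega>"
      by (auto elim!: eventually_mono intro: less_le_trans[where y = "ereal (epoch \<omega> n)"])
    show ?thesis
      using nonneg ruin by eventually_elim simp
  qed
qed

text \<open>Fubini trades the Stieltjes integral for a Lebesgue integral of \<open>D\<close>, which
  splits into stays. Shifting the time origin to the start of each stay takes out its discount
  factor.\<close>

lemma pathwise_value:
  "(\<integral>\<^sup>+t\<in>{t. 0 \<le> t \<and> ereal t < ruin_time b x \<omega>}. ennreal (exp (- \<delta> * t)) \<partial>\<mu>) =
   (\<Sum>n. ennreal (exp (- \<delta> * epoch \<omega> n)) *
     (if is_ruined n then 0 else stay_value (b (Z n \<omega>)) (lev n) (S n \<omega>)))"
    (is "_ = (\<Sum>n. ?t n)")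
proof -
  have "(\<integral>\<^sup>+t\<in>{t. 0 \<le> t \<and> ereal t < ruin_time b x \<omega>}. ennreal (exp (- \<delta> * t)) \<partial>\<mu>) =
      (\<integral>\<^sup>+t. ennreal (exp (- \<delta> * t)) \<partial>\<mu>)"
  proof (rule nn_integral_cong_AE)
    show "AE t in \<mu>. ennreal (exp (- \<delta> * t)) * indicator {t. 0 \<le> t \<and> ereal t < ruin_time b x \<omega>} t =
        ennreal (exp (- \<delta> * t))"
      using AE_before_ruin by eventually_elim simp
  qed
  also have "\<dots> = (\<integral>\<^sup>+s. ennreal (\<delta> * exp (- \<delta> * s)) * ennreal (D b x s \<omega>) \<partial>lborel)"
    by (rule nn_integral_discount)
  also have "\<dots> = (\<integral>\<^sup>+s. (\<Sum>n. ennreal (\<delta> * exp (- \<delta> * s)) * ennreal (paid_in n s)) \<partial>lborel)"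
  proof (intro nn_integral_cong)
    fix s
    obtain n where n: "s < epoch \<omega> n"
      using epoch_unbounded by blast
    have "(\<Sum>k. ennreal (paid_in k s)) = (\<Sum>k<n. ennreal (paid_in k s))"
    proof (rule suminf_finite)
      fix k assume "k \<notin> {..<n}"
      then have "s < epoch \<omega> k"
        using n epoch_le_iff[of n k] by simp
      then show "ennreal (paid_in k s) = 0"
        by (simp add: stay_dividends_def)
    qed simp
    also have "\<dots> = ennreal (D b x s \<omega>)"
      by (simp add: D_eq_sum[OF n] stay_dividends_nonneg)
    finally show "ennreal (\<delta> * exp (- \<delta> * s)) * ennreal (D b x s \<omega>) =
        (\<Sum>n. ennreal (\<delta> * exp (- \<delta> * s)) * ennreal (paid_in n s))"
      by simp
  qed
  also have "\<dots> = (\<Sum>n. \<integral>\<^sup>+s. ennreal (\<delta> * exp (- \<delta> * s)) * ennreal (paid_in n s) \<partial>lborel)"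
    by (rule nn_integral_suminf) (simp add: stay_dividends_def)
  also have "(\<lambda>n. \<integral>\<^sup>+s. ennreal (\<delta> * exp (- \<delta> * s)) * ennreal (paid_in n s) \<partial>lborel) =
      (\<lambda>n. ?t n)"
  proof
    fix n
    show "(\<integral>\<^sup>+s. ennreal (\<delta> * exp (- \<delta> * s)) * ennreal (paid_in n s) \<partial>lborel) = ?t n"
    proof (cases "is_ruined n")
      case True
      then show ?thesis
        by (simp add: stay_dividends_def)
    next
      case False
      have "(\<integral>\<^sup>+s. ennreal (\<delta> * exp (- \<delta> * s)) * ennreal (paid_in n s) \<partial>lborel) =
          (\<integral>\<^sup>+s. ennreal (\<delta> * exp (- \<delta> * (epoch \<omega> n + s))) *
            ennreal (paid_in n (epoch \<omega> n + s)) \<partial>lborel)"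
        by (subst nn_integral_real_affine[where c = 1 and t = "epoch \<omega> n"]) (simp_all add: stay_dividends_def)
      also have "\<dots> = (\<integral>\<^sup>+s. ennreal (exp (- \<delta> * epoch \<omega> n)) * (ennreal (\<delta> * exp (- \<delta> * s)) *
            ennreal (max 0 (lev n + c * min s (S n \<omega>) - b (Z n \<omega>))) * indicator {0..} s) \<partial>lborel)"
      proof (rule nn_integral_cong)
        fix s
        have "exp (- \<delta> * (epoch \<omega> n + s)) = exp (- \<delta> * epoch \<omega> n) * exp (- \<delta> * s)"
          by (simp add: algebra_simps flip: exp_add)
        then show "ennreal (\<delta> * exp (- \<delta> * (epoch \<omega> n + s))) *
              ennreal (paid_in n (epoch \<omega> n + s)) =
            ennreal (exp (- \<delta> * epoch \<omega> n)) * (ennreal (\<delta> * exp (- \<delta> * s)) *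
              ennreal (max 0 (lev n + c * min s (S n \<omega>) - b (Z n \<omega>))) * indicator {0..} s)"
          using False delta_pos
          by (auto simp: stay_dividends_def indicator_def mult_ac ennreal_mult')
      qed
      also have "\<dots> = ennreal (exp (- \<delta> * epoch \<omega> n)) * stay_value (b (Z n \<omega>)) (lev n) (S n \<omega>)"
        unfolding stay_value_def by (rule nn_integral_cmult) simp
      finally show ?thesis
        using False by simp
    qed
  qed
  finally show ?thesis .
qed

end

section \<open>The law of the first events\<close>

definition rate :: "nat \<Rightarrow> real" where
  "rate i = (\<Sum>j\<in>{1, 2, 3} - {i}. lam i j)"

definition jump_prob :: "nat \<Rightarrow> nat \<Rightarrow> nat \<Rightarrow> real" where
  "jump_prob i j k = lam i j / rate i * (if j = 3 then \<pi> k else of_bool (k = j))"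

definition hold :: "nat \<Rightarrow> real measure" where
  "hold i = density lborel (exponential_density (rate i))"

definition claim_size :: "real measure" where
  "claim_size = density lborel (exponential_density \<beta>)"

lemma sets_hold [simp, measurable_cong]: "sets (hold i) = sets borel"
  by (simp add: hold_def)

lemma sets_claim_size [simp, measurable_cong]: "sets claim_size = sets borel"
  by (simp add: claim_size_def)

lemma space_hold [simp]: "space (hold i) = UNIV"
  by (simp add: hold_def)

lemma space_claim_size [simp]: "space claim_size = UNIV"
  by (simp add: claim_size_def)

lemma rate_pos: "i \<in> {1, 2} \<Longrightarrow> rate i > 0"
  unfolding rate_def by (rule exit_rate_pos)

lemma jump_prob_nonneg: "i \<in> {1, 2} \<Longrightarrow> j \<in> {1, 2, 3} - {i} \<Longrightarrow> k \<in> {1, 2} \<Longrightarrow> jump_prob i j k \<ge> 0"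
  using rate_pos[of i] intensity_nonneg[of i j] restart_nonneg unfolding jump_prob_def
  by (intro mult_nonneg_nonneg divide_nonneg_nonneg) auto

lemma sum_jump_prob_restart:
  assumes "j \<in> {1, 2, 3}"
  shows "(\<Sum>k\<in>{1, 2}. jump_prob i j k) = lam i j / rate i"
proof (cases "j = 3")
  case True
  have "(\<Sum>k\<in>{1, 2}. jump_prob i j k) = lam i j / rate i * (\<pi> 1 + \<pi> 2)"
    using True by (simp add: jump_prob_def distrib_left)
  then show ?thesis
    unfolding restart_sum by simp
next
  case False
  then show ?thesis
    using assms by (auto simp: jump_prob_def)
qed

lemma sum_jump_prob:
  assumes "i \<in> {1, 2}"
  shows "(\<Sum>j\<in>{1, 2, 3} - {i}. \<Sum>k\<in>{1, 2}. jump_prob i j k) = 1"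
proof -
  have "(\<Sum>j\<in>{1, 2, 3} - {i}. \<Sum>k\<in>{1, 2}. jump_prob i j k) = (\<Sum>j\<in>{1, 2, 3} - {i}. lam i j / rate i)"
    by (intro sum.cong refl sum_jump_prob_restart) auto
  then show ?thesis
    using rate_pos[OF assms] by (simp add: sum_divide_distrib[symmetric] rate_def)
qed

lemma prob_space_hold: "i \<in> {1, 2} \<Longrightarrow> prob_space (hold i)"
  unfolding hold_def by (rule prob_space_exponential_density[OF rate_pos])

lemma prob_space_claim_size: "prob_space claim_size"
  unfolding claim_size_def by (rule prob_space_exponential_density[OF beta_pos])

lemma sigma_finite_hold: "sigma_finite_measure (hold i)"
  unfolding hold_def by (subst sigma_finite_measure.sigma_finite_iff_density_finite'[OF sigma_finite_lborel]) auto

lemma product_sigma_finite_hold: "product_sigma_finite (\<lambda>m. hold (ph m))"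
  by (simp add: product_sigma_finite_def sigma_finite_hold)

lemma product_sigma_finite_claim_size: "product_sigma_finite (\<lambda>_. claim_size)"
  by (simp add: product_sigma_finite_def prob_space_imp_sigma_finite prob_space_claim_size)

lemma emeasure_hold_greaterThan:
  assumes "i \<in> {1, 2}"
  shows "emeasure (hold i) {t<..} = ennreal (exp (- rate i * max 0 t))"
proof -
  have *: "emeasure (hold i) {t<..} = ennreal (exp (- rate i * t))" if "t \<ge> 0" for t
  proof -
    have "emeasure (hold i) {t<..} = (\<integral>\<^sup>+s. ennreal (exponential_density (rate i) s) * indicator {t<..} s \<partial>lborel)"
      unfolding hold_def by (simp add: emeasure_density)
    also have "\<dots> = (\<integral>\<^sup>+s. ennreal (rate i * exp (- rate i * s)) * indicator {t..} s \<partial>lborel)"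
      using AE_lborel_singleton[of t] that
      by (intro nn_integral_cong_AE) (auto elim!: eventually_mono simp: exponential_density_def indicator_def mult.commute)
    also have "\<dots> = ennreal (exp (- rate i * t))"
      by (rule nn_integral_exp_tail[OF rate_pos[OF assms]])
    finally show ?thesis .
  qed
  show ?thesis
  proof (cases "t \<ge> 0")
    case True
    with *[OF this] show ?thesis by simp
  next
    case False
    have "emeasure (hold i) {0<..} \<le> emeasure (hold i) {t<..}"
      using False by (intro emeasure_mono) auto
    moreover have "emeasure (hold i) {t<..} \<le> 1"
      using prob_space.emeasure_le_1[OF prob_space_hold[OF assms]] .
    ultimately show ?thesis
      using *[of 0] False by auto
  qed
qed

section \<open>Finite discrete paths and almost sure regularity\<close>

definition admissible :: "nat \<Rightarrow> (nat \<Rightarrow> nat) \<Rightarrow> (nat \<Rightarrow> nat) \<Rightarrow> bool" where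
  "admissible n ph st \<longleftrightarrow> (\<forall>m\<le>n. ph m \<in> {1, 2}) \<and> (\<forall>m<n. st m \<in> {1, 2, 3} - {ph m})"

definition path_event :: "nat \<Rightarrow> nat \<Rightarrow> (nat \<Rightarrow> nat) \<Rightarrow> (nat \<Rightarrow> nat) \<Rightarrow> 'w set" where
  "path_event i n ph st = {\<omega> \<in> space (P i). (\<forall>m<n. Z m \<omega> = ph m \<and> E m \<omega> = st m) \<and> Z n \<omega> = ph n}"

definition path_prob :: "nat \<Rightarrow> nat \<Rightarrow> (nat \<Rightarrow> nat) \<Rightarrow> (nat \<Rightarrow> nat) \<Rightarrow> real" where
  "path_prob i n ph st = of_bool (ph 0 = i) * (\<Prod>m<n. jump_prob (ph m) (st m) (ph (Suc m)))"

text \<open>Extensional functions make the observed path a unique element of a finite set, so that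
  expectations become finite sums over paths.\<close>

definition paths :: "nat \<Rightarrow> ((nat \<Rightarrow> nat) \<times> (nat \<Rightarrow> nat)) set" where
  "paths n = {p \<in> ({..n} \<rightarrow>\<^sub>E {1, 2}) \<times> ({..<n} \<rightarrow>\<^sub>E {1, 2, 3}). admissible n (fst p) (snd p)}"

definition good :: "nat \<Rightarrow> nat \<Rightarrow> 'w \<Rightarrow> bool" where
  "good i n \<omega> \<longleftrightarrow> Z 0 \<omega> = i \<and> (\<forall>m<n. Z m \<omega> \<in> {1, 2} \<and> S m \<omega> > 0 \<and> E m \<omega> \<in> {1, 2, 3} - {Z m \<omega>}) \<and>
     Z n \<omega> \<in> {1, 2}"

lemma finite_paths: "finite (paths n)"
  unfolding paths_def by (intro finite_subset[OF Collect_restrict] finite_cartesian_product finite_PiE) auto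

lemma path_prob_nonneg: "admissible n ph st \<Longrightarrow> path_prob i n ph st \<ge> 0"
  unfolding path_prob_def admissible_def
  by (intro mult_nonneg_nonneg prod_nonneg ballI jump_prob_nonneg) auto

lemma path_prob_Suc:
  "path_prob i (Suc n) ph st = path_prob i n ph st * jump_prob (ph n) (st n) (ph (Suc n))"
  by (simp add: path_prob_def)

context
  fixes i :: nat
  assumes i: "i \<in> {1, 2}"
begin

interpretation pr: prob_space "P i"
  by (rule prob_space_P[OF i])

lemmas measurable_chain [measurable] = measurable_Z[OF i] measurable_S[OF i] measurable_E[OF i]

lemma measurable_Y [measurable]:
  assumes "k \<ge> 1"
  shows "Y k \<in> borel_measurable (P i)"
  using distributed_measurable[OF claims_exponential[OF i assms]] by simp

lemma path_event_sets [measurable]: "path_event i n ph st \<in> sets (P i)"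
  unfolding path_event_def by measurable

lemma measure_path_event:
  assumes "admissible n ph st" "\<And>m. m < n \<Longrightarrow> t m \<ge> 0"
  shows "pr.prob {\<omega> \<in> path_event i n ph st. \<forall>m<n. S m \<omega> > t m} =
    path_prob i n ph st * (\<Prod>m<n. exp (- rate (ph m) * t m))"
proof -
  have event: "{\<omega> \<in> path_event i n ph st. \<forall>m<n. S m \<omega> > t m} =
      {\<omega> \<in> space (P i). (\<forall>m<n. Z m \<omega> = ph m \<and> S m \<omega> > t m \<and> E m \<omega> = st m) \<and> Z n \<omega> = ph n}"
    by (auto simp: path_event_def)
  have "pr.prob {\<omega> \<in> path_event i n ph st. \<forall>m<n. S m \<omega> > t m} = of_bool (ph 0 = i) *
          (\<Prod>m<n. exp (- rate (ph m) * t m) * (lam (ph m) (st m) / rate (ph m)) *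
                  (if st m = 3 then \<pi> (ph (Suc m)) else of_bool (ph (Suc m) = st m)))"
    using assms unfolding event admissible_def rate_def by (intro chain_law[OF i]) auto
  also have "\<dots> = of_bool (ph 0 = i) *
      (\<Prod>m<n. jump_prob (ph m) (st m) (ph (Suc m)) * exp (- rate (ph m) * t m))"
  proof -
    have rotate: "u * v * w = v * w * u" for u v w :: real
      by simp
    show ?thesis
      unfolding jump_prob_def by (subst rotate) (rule refl)
  qed
  also have "\<dots> = path_prob i n ph st * (\<Prod>m<n. exp (- rate (ph m) * t m))"
    by (simp add: path_prob_def prod.distrib)
  finally show ?thesis .
qed

text \<open>\<open>chain_law\<close> prescribes probabilities only along admissible paths. The
  one-step extensions of such a path are disjoint, and their probabilities add up to that of the
  path because the jump probabilities sum to 1; what remains is a null set.\<close>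

lemma AE_good_step:
  assumes "admissible n ph st"
  shows "AE \<omega> in P i. \<omega> \<in> path_event i n ph st \<and> (\<forall>m<n. S m \<omega> > 0) \<longrightarrow>
    S n \<omega> > 0 \<and> E n \<omega> \<in> {1, 2, 3} - {Z n \<omega>} \<and> Z (Suc n) \<omega> \<in> {1, 2}"
proof -
  define A where "A n ph st = {\<omega> \<in> path_event i n ph st. \<forall>m<n. S m \<omega> > 0}" for n ph st
  have [measurable]: "A n ph st \<in> sets (P i)" for n ph st
    unfolding A_def path_event_def by measurable
  have prob_A: "pr.prob (A n ph st) = path_prob i n ph st" if "admissible n ph st" for n ph st
    using measure_path_event[OF that, of "\<lambda>_. 0"] by (simp add: A_def)
  define B where "B = (\<lambda>(j, k). A (Suc n) (ph(Suc n := k)) (st(n := j)))"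
  define I where "I = ({1, 2, 3} - {ph n}) \<times> {1, 2::nat}"
  have ph_n: "ph n \<in> {1, 2}"
    using assms by (simp add: admissible_def)
  have UN_B: "(\<Union>p\<in>I. B p) \<in> sets (P i)"
    by (rule sets.finite_UN) (auto simp: I_def B_def)
  have sub: "(\<Union>p\<in>I. B p) \<subseteq> A n ph st"
    by (auto simp: B_def A_def path_event_def split: if_splits)
  have "pr.prob (\<Union>p\<in>I. B p) = (\<Sum>p\<in>I. pr.prob (B p))"
  proof (rule pr.finite_measure_finite_Union)
    show "disjoint_family_on B I"
      unfolding disjoint_family_on_def
    proof (intro ballI impI)
      have "(E n \<omega>, Z (Suc n) \<omega>) = p" if "\<omega> \<in> B p" for p \<omega>
        using that unfolding B_def A_def path_event_def by (cases p) auto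
      then show "B p \<inter> B q = {}" if "p \<noteq> q" for p q
        using that by blast
    qed
  qed (auto simp: I_def B_def)
  also have "\<dots> = (\<Sum>p\<in>I. path_prob i n ph st * (case p of (j, k) \<Rightarrow> jump_prob (ph n) j k))"
  proof (rule sum.cong)
    fix p assume "p \<in> I"
    then obtain j k where p: "p = (j, k)" and jk: "j \<in> {1, 2, 3} - {ph n}" "k \<in> {1, 2}"
      by (auto simp: I_def)
    have "admissible (Suc n) (ph(Suc n := k)) (st(n := j))"
      using assms jk by (auto simp: admissible_def less_Suc_eq le_Suc_eq)
    then have "pr.prob (B p) = path_prob i (Suc n) (ph(Suc n := k)) (st(n := j))"
      unfolding p B_def by (simp add: prob_A)
    also have "\<dots> = path_prob i n ph st * jump_prob (ph n) j k"
      by (auto simp: path_prob_def intro!: prod.cong)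
    finally show "pr.prob (B p) = path_prob i n ph st * (case p of (j, k) \<Rightarrow> jump_prob (ph n) j k)"
      by (simp add: p)
  qed simp
  also have "\<dots> = path_prob i n ph st * (\<Sum>j\<in>{1, 2, 3} - {ph n}. \<Sum>k\<in>{1, 2}. jump_prob (ph n) j k)"
    unfolding I_def sum_distrib_left[symmetric] sum.cartesian_product ..
  also have "\<dots> = pr.prob (A n ph st)"
    by (simp only: sum_jump_prob[OF ph_n] mult_1_right prob_A[OF assms])
  finally have "pr.prob (A n ph st - (\<Union>p\<in>I. B p)) = 0"
    using sub UN_B by (subst pr.finite_measure_Diff) auto
  then have "A n ph st - (\<Union>p\<in>I. B p) \<in> null_sets (P i)"
    using UN_B by (simp add: null_setsI pr.emeasure_eq_measure)
  then have "AE \<omega> in P i. \<omega> \<notin> A n ph st - (\<Union>p\<in>I. B p)"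
    by (rule AE_not_in)
  then show ?thesis
  proof eventually_elim
    case (elim \<omega>)
    show ?case
    proof
      assume *: "\<omega> \<in> path_event i n ph st \<and> (\<forall>m<n. S m \<omega> > 0)"
      then have "\<omega> \<in> A n ph st"
        by (simp add: A_def)
      with elim obtain j k where jk: "j \<in> {1, 2, 3} - {ph n}" "k \<in> {1, 2}" "\<omega> \<in> B (j, k)"
        by (auto simp: I_def)
      then have "E n \<omega> = j" "Z (Suc n) \<omega> = k" "S n \<omega> > 0"
        unfolding B_def A_def path_event_def by auto
      with jk * show "S n \<omega> > 0 \<and> E n \<omega> \<in> {1, 2, 3} - {Z n \<omega>} \<and> Z (Suc n) \<omega> \<in> {1, 2}"
        unfolding path_event_def by auto
    qed
  qed
qed

lemma good_path:
  assumes "good i n \<omega>" "\<omega> \<in> space (P i)"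
  defines "p \<equiv> (restrict (\<lambda>m. Z m \<omega>) {..n}, restrict (\<lambda>m. E m \<omega>) {..<n})"
  shows "p \<in> paths n" "\<And>q. q \<in> paths n \<Longrightarrow> \<omega> \<in> path_event i n (fst q) (snd q) \<longleftrightarrow> q = p"
proof -
  show "p \<in> paths n"
    using assms by (auto simp: paths_def admissible_def good_def le_less)
next
  fix q assume "q \<in> paths n"
  then obtain ph st where q: "q = (ph, st)" "ph \<in> {..n} \<rightarrow>\<^sub>E {1, 2}" "st \<in> {..<n} \<rightarrow>\<^sub>E {1, 2, 3}"
    by (auto simp: paths_def)
  have "\<omega> \<in> path_event i n ph st \<longleftrightarrow> (\<forall>m\<le>n. ph m = Z m \<omega>) \<and> (\<forall>m<n. st m = E m \<omega>)"
    using assms(2) by (auto simp: path_event_def le_less)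
  also have "\<dots> \<longleftrightarrow> ph = restrict (\<lambda>m. Z m \<omega>) {..n} \<and> st = restrict (\<lambda>m. E m \<omega>) {..<n}"
    using q(2,3) by (auto simp: fun_eq_iff PiE_def extensional_def)
  finally show "\<omega> \<in> path_event i n (fst q) (snd q) \<longleftrightarrow> q = p"
    by (simp add: q p_def)
qed

lemma AE_good: "AE \<omega> in P i. good i n \<omega>"
proof (induction n)
  case 0
  have "pr.prob {\<omega> \<in> space (P i). Z 0 \<omega> = i} = 1"
    using measure_path_event[of 0 "\<lambda>_. i" "\<lambda>_. 0" "\<lambda>_. 0"] i
    by (simp add: admissible_def path_event_def path_prob_def)
  then have "AE \<omega> in P i. Z 0 \<omega> = i"
    by (auto dest: pr.AE_prob_1)
  then show ?case
    by eventually_elim (use i in \<open>auto simp: good_def\<close>)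
next
  case (Suc n)
  have "AE \<omega> in P i. \<forall>p\<in>paths n. \<omega> \<in> path_event i n (fst p) (snd p) \<and> (\<forall>m<n. S m \<omega> > 0) \<longrightarrow>
    S n \<omega> > 0 \<and> E n \<omega> \<in> {1, 2, 3} - {Z n \<omega>} \<and> Z (Suc n) \<omega> \<in> {1, 2}"
    by (rule AE_finite_allI[OF finite_paths], rule AE_good_step) (simp add: paths_def)
  with Suc AE_space show ?case
  proof eventually_elim
    case (elim \<omega>)
    note p = good_path[OF elim(1,2)]
    have "\<forall>m<n. S m \<omega> > 0"
      using elim(1) by (simp add: good_def)
    with elim(3) p have "S n \<omega> > 0 \<and> E n \<omega> \<in> {1, 2, 3} - {Z n \<omega>} \<and> Z (Suc n) \<omega> \<in> {1, 2}"
      by blast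
    with elim(1) show ?case
      by (auto simp: good_def less_Suc_eq)
  qed
qed

lemma nn_integral_paths:
  assumes [measurable]: "g \<in> borel_measurable (P i)"
  shows "(\<integral>\<^sup>+\<omega>. g \<omega> \<partial>P i) =
    (\<Sum>p\<in>paths n. \<integral>\<^sup>+\<omega>. g \<omega> * indicator (path_event i n (fst p) (snd p)) \<omega> \<partial>P i)"
proof -
  have "(\<integral>\<^sup>+\<omega>. g \<omega> \<partial>P i) =
      (\<integral>\<^sup>+\<omega>. (\<Sum>p\<in>paths n. g \<omega> * indicator (path_event i n (fst p) (snd p)) \<omega>) \<partial>P i)"
  proof (rule nn_integral_cong_AE)
    show "AE \<omega> in P i. g \<omega> = (\<Sum>p\<in>paths n. g \<omega> * indicator (path_event i n (fst p) (snd p)) \<omega>)"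
      using AE_good[of n] AE_space
    proof eventually_elim
      case (elim \<omega>)
      note p = good_path[OF elim]
      have "(\<Sum>p\<in>paths n. g \<omega> * indicator (path_event i n (fst p) (snd p)) \<omega>) =
          (\<Sum>q\<in>paths n. if q = (restrict (\<lambda>m. Z m \<omega>) {..n}, restrict (\<lambda>m. E m \<omega>) {..<n}) then g \<omega> else 0)"
        by (rule sum.cong) (auto simp: p(2) indicator_def simp del: restrict_apply)
      also have "\<dots> = g \<omega>"
        using p(1) finite_paths by (simp add: sum.delta)
      finally show ?case by simp
    qed
  qed
  also have "\<dots> = (\<Sum>p\<in>paths n. \<integral>\<^sup>+\<omega>. g \<omega> * indicator (path_event i n (fst p) (snd p)) \<omega> \<partial>P i)"
    by (rule nn_integral_sum) measurable
  finally show ?thesis .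
qed

end

section \<open>Joint law of holding times and claim sizes on a path\<close>

context
  fixes i :: nat
  assumes i: "i \<in> {1, 2}"
begin

interpretation pr: prob_space "P i"
  by (rule prob_space_P[OF i])

lemmas [measurable] = measurable_Z[OF i] measurable_S[OF i] measurable_E[OF i] measurable_Y[OF i]
  path_event_sets[OF i]

text \<open>On a fixed path event the holding times behave as independent exponential variables,
  with the probability of the path as total mass.\<close>

lemma path_law_S:
  assumes adm: "admissible n ph st"
  shows "distr (density (P i) (indicator (path_event i n ph st))) (\<Pi>\<^sub>M m\<in>{..<n}. borel) (\<lambda>\<omega>. \<lambda>m\<in>{..<n}. S m \<omega>) =
    scale_measure (path_prob i n ph st) (\<Pi>\<^sub>M m\<in>{..<n}. hold (ph m))" (is "distr ?D _ ?S = ?N")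
proof (rule measure_eqI_PiM_greaterThan)
  let ?M = "distr ?D (\<Pi>\<^sub>M m\<in>{..<n}. borel) ?S" and ?box = "\<lambda>t. \<Pi>\<^sub>E m\<in>{..<n}. {t m<..}"
  interpret H: product_sigma_finite "\<lambda>m. hold (ph m)"
    by (rule product_sigma_finite_hold)
  show "sets ?N = sets (\<Pi>\<^sub>M m\<in>{..<n}. borel)"
    by (simp cong: sets_PiM_cong)
  have meas [measurable]: "?S \<in> measurable (P i) (\<Pi>\<^sub>M m\<in>{..<n}. borel)"
    by measurable
  have em: "emeasure (?M) X = emeasure (P i) {\<omega> \<in> path_event i n ph st. ?S \<omega> \<in> X}"
    if [measurable]: "X \<in> sets (\<Pi>\<^sub>M m\<in>{..<n}. borel)" for X
  proof -
    have "emeasure (?M) X = emeasure ?D (?S -` X \<inter> space (P i))"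
      by (subst emeasure_distr) simp_all
    also have "\<dots> = (\<integral>\<^sup>+\<omega>. indicator (path_event i n ph st) \<omega> * indicator (?S -` X \<inter> space (P i)) \<omega> \<partial>P i)"
      by (subst emeasure_density) simp_all
    also have "\<dots> = (\<integral>\<^sup>+\<omega>. indicator {\<omega> \<in> path_event i n ph st. ?S \<omega> \<in> X} \<omega> \<partial>P i)"
      by (rule nn_integral_cong) (auto simp: indicator_def)
    also have "\<dots> = emeasure (P i) {\<omega> \<in> path_event i n ph st. ?S \<omega> \<in> X}"
    proof (rule nn_integral_indicator)
      have "{\<omega> \<in> path_event i n ph st. ?S \<omega> \<in> X} = path_event i n ph st \<inter> (?S -` X \<inter> space (P i))"
        by (auto simp: path_event_def)
      then show "{\<omega> \<in> path_event i n ph st. ?S \<omega> \<in> X} \<in> sets (P i)"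
        by simp
    qed
    finally show ?thesis .
  qed
  show "finite_measure (?M)"
    by (rule finite_measureI) (simp add: em pr.emeasure_eq_measure)
  fix t :: "nat \<Rightarrow> real"
  have box: "(?box t) \<in> sets (\<Pi>\<^sub>M m\<in>{..<n}. borel)"
    by (rule sets_PiM_I_finite) auto
  have "emeasure (?M) (?box t) =
      emeasure (P i) {\<omega> \<in> path_event i n ph st. \<forall>m<n. S m \<omega> > t m}"
    unfolding em[OF box] by (intro arg_cong[where f = "emeasure (P i)"]) (auto simp: PiE_iff)
  \<comment> \<open>Negative thresholds may be replaced by 0 because the stays are almost surely
    positive; \<open>chain_law\<close> speaks of nonnegative thresholds.\<close>
  also have "\<dots> = emeasure (P i) {\<omega> \<in> path_event i n ph st. \<forall>m<n. S m \<omega> > max 0 (t m)}"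
  proof (rule emeasure_eq_AE)
    show "AE \<omega> in P i. \<omega> \<in> {\<omega> \<in> path_event i n ph st. \<forall>m<n. S m \<omega> > t m} \<longleftrightarrow>
        \<omega> \<in> {\<omega> \<in> path_event i n ph st. \<forall>m<n. S m \<omega> > max 0 (t m)}"
      using AE_good[OF i, of n] by eventually_elim (auto simp: good_def)
  qed (auto simp: path_event_def)
  also have "\<dots> = ennreal (path_prob i n ph st * (\<Prod>m<n. exp (- rate (ph m) * max 0 (t m))))"
    unfolding pr.emeasure_eq_measure using measure_path_event[OF i adm, of "\<lambda>m. max 0 (t m)"] by simp
  also have "\<dots> = ennreal (path_prob i n ph st) * (\<Prod>m<n. ennreal (exp (- rate (ph m) * max 0 (t m))))"
    by (simp add: ennreal_mult' path_prob_nonneg[OF adm] prod_ennreal)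
  also have "(\<Prod>m<n. ennreal (exp (- rate (ph m) * max 0 (t m)))) = (\<Prod>m<n. emeasure (hold (ph m)) {t m<..})"
    using adm by (intro prod.cong refl emeasure_hold_greaterThan[symmetric]) (auto simp: admissible_def)
  also have "\<dots> = emeasure (\<Pi>\<^sub>M m\<in>{..<n}. hold (ph m)) (?box t)"
    by (subst H.emeasure_PiM) auto
  finally show "emeasure (?M) (?box t) =
      emeasure ?N (?box t)"
    unfolding emeasure_scale_measure .
qed simp_all

lemma claims_law:
  assumes "K \<ge> 1"
  shows "distr (P i) (\<Pi>\<^sub>M k\<in>{1..K}. borel) (\<lambda>\<omega>. \<lambda>k\<in>{1..K}. Y k \<omega>) = (\<Pi>\<^sub>M k\<in>{1..K}. claim_size)"
proof -
  have "pr.indep_vars (\<lambda>_. borel) Y {1..K}"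
    using claims_indep[OF i] by (rule pr.indep_vars_subset) auto
  then have "distr (P i) (\<Pi>\<^sub>M k\<in>{1..K}. borel) (\<lambda>\<omega>. \<lambda>k\<in>{1..K}. Y k \<omega>) =
      (\<Pi>\<^sub>M k\<in>{1..K}. distr (P i) borel (Y k))"
    using assms by (subst (asm) pr.indep_vars_iff_distr_eq_PiM') auto
  also have "\<dots> = (\<Pi>\<^sub>M k\<in>{1..K}. claim_size)"
  proof (rule PiM_cong)
    fix k assume "k \<in> {1..K}"
    then have "distr (P i) lborel (Y k) = claim_size"
      unfolding claim_size_def by (intro distributed_distr_eq_density claims_exponential[OF i]) auto
    moreover have "distr (P i) borel (Y k) = distr (P i) lborel (Y k)"
      by (rule distr_cong) auto
    ultimately show "distr (P i) borel (Y k) = claim_size"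
      by simp
  qed simp
  finally show ?thesis .
qed

text \<open>The path event and the holding times belong to the sigma-algebra of the phases, so their
  independence from the claims turns the joint law into a product.\<close>

lemma nn_integral_path:
  assumes adm: "admissible n ph st" and K: "K \<ge> 1"
    and F: "F \<in> borel_measurable ((\<Pi>\<^sub>M m\<in>{..<n}. borel) \<Otimes>\<^sub>M (\<Pi>\<^sub>M k\<in>{1..K}. borel))"
  shows "(\<integral>\<^sup>+\<omega>. F (\<lambda>m\<in>{..<n}. S m \<omega>, \<lambda>k\<in>{1..K}. Y k \<omega>) * indicator (path_event i n ph st) \<omega> \<partial>P i) =
    path_prob i n ph st * (\<integral>\<^sup>+s. \<integral>\<^sup>+y. F (s, y) \<partial>(\<Pi>\<^sub>M k\<in>{1..K}. claim_size) \<partial>(\<Pi>\<^sub>M m\<in>{..<n}. hold (ph m)))"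
proof -
  note One_nat_def [simp del]
  let ?D = "density (P i) (indicator (path_event i n ph st))"
  let ?BS = "\<Pi>\<^sub>M m\<in>{..<n}. borel :: real measure" and ?BY = "\<Pi>\<^sub>M k\<in>{1..K}. borel :: real measure"
  let ?S = "\<lambda>\<omega>. \<lambda>m\<in>{..<n}. S m \<omega>" and ?Y = "\<lambda>\<omega>. \<lambda>k\<in>{1..K}. Y k \<omega>"
  let ?NS = "\<Pi>\<^sub>M m\<in>{..<n}. hold (ph m)" and ?NY = "\<Pi>\<^sub>M k\<in>{1..K}. claim_size"
  let ?MS = "distr ?D ?BS ?S" and ?J = "distr ?D (?BS \<Otimes>\<^sub>M ?BY) (\<lambda>\<omega>. (?S \<omega>, ?Y \<omega>))"
  interpret H: product_sigma_finite "\<lambda>m. hold (ph m)"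
    by (rule product_sigma_finite_hold)
  interpret C: product_sigma_finite "\<lambda>_ :: nat. claim_size"
    by (rule product_sigma_finite_claim_size)
  interpret NY: sigma_finite_measure ?NY
    by (rule C.sigma_finite) simp
  have [measurable]: "?S \<in> measurable (P i) ?BS"
    by measurable
  have [measurable]: "?Y \<in> measurable (P i) ?BY"
    by measurable
  have sets_NS [simp, measurable_cong]: "sets ?NS = sets ?BS"
    by (intro sets_PiM_cong) simp_all
  have sets_NY [simp, measurable_cong]: "sets ?NY = sets ?BY"
    by (intro sets_PiM_cong) simp_all
  have joint: "?MS \<Otimes>\<^sub>M ?NY = ?J"
  proof (rule pair_measure_eqI)
    have "finite_measure ?D"
      by (rule finite_measureI) (simp add: emeasure_density pr.emeasure_eq_measure)
    then have "finite_measure (?MS)"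
      by (rule finite_measure.finite_measure_distr) simp
    then show "sigma_finite_measure (?MS)"
      by (rule finite_measure.axioms)
    show "sigma_finite_measure ?NY" ..
    show "sets (?MS \<Otimes>\<^sub>M ?NY) = sets (?J)"
      unfolding sets_distr by (rule sets_pair_measure_cong) (simp, rule sets_NY)
    fix A B assume "A \<in> sets (?MS)" "B \<in> sets ?NY"
    then have A [measurable]: "A \<in> sets ?BS" and B [measurable]: "B \<in> sets ?BY"
      by (simp_all only: sets_distr sets_NY)
    let ?A = "path_event i n ph st \<inter> (?S -` A \<inter> space (P i))" and ?B = "?Y -` B \<inter> space (P i)"
    have emD: "emeasure ?D X = emeasure (P i) (path_event i n ph st \<inter> X)" if [measurable]: "X \<in> sets (P i)" for X
    proof -
      have "emeasure ?D X = (\<integral>\<^sup>+\<omega>. indicator (path_event i n ph st) \<omega> * indicator X \<omega> \<partial>P i)"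
        by (subst emeasure_density) simp_all
      also have "\<dots> = (\<integral>\<^sup>+\<omega>. indicator (path_event i n ph st \<inter> X) \<omega> \<partial>P i)"
        by (rule nn_integral_cong) (auto simp: indicator_def)
      also have "\<dots> = emeasure (P i) (path_event i n ph st \<inter> X)"
        by (rule nn_integral_indicator) simp
      finally show ?thesis .
    qed
    have "emeasure (?J) (A \<times> B) =
        emeasure ?D ((\<lambda>\<omega>. (?S \<omega>, ?Y \<omega>)) -` (A \<times> B) \<inter> space (P i))"
      by (subst emeasure_distr) simp_all
    also have "\<dots> = emeasure (P i) (path_event i n ph st \<inter> ((\<lambda>\<omega>. (?S \<omega>, ?Y \<omega>)) -` (A \<times> B) \<inter> space (P i)))"
      by (rule emD) measurable
    also have "path_event i n ph st \<inter> ((\<lambda>\<omega>. (?S \<omega>, ?Y \<omega>)) -` (A \<times> B) \<inter> space (P i)) = ?A \<inter> ?B"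
      by auto
    also have "emeasure (P i) (?A \<inter> ?B) = emeasure (P i) ?A * emeasure (P i) ?B"
    proof -
      let ?C = "\<Pi>\<^sub>M n\<in>UNIV. count_space UNIV \<Otimes>\<^sub>M (borel \<Otimes>\<^sub>M count_space UNIV) :: (nat \<times> real \<times> nat) measure"
      let ?z = "\<lambda>\<omega> n. (Z n \<omega>, S n \<omega>, E n \<omega>)" and ?y = "\<lambda>\<omega>. \<lambda>k\<in>{1..}. Y k \<omega>"
      \<comment> \<open>The event is rewritten on the space of whole trajectories, the form in which
        \<open>claims_indep_phases\<close> states independence.\<close>
      let ?A' = "{z \<in> space ?C. (\<forall>m<n. fst (z m) = ph m \<and> snd (snd (z m)) = st m) \<and> fst (z n) = ph n \<and>
          (\<lambda>m\<in>{..<n}. fst (snd (z m))) \<in> A}"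
      let ?B' = "{y \<in> space (\<Pi>\<^sub>M k\<in>{1..}. borel :: real measure). restrict y {1..K} \<in> B}"
      have "?A' \<in> sets ?C"
        by measurable
      then have "?z -` ?A' \<inter> space (P i) \<in> sets (vimage_algebra (space (P i)) ?z ?C)"
        by (rule in_vimage_algebra)
      moreover have "?z -` ?A' \<inter> space (P i) = ?A"
        by (auto simp: path_event_def space_PiM space_pair_measure)
      moreover have [measurable]: "(\<lambda>y. restrict y {1..K}) \<in> measurable (\<Pi>\<^sub>M k\<in>{1..}. borel) ?BY"
        by (rule measurable_restrict_subset) auto
      have "?B' \<in> sets (\<Pi>\<^sub>M k\<in>{1..}. borel :: real measure)"
        by measurable
      then have "?y -` ?B' \<inter> space (P i) \<in> sets (vimage_algebra (space (P i)) ?y (\<Pi>\<^sub>M k\<in>{1..}. borel))"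
        by (rule in_vimage_algebra)
      moreover have "?y -` ?B' \<inter> space (P i) = ?B"
      proof -
        have "restrict (?y \<omega>) {1..K} = ?Y \<omega>" for \<omega>
          by (auto simp: restrict_def)
        then show ?thesis
          by (auto simp: space_PiM)
      qed
      ultimately have "pr.prob (?A \<inter> ?B) = pr.prob ?A * pr.prob ?B"
        by (intro pr.indep_setD[OF claims_indep_phases[OF i]]) simp_all
      then show ?thesis
        by (simp add: pr.emeasure_eq_measure ennreal_mult')
    qed
    also have "emeasure (P i) ?A = emeasure (?MS) A"
      by (subst emeasure_distr) (simp_all add: emD)
    also have "emeasure (P i) ?B = emeasure ?NY B"
      unfolding claims_law[OF K, symmetric] by (subst emeasure_distr) simp_all
    finally show "emeasure (?MS) A * emeasure ?NY B =
        emeasure (?J) (A \<times> B)" ..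
  qed
  note F [measurable]
  have "(\<integral>\<^sup>+\<omega>. F (?S \<omega>, ?Y \<omega>) * indicator (path_event i n ph st) \<omega> \<partial>P i) = (\<integral>\<^sup>+\<omega>. F (?S \<omega>, ?Y \<omega>) \<partial>?D)"
    by (subst nn_integral_density) (simp_all add: mult.commute)
  also have "\<dots> = (\<integral>\<^sup>+z. F z \<partial>(?MS \<Otimes>\<^sub>M ?NY))"
    unfolding joint by (subst nn_integral_distr) simp_all
  also have "\<dots> = (\<integral>\<^sup>+s. \<integral>\<^sup>+y. F (s, y) \<partial>?NY \<partial>?MS)"
    by (subst NY.nn_integral_fst) (simp_all cong: measurable_cong_sets)
  also have "\<dots> = path_prob i n ph st * (\<integral>\<^sup>+s. \<integral>\<^sup>+y. F (s, y) \<partial>?NY \<partial>?NS)"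
    unfolding path_law_S[OF adm] by (rule nn_integral_scale_measure) measurable
  finally show ?thesis .
qed

end

section \<open>The Markov property\<close>

abbreviation claim_count :: "(nat \<Rightarrow> nat) \<Rightarrow> nat \<Rightarrow> nat" where
  "claim_count st n \<equiv> card {k. k < n \<and> st k = 3}"

text \<open>After ruin the surplus is frozen at \<open>- 1\<close>.\<close>

definition next_level :: "(nat \<Rightarrow> real) \<Rightarrow> real \<Rightarrow> nat \<Rightarrow> real \<Rightarrow> nat \<Rightarrow> real \<Rightarrow> real" where
  "next_level b u i t j y = (if u < 0 then - 1 else min (u + c * t) (b i) - (if j = 3 then y else 0))"

text \<open>Driven by deterministic sequences, so that it can be integrated over product spaces. The
  sequence \<open>y\<close> is indexed by the number of the claim, hence the successor of the count
  so far.\<close>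

primrec surplus :: "(nat \<Rightarrow> real) \<Rightarrow> real \<Rightarrow> (nat \<Rightarrow> nat) \<Rightarrow> (nat \<Rightarrow> nat) \<Rightarrow> (nat \<Rightarrow> real) \<Rightarrow> (nat \<Rightarrow> real) \<Rightarrow>
    nat \<Rightarrow> real" where
  "surplus b x ph st s y 0 = x"
| "surplus b x ph st s y (Suc n) =
    next_level b (surplus b x ph st s y n) (ph n) (s n) (st n) (y (Suc (claim_count st n)))"

definition state :: "(nat \<Rightarrow> real) \<Rightarrow> real \<Rightarrow> 'w \<Rightarrow> nat \<Rightarrow> real" where
  "state b x \<omega> n = surplus b x (\<lambda>m. Z m \<omega>) (\<lambda>m. E m \<omega>) (\<lambda>m. S m \<omega>) (\<lambda>k. Y k \<omega>) n"

lemma state_0 [simp]: "state b x \<omega> 0 = x"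
  by (simp add: state_def)

lemma state_Suc:
  "state b x \<omega> (Suc n) = next_level b (state b x \<omega> n) (Z n \<omega>) (S n \<omega>) (E n \<omega>) (Y (Suc (claims \<omega> n)) \<omega>)"
  by (simp add: state_def claims_def)

text \<open>Freezing at a negative value stores ruin in the sign of the surplus, so that phase and
  surplus alone carry the Markov property; before ruin nothing is altered.\<close>

lemma state_ruined:
  "(state b x \<omega> n < 0 \<longleftrightarrow> ruined b x \<omega> n) \<and> (\<not> ruined b x \<omega> n \<longrightarrow> state b x \<omega> n = level b x \<omega> n)"
proof (induction n)
  case 0
  then show ?case by simp
next
  case (Suc n)
  show ?case
  proof (cases "ruined b x \<omega> n")
    case True
    with Suc show ?thesis
      by (simp add: state_Suc next_level_def)
  next
    case False
    with Suc have "state b x \<omega> (Suc n) = level b x \<omega> (Suc n)"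
      by (simp add: state_Suc next_level_def level_Suc)
    with False show ?thesis
      by (simp add: ruined_Suc del: ruined.simps)
  qed
qed

lemma claim_count_mono: "m \<le> n \<Longrightarrow> claim_count st m \<le> claim_count st n"
  by (intro card_mono) auto

text \<open>Later coordinates can thus be overwritten or integrated out without touching the surplus
  after \<open>n\<close> events.\<close>

lemma surplus_cong:
  assumes "\<And>m. m < n \<Longrightarrow> ph m = ph' m \<and> st m = st' m \<and> s m = s' m"
    and "\<And>k. 1 \<le> k \<Longrightarrow> k \<le> claim_count st n \<Longrightarrow> y k = y' k"
  shows "surplus b x ph st s y n = surplus b x ph' st' s' y' n"
  using assms
proof (induction n)
  case 0
  then show ?case by simp
next
  case (Suc n)
  have IH: "surplus b x ph st s y n = surplus b x ph' st' s' y' n"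
  proof (rule Suc.IH)
    show "y k = y' k" if "1 \<le> k" "k \<le> claim_count st n" for k
      using that claim_count_mono[of n "Suc n" st] by (intro Suc.prems(2)) auto
  qed (use Suc.prems(1) in auto)
  have count: "claim_count st n = claim_count st' n"
    using Suc.prems(1) by (intro arg_cong[where f = card]) auto
  have "y (Suc (claim_count st n)) = y' (Suc (claim_count st n))" if "st n = 3"
  proof (rule Suc.prems(2))
    have "{k. k < Suc n \<and> st k = 3} = insert n {k. k < n \<and> st k = 3}"
      using that by auto
    then show "Suc (claim_count st n) \<le> claim_count st (Suc n)"
      by simp
  qed simp
  with IH count Suc.prems(1)[of n] show ?case
    by (simp add: next_level_def)
qed

lemma measurable_next_level [measurable (raw)]:
  assumes [measurable]: "u \<in> borel_measurable M" "t \<in> borel_measurable M" "y \<in> borel_measurable M"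
    "i \<in> measurable M (count_space UNIV)" "j \<in> measurable M (count_space UNIV)"
  shows "(\<lambda>z. next_level b (u z) (i z) (t z) (j z) (y z)) \<in> borel_measurable M"
  unfolding next_level_def by measurable

lemma measurable_surplus:
  assumes "n \<le> L" "claim_count st n \<le> K"
  shows "(\<lambda>z. surplus b x ph st (fst z) (snd z) n) \<in>
    borel_measurable ((\<Pi>\<^sub>M m\<in>{..<L}. borel) \<Otimes>\<^sub>M (\<Pi>\<^sub>M k\<in>{1..K}. borel))"
  using assms
proof (induction n)
  case 0
  then show ?case by simp
next
  case (Suc n)
  let ?M = "(\<Pi>\<^sub>M m\<in>{..<L}. borel) \<Otimes>\<^sub>M (\<Pi>\<^sub>M k\<in>{1..K}. borel) :: ((nat \<Rightarrow> real) \<times> (nat \<Rightarrow> real)) measure"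
  have [measurable]: "(\<lambda>z. surplus b x ph st (fst z) (snd z) n) \<in> borel_measurable ?M"
    using Suc.prems claim_count_mono[of n "Suc n" st] by (intro Suc.IH) auto
  have "n \<in> {..<L}"
    using Suc.prems by simp
  then have [measurable]: "(\<lambda>z. fst z n) \<in> borel_measurable ?M"
    by measurable
  have "(\<lambda>z. next_level b (surplus b x ph st (fst z) (snd z) n) (ph n) (fst z n) (st n)
      (snd z (Suc (claim_count st n)))) \<in> borel_measurable ?M"
  proof (cases "st n = 3")
    case True
    then have "{k. k < Suc n \<and> st k = 3} = insert n {k. k < n \<and> st k = 3}"
      by auto
    then have "Suc (claim_count st n) \<in> {1..K}"
      using Suc.prems by simp
    then have [measurable]: "(\<lambda>z. snd z (Suc (claim_count st n))) \<in> borel_measurable ?M"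
      by measurable
    show ?thesis
      by measurable
  next
    case False
    \<comment> \<open>Without a claim the next level does not depend on the claim coordinate, whose
      index may exceed \<open>K\<close>; the value 0 stands in for it.\<close>
    then have "(\<lambda>z. next_level b (surplus b x ph st (fst z) (snd z) n) (ph n) (fst z n) (st n)
        (snd z (Suc (claim_count st n)))) =
      (\<lambda>z. next_level b (surplus b x ph st (fst z) (snd z) n) (ph n) (fst z n) (st n) 0)"
      by (auto simp: next_level_def fun_eq_iff)
    then show ?thesis
      by (simp only:) measurable
  qed
  then show ?case
    by simp
qed

context
  fixes i :: nat
  assumes i: "i \<in> {1, 2}"
begin

interpretation pr: prob_space "P i"
  by (rule prob_space_P[OF i])

lemmas [measurable] = measurable_Z[OF i] measurable_S[OF i] measurable_E[OF i] measurable_Y[OF i]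
  path_event_sets[OF i]

lemma measurable_claims [measurable]: "(\<lambda>\<omega>. claims \<omega> n) \<in> measurable (P i) (count_space UNIV)"
  unfolding claims_def by measurable

lemma measurable_next_claim [measurable]: "(\<lambda>\<omega>. Y (Suc (claims \<omega> n)) \<omega>) \<in> borel_measurable (P i)"
  by (rule measurable_compose_countable[where g = "\<lambda>\<omega>. claims \<omega> n"]) measurable

lemma measurable_epoch [measurable]: "(\<lambda>\<omega>. epoch \<omega> n) \<in> borel_measurable (P i)"
  unfolding epoch_def by measurable

lemma measurable_state [measurable]: "(\<lambda>\<omega>. state b x \<omega> n) \<in> borel_measurable (P i)"
  by (induction n) (simp_all add: state_Suc)

text \<open>On one path the law is a product, so the last holding time and the next claim can be
  integrated out by Fubini. The additional factor in the probability of the longer path is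
  \<open>jump_prob\<close>.\<close>

lemma markov_path:
  assumes adm: "admissible (Suc n) ph st"
    and [measurable]: "\<psi> \<in> borel_measurable (borel \<Otimes>\<^sub>M borel \<Otimes>\<^sub>M borel)"
  shows "(\<integral>\<^sup>+\<omega>. ennreal (exp (- \<delta> * epoch \<omega> n)) * \<psi> (state b x \<omega> n, S n \<omega>, Y (Suc (claims \<omega> n)) \<omega>) *
      indicator (path_event i (Suc n) ph st) \<omega> \<partial>P i) =
    jump_prob (ph n) (st n) (ph (Suc n)) *
    (\<integral>\<^sup>+\<omega>. ennreal (exp (- \<delta> * epoch \<omega> n)) * (\<integral>\<^sup>+t. \<integral>\<^sup>+y. \<psi> (state b x \<omega> n, t, y) \<partial>claim_size \<partial>hold (ph n)) *
      indicator (path_event i n ph st) \<omega> \<partial>P i)"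
proof -
  note One_nat_def [simp del]
  define k where "k = claim_count st n"
  let ?i = "\<lambda>n. indicator (path_event i n ph st) :: 'w \<Rightarrow> ennreal"
  let ?d = "\<lambda>\<omega>. ennreal (exp (- \<delta> * epoch \<omega> n))"
  let ?g = "\<lambda>\<omega>. \<psi> (state b x \<omega> n, S n \<omega>, Y (Suc (claims \<omega> n)) \<omega>)"
  \<comment> \<open>One claim beyond the \<open>k\<close> already used: it is the one that
    \<open>\<psi>\<close> sees, and it keeps the block of claims nonempty even if
    \<open>k = 0\<close>.\<close>
  let ?S = "\<lambda>L \<omega>. \<lambda>m\<in>{..<L}. S m \<omega>" and ?Y = "\<lambda>\<omega>. \<lambda>l\<in>{1..Suc k}. Y l \<omega>"
  define h where "h s = ennreal (exp (- \<delta> * (\<Sum>m<n. s m)))" for s :: "nat \<Rightarrow> real"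
  define U where "U z = surplus b x ph st (fst z) (snd z) n" for z
  define G where "G u = (\<integral>\<^sup>+t. \<integral>\<^sup>+y. \<psi> (u, t, y) \<partial>claim_size \<partial>hold (ph n))" for u
  interpret H: product_sigma_finite "\<lambda>m. hold (ph m)"
    by (rule product_sigma_finite_hold)
  interpret C: product_sigma_finite "\<lambda>_ :: nat. claim_size"
    by (rule product_sigma_finite_claim_size)
  interpret c: prob_space claim_size
    by (rule prob_space_claim_size)
  interpret hn: sigma_finite_measure "hold (ph n)"
    by (rule sigma_finite_hold)
  have [measurable]: "G \<in> borel_measurable borel"
    unfolding G_def by measurable
  let ?BS = "\<lambda>L. (\<Pi>\<^sub>M m\<in>{..<L}. borel) :: (nat \<Rightarrow> real) measure"
  let ?BY = "\<lambda>K. (\<Pi>\<^sub>M k\<in>{1..K}. borel) :: (nat \<Rightarrow> real) measure"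
  let ?NS = "\<lambda>L. \<Pi>\<^sub>M m\<in>{..<L}. hold (ph m)"
  let ?NY = "\<lambda>K. \<Pi>\<^sub>M k\<in>{1..K}. claim_size"
  have sets_NS: "sets (?NS L) = sets (?BS L)" for L
    by (intro sets_PiM_cong) simp_all
  have sets_NY: "sets (?NY K) = sets (?BY K)" for K
    by (intro sets_PiM_cong) simp_all
  note [measurable_cong] = sets_NS sets_NY
  have U [measurable]: "U \<in> borel_measurable (?BS L \<Otimes>\<^sub>M ?BY K)" if "n \<le> L" "k \<le> K" for L K
    unfolding U_def using that by (intro measurable_surplus) (auto simp: k_def)
  have U_s: "(\<lambda>y. U (s, y)) \<in> borel_measurable (?NY k)" if "s \<in> space (?NS n)" for s
  proof -
    have "Pair s \<in> measurable (?BY k) (?BS n \<Otimes>\<^sub>M ?BY k)"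
      using that by (intro measurable_Pair1') (simp add: sets_eq_imp_space_eq[OF sets_NS])
    from measurable_compose[OF this U[OF order_refl order_refl]]
    show ?thesis
      by (simp cong: measurable_cong_sets add: sets_NY del: One_nat_def)
  qed
  have U_upd: "U (s(n := t), y) = U (s, y)" "U (s, y(Suc k := y')) = U (s, y)" for s t y y'
    unfolding U_def by (auto intro!: surplus_cong simp: k_def)
  have h_upd: "h (s(n := t)) = h s" for s t
    unfolding h_def by simp
  have h_meas: "h \<in> borel_measurable (?BS L)" if "n \<le> L" for L
  proof -
    have "m \<in> {..<L}" if "m \<in> {..<n}" for m
      using that \<open>n \<le> L\<close> by simp
    then show ?thesis
      unfolding h_def by measurable
  qed
  define F1 where "F1 z = h (fst z) * \<psi> (U z, fst z n, snd z (Suc k))" for z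
  define F2 where "F2 z = h (fst z) * G (U z)" for z
  have F1 [measurable]: "F1 \<in> borel_measurable (?BS (Suc n) \<Otimes>\<^sub>M ?BY (Suc k))"
  proof -
    have [measurable]: "h \<in> borel_measurable (?BS (Suc n))" "U \<in> borel_measurable (?BS (Suc n) \<Otimes>\<^sub>M ?BY (Suc k))"
      by (rule h_meas, simp) (rule U, simp_all)
    show ?thesis
      unfolding F1_def by measurable
  qed
  have F2 [measurable]: "F2 \<in> borel_measurable (?BS n \<Otimes>\<^sub>M ?BY (Suc k))"
  proof -
    have [measurable]: "h \<in> borel_measurable (?BS n)" "U \<in> borel_measurable (?BS n \<Otimes>\<^sub>M ?BY (Suc k))"
      by (rule h_meas, simp) (rule U, simp_all)
    show ?thesis
      unfolding F2_def by measurable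
  qed
  have insert_k: "{1..Suc k} = insert (Suc k) {1..k}"
    by auto
  have peel_y: "(\<integral>\<^sup>+y. f y \<partial>?NY (Suc k)) = (\<integral>\<^sup>+y. \<integral>\<^sup>+y'. f (y(Suc k := y')) \<partial>claim_size \<partial>?NY k)"
    if "f \<in> borel_measurable (?BY (Suc k))" for f :: "_ \<Rightarrow> ennreal"
    using that unfolding insert_k
    by (intro C.product_nn_integral_insert) (auto cong: measurable_cong_sets sets_PiM_cong)
  have on_path: "state b x \<omega> n = U (?S L \<omega>, ?Y \<omega>)"
      "claims \<omega> n = k" "?d \<omega> = h (?S L \<omega>)"
    if "\<forall>m<n. Z m \<omega> = ph m \<and> E m \<omega> = st m" "n \<le> L" for \<omega> L
  proof -
    show count: "claims \<omega> n = k"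
      unfolding claims_def k_def using that by (intro arg_cong[where f = card]) auto
    show "state b x \<omega> n = U (?S L \<omega>, ?Y \<omega>)"
      unfolding state_def U_def fst_conv snd_conv using that count
      by (intro surplus_cong) (auto simp: claims_def)
    show "?d \<omega> = h (?S L \<omega>)"
      unfolding h_def epoch_def using that by simp
  qed
  have adm': "admissible n ph st"
    using adm by (auto simp: admissible_def)
  have "(\<integral>\<^sup>+\<omega>. ?d \<omega> * ?g \<omega> *
      ?i (Suc n) \<omega> \<partial>P i) =
    (\<integral>\<^sup>+\<omega>. F1 (?S (Suc n) \<omega>, ?Y \<omega>) * ?i (Suc n) \<omega> \<partial>P i)"
  proof (rule nn_integral_cong)
    fix \<omega>
    show "?d \<omega> * ?g \<omega> *
        ?i (Suc n) \<omega> =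
      F1 (?S (Suc n) \<omega>, ?Y \<omega>) * ?i (Suc n) \<omega>"
    proof (cases "\<omega> \<in> path_event i (Suc n) ph st")
      case True
      then have "\<forall>m<n. Z m \<omega> = ph m \<and> E m \<omega> = st m"
        by (simp add: path_event_def)
      note p = on_path[OF this le_SucI[OF order_refl]]
      show ?thesis
        by (simp only: p F1_def fst_conv snd_conv) simp
    qed simp
  qed
  also have "\<dots> = path_prob i (Suc n) ph st * (\<integral>\<^sup>+s. \<integral>\<^sup>+y. F1 (s, y) \<partial>?NY (Suc k) \<partial>?NS (Suc n))"
    by (rule nn_integral_path[OF i adm _ F1]) simp
  also have "(\<integral>\<^sup>+s. \<integral>\<^sup>+y. F1 (s, y) \<partial>?NY (Suc k) \<partial>?NS (Suc n)) =
      (\<integral>\<^sup>+s. \<integral>\<^sup>+t. (\<integral>\<^sup>+y. F1 (s(n := t), y) \<partial>?NY (Suc k)) \<partial>hold (ph n) \<partial>?NS n)"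
  proof -
    interpret NY: sigma_finite_measure "?NY (Suc k)"
      by (rule C.sigma_finite) simp
    have "(\<lambda>s. \<integral>\<^sup>+y. F1 (s, y) \<partial>?NY (Suc k)) \<in> borel_measurable (?NS (Suc n))"
      by measurable
    then show ?thesis
      unfolding lessThan_Suc by (intro H.product_nn_integral_insert) auto
  qed
  also have "\<dots> = (\<integral>\<^sup>+s. \<integral>\<^sup>+y. h s * G (U (s, y)) \<partial>?NY k \<partial>?NS n)"
  proof (rule nn_integral_cong)
    fix s assume s: "s \<in> space (?NS n)"
    interpret NY: sigma_finite_measure "?NY k"
      by (rule C.sigma_finite) simp
    interpret pair_sigma_finite "?NY k" "hold (ph n)" ..
    note [measurable] = U_s[OF s]
    have "(\<integral>\<^sup>+t. (\<integral>\<^sup>+y. F1 (s(n := t), y) \<partial>?NY (Suc k)) \<partial>hold (ph n)) =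
        (\<integral>\<^sup>+t. (\<integral>\<^sup>+y. \<integral>\<^sup>+y'. h s * \<psi> (U (s, y), t, y') \<partial>claim_size \<partial>?NY k) \<partial>hold (ph n))"
    proof (rule nn_integral_cong)
      fix t
      have "s(n := t) \<in> space (?BS (Suc n))"
        using s by (auto simp: space_PiM PiE_def extensional_def)
      then have "(\<lambda>y. F1 (s(n := t), y)) \<in> borel_measurable (?BY (Suc k))"
        by (rule measurable_compose[OF measurable_Pair1' F1])
      then show "(\<integral>\<^sup>+y. F1 (s(n := t), y) \<partial>?NY (Suc k)) =
          (\<integral>\<^sup>+y. \<integral>\<^sup>+y'. h s * \<psi> (U (s, y), t, y') \<partial>claim_size \<partial>?NY k)"
        by (subst peel_y) (simp_all add: F1_def U_upd h_upd)
    qed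
    also have "\<dots> = (\<integral>\<^sup>+y. (\<integral>\<^sup>+t. \<integral>\<^sup>+y'. h s * \<psi> (U (s, y), t, y') \<partial>claim_size \<partial>hold (ph n)) \<partial>?NY k)"
      by (rule Fubini') measurable
    also have "\<dots> = (\<integral>\<^sup>+y. h s * G (U (s, y)) \<partial>?NY k)"
      unfolding G_def by (simp add: nn_integral_cmult)
    finally show "(\<integral>\<^sup>+t. (\<integral>\<^sup>+y. F1 (s(n := t), y) \<partial>?NY (Suc k)) \<partial>hold (ph n)) =
        (\<integral>\<^sup>+y. h s * G (U (s, y)) \<partial>?NY k)" .
  qed
  \<comment> \<open>The next claim is reinstated as a dummy variable under the probability measure
    \<open>claim_size\<close>, so that \<open>nn_integral_path\<close> applies backwards with the
    same block of claims.\<close>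
  also have "\<dots> = (\<integral>\<^sup>+s. \<integral>\<^sup>+y. F2 (s, y) \<partial>?NY (Suc k) \<partial>?NS n)"
  proof (rule nn_integral_cong)
    fix s assume s: "s \<in> space (?NS n)"
    then have "s \<in> space (?BS n)"
      by (simp add: sets_eq_imp_space_eq[OF sets_NS])
    then have "(\<lambda>y. F2 (s, y)) \<in> borel_measurable (?BY (Suc k))"
      by (rule measurable_compose[OF measurable_Pair1' F2])
    then show "(\<integral>\<^sup>+y. h s * G (U (s, y)) \<partial>?NY k) = (\<integral>\<^sup>+y. F2 (s, y) \<partial>?NY (Suc k))"
      by (subst peel_y) (simp_all add: F2_def U_upd c.emeasure_space_1[simplified])
  qed
  also have "path_prob i (Suc n) ph st * (\<integral>\<^sup>+s. \<integral>\<^sup>+y. F2 (s, y) \<partial>?NY (Suc k) \<partial>?NS n) =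
      jump_prob (ph n) (st n) (ph (Suc n)) *
        (path_prob i n ph st * (\<integral>\<^sup>+s. \<integral>\<^sup>+y. F2 (s, y) \<partial>?NY (Suc k) \<partial>?NS n))"
    by (simp add: path_prob_Suc ennreal_mult' path_prob_nonneg[OF adm'] mult_ac)
  also have "path_prob i n ph st * (\<integral>\<^sup>+s. \<integral>\<^sup>+y. F2 (s, y) \<partial>?NY (Suc k) \<partial>?NS n) =
      (\<integral>\<^sup>+\<omega>. F2 (?S n \<omega>, ?Y \<omega>) * ?i n \<omega> \<partial>P i)"
    by (rule nn_integral_path[OF i adm' _ F2, symmetric]) simp
  also have "\<dots> = (\<integral>\<^sup>+\<omega>. ?d \<omega> *
      (\<integral>\<^sup>+t. \<integral>\<^sup>+y. \<psi> (state b x \<omega> n, t, y) \<partial>claim_size \<partial>hold (ph n)) * ?i n \<omega> \<partial>P i)"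
  proof (rule nn_integral_cong)
    fix \<omega>
    show "F2 (?S n \<omega>, ?Y \<omega>) * ?i n \<omega> =
      ?d \<omega> * (\<integral>\<^sup>+t. \<integral>\<^sup>+y. \<psi> (state b x \<omega> n, t, y) \<partial>claim_size \<partial>hold (ph n)) *
        ?i n \<omega>"
    proof (cases "\<omega> \<in> path_event i n ph st")
      case True
      then have "\<forall>m<n. Z m \<omega> = ph m \<and> E m \<omega> = st m"
        by (simp add: path_event_def)
      note p = on_path[OF this order_refl]
      show ?thesis
        by (simp only: p F2_def G_def fst_conv snd_conv)
    qed simp
  qed
  finally show ?thesis .
qed

end

text \<open>\<open>\<psi>\<close> receives the phase left, the state entered and the new phase,
  together with surplus, holding time and next claim size. One operator thus serves both rewards and
  continuation values.\<close>

definition step :: "(nat \<Rightarrow> nat \<Rightarrow> nat \<Rightarrow> real \<times> real \<times> real \<Rightarrow> ennreal) \<Rightarrow> nat \<Rightarrow> real \<Rightarrow> ennreal" where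
  "step \<psi> i u = (\<Sum>j\<in>{1, 2, 3} - {i}. \<Sum>k\<in>{1, 2}. jump_prob i j k *
     (\<integral>\<^sup>+t. \<integral>\<^sup>+y. \<psi> i j k (u, t, y) \<partial>claim_size \<partial>hold i))"

lemma sigma_finite_claim_size: "sigma_finite_measure claim_size"
  by (rule prob_space_imp_sigma_finite[OF prob_space_claim_size])

lemma measurable_hold_claim [measurable]:
  assumes [measurable]: "\<psi> \<in> borel_measurable (borel \<Otimes>\<^sub>M borel \<Otimes>\<^sub>M borel)"
  shows "(\<lambda>u. \<integral>\<^sup>+t. \<integral>\<^sup>+y. \<psi> (u, t, y) \<partial>claim_size \<partial>hold i) \<in> borel_measurable borel"
proof -
  interpret c: sigma_finite_measure claim_size
    by (rule sigma_finite_claim_size)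
  interpret h: sigma_finite_measure "hold i"
    by (rule sigma_finite_hold)
  show ?thesis
    by measurable
qed

lemma measurable_step [measurable]:
  assumes [measurable]: "\<And>i j k. \<psi> i j k \<in> borel_measurable (borel \<Otimes>\<^sub>M borel \<Otimes>\<^sub>M borel)"
  shows "step \<psi> i \<in> borel_measurable borel"
  unfolding step_def by measurable

text \<open>The version for one path is summed over the finitely many paths and over their one-step
  extensions, of which almost surely exactly one occurs.\<close>

lemma markov:
  assumes i: "i \<in> {1, 2}"
    and \<psi> [measurable]: "\<And>a j k. \<psi> a j k \<in> borel_measurable (borel \<Otimes>\<^sub>M borel \<Otimes>\<^sub>M borel)"
  shows "(\<integral>\<^sup>+\<omega>. ennreal (exp (- \<delta> * epoch \<omega> n)) *
      \<psi> (Z n \<omega>) (E n \<omega>) (Z (Suc n) \<omega>) (state b x \<omega> n, S n \<omega>, Y (Suc (claims \<omega> n)) \<omega>) \<partial>P i) =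
    (\<integral>\<^sup>+\<omega>. ennreal (exp (- \<delta> * epoch \<omega> n)) * step \<psi> (Z n \<omega>) (state b x \<omega> n) \<partial>P i)"
    (is "(\<integral>\<^sup>+\<omega>. ?d \<omega> * ?l \<omega> \<partial>P i) = (\<integral>\<^sup>+\<omega>. ?d \<omega> * ?r \<omega> \<partial>P i)")
proof -
  note [measurable] = measurable_Z[OF i] measurable_S[OF i] measurable_E[OF i] path_event_sets[OF i]
    measurable_next_claim[OF i] measurable_epoch[OF i] measurable_state[OF i]
  let ?v = "\<lambda>\<omega>. (state b x \<omega> n, S n \<omega>, Y (Suc (claims \<omega> n)) \<omega>)"
  have [measurable]: "?l \<in> borel_measurable (P i)"
  proof -
    let ?g = "\<lambda>\<omega>. (Z n \<omega>, E n \<omega>, Z (Suc n) \<omega>)"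
    have "(\<lambda>\<omega>. \<psi> (fst (?g \<omega>)) (fst (snd (?g \<omega>))) (snd (snd (?g \<omega>))) (?v \<omega>)) \<in> borel_measurable (P i)"
    proof (rule measurable_compose_countable[where g = ?g and
          f = "\<lambda>p \<omega>. \<psi> (fst p) (fst (snd p)) (snd (snd p)) (?v \<omega>)"])
      show "(\<lambda>\<omega>. (Z n \<omega>, E n \<omega>, Z (Suc n) \<omega>)) \<in> measurable (P i) (count_space UNIV)"
        by measurable
      show "(\<lambda>\<omega>. \<psi> (fst p) (fst (snd p)) (snd (snd p)) (?v \<omega>)) \<in> borel_measurable (P i)" for p
        by measurable
    qed
    then show ?thesis by simp
  qed
  have [measurable]: "?r \<in> borel_measurable (P i)"
    by (rule measurable_compose_countable[where g = "Z n"]) measurable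
  have path: "(\<integral>\<^sup>+\<omega>. ?d \<omega> * ?l \<omega> * indicator (path_event i n ph st) \<omega> \<partial>P i) =
      (\<integral>\<^sup>+\<omega>. ?d \<omega> * ?r \<omega> * indicator (path_event i n ph st) \<omega> \<partial>P i)" if adm: "admissible n ph st" for ph st
  proof -
    let ?J = "{1, 2, 3} - {ph n}"
    let ?i = "indicator (path_event i n ph st) :: 'w \<Rightarrow> ennreal"
    let ?I = "\<lambda>j k \<omega>. \<integral>\<^sup>+t. \<integral>\<^sup>+y. \<psi> (ph n) j k (state b x \<omega> n, t, y) \<partial>claim_size \<partial>hold (ph n)"
    let ?ext = "\<lambda>j k. path_event i (Suc n) (ph(Suc n := k)) (st(n := j))"
    let ?x = "\<lambda>j k. indicator (?ext j k) :: 'w \<Rightarrow> ennreal"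
    have "(\<integral>\<^sup>+\<omega>. ?d \<omega> * ?l \<omega> * ?i \<omega> \<partial>P i) =
        (\<integral>\<^sup>+\<omega>. (\<Sum>j\<in>?J. \<Sum>k\<in>{1, 2}. ?d \<omega> * ?l \<omega> * ?x j k \<omega>) \<partial>P i)"
    proof (rule nn_integral_cong_AE)
      show "AE \<omega> in P i. ?d \<omega> * ?l \<omega> * ?i \<omega> =
          (\<Sum>j\<in>?J. \<Sum>k\<in>{1, 2}. ?d \<omega> * ?l \<omega> * ?x j k \<omega>)"
        using AE_good[OF i, of "Suc n"]
      proof eventually_elim
        case (elim \<omega>)
        have ext: "?x j k \<omega> =
            (if k = Z (Suc n) \<omega> \<and> j = E n \<omega> then ?i \<omega> else 0 :: ennreal)" for j k
          by (auto simp: path_event_def indicator_def less_Suc_eq)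
        have Z: "Z (Suc n) \<omega> = 1 \<or> Z (Suc n) \<omega> = 2" and E: "E n \<omega> \<in> {1, 2, 3} - {Z n \<omega>}"
          using elim by (auto simp: good_def)
        have inner: "(\<Sum>k\<in>{1, 2}. w * ?x j k \<omega>) =
            (if j = E n \<omega> then w * ?i \<omega> else 0)" for j and w :: ennreal
          unfolding ext using Z by auto
        show ?case
          unfolding inner
        proof (cases "\<omega> \<in> path_event i n ph st")
          case True
          then have "E n \<omega> \<in> ?J"
            using E by (simp add: path_event_def)
          then show "?d \<omega> * ?l \<omega> * ?i \<omega> =
              (\<Sum>j\<in>?J. if j = E n \<omega> then ?d \<omega> * ?l \<omega> * ?i \<omega> else 0)"
            by (subst sum.delta) simp_all
        qed simp
      qed
    qed
    also have "\<dots> = (\<Sum>j\<in>?J. \<Sum>k\<in>{1, 2}. \<integral>\<^sup>+\<omega>. ?d \<omega> * ?l \<omega> * ?x j k \<omega> \<partial>P i)"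
      by (subst nn_integral_sum, measurable, intro sum.cong refl nn_integral_sum) measurable
    also have "\<dots> = (\<Sum>j\<in>?J. \<Sum>k\<in>{1, 2}. \<integral>\<^sup>+\<omega>. ?d \<omega> * (jump_prob (ph n) j k *
        ?I j k \<omega>) * ?i \<omega> \<partial>P i)"
    proof (intro sum.cong refl)
      fix j k :: nat assume jk: "j \<in> ?J" "k \<in> {1, 2}"
      have adm': "admissible (Suc n) (ph(Suc n := k)) (st(n := j))"
        using adm jk by (auto simp: admissible_def less_Suc_eq le_Suc_eq)
      have "(\<integral>\<^sup>+\<omega>. ?d \<omega> * ?l \<omega> * ?x j k \<omega> \<partial>P i) =
          (\<integral>\<^sup>+\<omega>. ?d \<omega> * \<psi> (ph n) j k (?v \<omega>) * ?x j k \<omega> \<partial>P i)"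
        by (intro nn_integral_cong) (auto simp: path_event_def indicator_def)
      also have "\<dots> = jump_prob (ph n) j k * (\<integral>\<^sup>+\<omega>. ?d \<omega> *
          ?I j k \<omega> *
            indicator (path_event i n (ph(Suc n := k)) (st(n := j))) \<omega> \<partial>P i)"
        using markov_path[OF i adm' \<psi>[of "ph n" j k], of b x] by simp
      also have "path_event i n (ph(Suc n := k)) (st(n := j)) = path_event i n ph st"
        by (auto simp: path_event_def)
      also have "jump_prob (ph n) j k * (\<integral>\<^sup>+\<omega>. ?d \<omega> *
          ?I j k \<omega> *
            ?i \<omega> \<partial>P i) =
        (\<integral>\<^sup>+\<omega>. jump_prob (ph n) j k * (?d \<omega> *
          ?I j k \<omega> *
            ?i \<omega>) \<partial>P i)"
        by (rule nn_integral_cmult[symmetric]) measurable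
      finally show "(\<integral>\<^sup>+\<omega>. ?d \<omega> * ?l \<omega> * ?x j k \<omega> \<partial>P i) = (\<integral>\<^sup>+\<omega>. ?d \<omega> * (jump_prob (ph n) j k *
        ?I j k \<omega>) * ?i \<omega> \<partial>P i)"
        by (simp only: mult_ac)
    qed
    also have "\<dots> = (\<integral>\<^sup>+\<omega>. ?d \<omega> * step \<psi> (ph n) (state b x \<omega> n) * ?i \<omega> \<partial>P i)"
      unfolding step_def sum_distrib_left sum_distrib_right
      by (subst nn_integral_sum, measurable, intro sum.cong refl nn_integral_sum[symmetric]) measurable
    also have "\<dots> = (\<integral>\<^sup>+\<omega>. ?d \<omega> * ?r \<omega> * ?i \<omega> \<partial>P i)"
      by (intro nn_integral_cong) (auto simp: path_event_def indicator_def)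
    finally show ?thesis .
  qed
  have "(\<integral>\<^sup>+\<omega>. ?d \<omega> * ?l \<omega> \<partial>P i) = (\<Sum>p\<in>paths n. \<integral>\<^sup>+\<omega>. ?d \<omega> * ?l \<omega> * indicator (path_event i n (fst p) (snd p)) \<omega> \<partial>P i)"
    by (rule nn_integral_paths[OF i]) measurable
  also have "\<dots> = (\<Sum>p\<in>paths n. \<integral>\<^sup>+\<omega>. ?d \<omega> * ?r \<omega> * indicator (path_event i n (fst p) (snd p)) \<omega> \<partial>P i)"
    by (intro sum.cong refl path) (simp add: paths_def)
  also have "\<dots> = (\<integral>\<^sup>+\<omega>. ?d \<omega> * ?r \<omega> \<partial>P i)"
    by (rule nn_integral_paths[OF i, symmetric]) measurable
  finally show ?thesis .
qed

text \<open>Continuation value after one stay, discounted over that stay. In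
  \<open>total_value\<close> the rewards of the successive stays are added; they vanish at negative
  surplus, which stops payments at ruin.\<close>

definition trans_value :: "(nat \<Rightarrow> real) \<Rightarrow> (nat \<Rightarrow> real \<Rightarrow> ennreal) \<Rightarrow> nat \<Rightarrow> real \<Rightarrow> ennreal" where
  "trans_value b w = step (\<lambda>i j k (u, t, y). ennreal (exp (- \<delta> * t)) * w k (next_level b u i t j y))"

definition reward :: "(nat \<Rightarrow> real) \<Rightarrow> nat \<Rightarrow> real \<Rightarrow> ennreal" where
  "reward b i u = (if u < 0 then 0 else \<integral>\<^sup>+t. stay_value (b i) u t \<partial>hold i)"

definition total_value :: "(nat \<Rightarrow> real) \<Rightarrow> nat \<Rightarrow> real \<Rightarrow> ennreal" where
  "total_value b i u = (\<Sum>n. (trans_value b ^^ n) (reward b) i u)"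

section \<open>The value as a fixed point\<close>

text \<open>The Laplace transform of the holding time at \<delta>, that is, the mean discount factor
  of one stay.\<close>

definition discount :: "nat \<Rightarrow> real" where
  "discount i = rate i / (rate i + \<delta>)"

definition rho :: real where
  "rho = max (discount 1) (discount 2)"

lemma discount_bounds:
  assumes "i \<in> {1, 2}"
  shows "0 \<le> discount i" "discount i \<le> rho"
  using rate_pos[OF assms] delta_pos assms by (auto simp: discount_def rho_def)

lemma rho_bounds: "0 \<le> rho" "rho < 1"
proof -
  show "0 \<le> rho"
    using discount_bounds[of 1] by simp
  have "discount i < 1" if "i \<in> {1, 2}" for i
    using rate_pos[OF that] delta_pos by (simp add: discount_def field_simps)
  then show "rho < 1"
    by (simp add: rho_def)
qed

section \<open>Integration against holding times and claim sizes\<close>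

lemma nn_integral_hold:
  assumes [measurable]: "g \<in> borel_measurable borel" and "i \<in> {1, 2}"
  shows "(\<integral>\<^sup>+t. g t \<partial>hold i) = (\<integral>\<^sup>+t. ennreal (rate i * exp (- rate i * t)) * g t * indicator {0..} t \<partial>lborel)"
proof -
  have "(\<integral>\<^sup>+t. g t \<partial>hold i) = (\<integral>\<^sup>+t. ennreal (exponential_density (rate i) t) * g t \<partial>lborel)"
    unfolding hold_def by (rule nn_integral_density) simp_all
  also have "\<dots> = (\<integral>\<^sup>+t. ennreal (rate i * exp (- rate i * t)) * g t * indicator {0..} t \<partial>lborel)"
    by (rule nn_integral_cong) (auto simp: exponential_density_def indicator_def mult.commute)
  finally show ?thesis .
qed

lemma nn_integral_claim_size:
  assumes [measurable]: "g \<in> borel_measurable borel"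
  shows "(\<integral>\<^sup>+y. g y \<partial>claim_size) = (\<integral>\<^sup>+y. ennreal (\<beta> * exp (- \<beta> * y)) * g y * indicator {0..} y \<partial>lborel)"
proof -
  have "(\<integral>\<^sup>+y. g y \<partial>claim_size) = (\<integral>\<^sup>+y. ennreal (exponential_density \<beta> y) * g y \<partial>lborel)"
    unfolding claim_size_def by (rule nn_integral_density) simp_all
  also have "\<dots> = (\<integral>\<^sup>+y. ennreal (\<beta> * exp (- \<beta> * y)) * g y * indicator {0..} y \<partial>lborel)"
    by (rule nn_integral_cong) (auto simp: exponential_density_def indicator_def mult.commute)
  finally show ?thesis .
qed

lemma AE_claim_size_nonneg: "AE y in claim_size. y \<ge> 0"
  unfolding claim_size_def by (subst AE_density) (auto simp: exponential_density_def)

lemma nn_integral_discount_hold: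
  assumes "i \<in> {1, 2}"
  shows "(\<integral>\<^sup>+t. ennreal (exp (- \<delta> * t)) \<partial>hold i) = ennreal (discount i)"
proof -
  let ?q = "rate i + \<delta>"
  have q: "?q > 0" "rate i > 0"
    using rate_pos[OF assms] delta_pos by simp_all
  have "(\<integral>\<^sup>+t. ennreal (exp (- \<delta> * t)) \<partial>hold i) =
      (\<integral>\<^sup>+t. ennreal (discount i) * (ennreal (?q * exp (- ?q * t)) * indicator {0..} t) \<partial>lborel)"
  proof (subst nn_integral_hold[OF _ assms], simp, rule nn_integral_cong)
    fix t
    have "rate i * exp (- rate i * t) * exp (- \<delta> * t) = rate i * exp (- ?q * t)"
      by (simp add: algebra_simps flip: exp_add)
    also have "\<dots> = discount i * (?q * exp (- ?q * t))"
      using q by (simp add: discount_def)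
    finally have "ennreal (rate i * exp (- rate i * t)) * ennreal (exp (- \<delta> * t)) = ennreal (discount i) * ennreal (?q * exp (- ?q * t))"
      using q discount_bounds(1)[OF assms] by (simp only: ennreal_mult'[symmetric] mult_nonneg_nonneg exp_ge_zero less_imp_le)
    then show "ennreal (rate i * exp (- rate i * t)) * ennreal (exp (- \<delta> * t)) * indicator {0..} t =
        ennreal (discount i) * (ennreal (?q * exp (- ?q * t)) * indicator {0..} t)"
      by (simp only: mult.assoc[symmetric])
  qed
  also have "\<dots> = ennreal (discount i) * ennreal (exp (- ?q * 0))"
    by (subst nn_integral_cmult) (simp, simp only: nn_integral_exp_tail[OF q(1)])
  finally show ?thesis by simp
qed

lemma measurable_stay_value [measurable (raw)]:
  assumes [measurable]: "u \<in> borel_measurable M" "t \<in> borel_measurable M"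
  shows "(\<lambda>z. stay_value h (u z) (t z)) \<in> borel_measurable M"
  unfolding stay_value_def by measurable

lemma measurable_reward [measurable]: "reward b i \<in> borel_measurable borel"
proof -
  interpret h: sigma_finite_measure "hold i"
    by (rule sigma_finite_hold)
  show ?thesis
    unfolding reward_def by measurable
qed

lemma measurable_trans_value [measurable]:
  assumes [measurable]: "\<And>k. w k \<in> borel_measurable borel"
  shows "trans_value b w i \<in> borel_measurable borel"
  unfolding trans_value_def by measurable

lemma measurable_funpow_trans_value [measurable]:
  assumes "\<And>k. w k \<in> borel_measurable borel"
  shows "(trans_value b ^^ n) w i \<in> borel_measurable borel"
  using assms by (induction n arbitrary: i) simp_all

lemma measurable_total_value [measurable]: "total_value b i \<in> borel_measurable borel"
  unfolding total_value_def by measurable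

lemma sum_jump_prob_ennreal:
  assumes "i \<in> {1, 2}"
  shows "(\<Sum>j\<in>{1, 2, 3} - {i}. \<Sum>k\<in>{1, 2}. ennreal (jump_prob i j k)) = 1"
proof -
  have "(\<Sum>j\<in>{1, 2, 3} - {i}. \<Sum>k\<in>{1, 2}. ennreal (jump_prob i j k)) =
      (\<Sum>j\<in>{1, 2, 3} - {i}. ennreal (\<Sum>k\<in>{1, 2}. jump_prob i j k))"
    by (intro sum.cong refl sum_ennreal jump_prob_nonneg[OF assms])
  also have "\<dots> = ennreal (\<Sum>j\<in>{1, 2, 3} - {i}. \<Sum>k\<in>{1, 2}. jump_prob i j k)"
    by (intro sum_ennreal sum_nonneg jump_prob_nonneg[OF assms])
  finally show ?thesis
    unfolding sum_jump_prob[OF assms] by simp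
qed

lemma step_const:
  assumes "i \<in> {1, 2}"
    and "\<And>j k. j \<in> {1, 2, 3} - {i} \<Longrightarrow> k \<in> {1, 2} \<Longrightarrow> (\<integral>\<^sup>+t. \<integral>\<^sup>+y. \<psi> i j k (u, t, y) \<partial>claim_size \<partial>hold i) = C"
  shows "step \<psi> i u = C"
proof -
  have "step \<psi> i u = (\<Sum>j\<in>{1, 2, 3} - {i}. \<Sum>k\<in>{1, 2}. ennreal (jump_prob i j k) * C)"
    unfolding step_def by (intro sum.cong refl) (simp only: assms(2))
  also have "\<dots> = C"
    unfolding sum_distrib_right[symmetric] sum_jump_prob_ennreal[OF assms(1)] by simp
  finally show ?thesis .
qed

lemma step_mono:
  assumes "\<And>j k t. j \<in> {1, 2, 3} - {i} \<Longrightarrow> k \<in> {1, 2} \<Longrightarrow> AE y in claim_size. \<psi> i j k (u, t, y) \<le> \<psi>' i j k (u, t, y)"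
  shows "step \<psi> i u \<le> step \<psi>' i u"
  unfolding step_def
  by (intro sum_mono mult_left_mono nn_integral_mono nn_integral_mono_AE assms) auto

lemma trans_value_mono:
  assumes "\<And>k u. k \<in> {1, 2} \<Longrightarrow> w k u \<le> w' k u"
  shows "trans_value b w i u \<le> trans_value b w' i u"
  unfolding trans_value_def by (intro step_mono AE_I2) (auto intro!: mult_left_mono assms)

text \<open>After one stay the surplus is at most the barrier, or -1 if ruin came before, whatever
  it was at the start. A bound on \<open>w\<close> up to \<open>B\<close> therefore controls the
  image at every surplus, although \<open>w\<close> may be unbounded.\<close>

lemma trans_value_bound:
  assumes i: "i \<in> {1, 2}" and B: "b i \<le> B" "- 1 \<le> B"
    and w: "\<And>k u. k \<in> {1, 2} \<Longrightarrow> u \<le> B \<Longrightarrow> w k u \<le> C"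
  shows "trans_value b w i u \<le> ennreal (discount i) * C"
proof -
  interpret c: prob_space claim_size
    by (rule prob_space_claim_size)
  have "trans_value b w i u \<le> step (\<lambda>i j k (u, t, y). ennreal (exp (- \<delta> * t)) * C) i u"
    unfolding trans_value_def
  proof (rule step_mono)
    fix j k t assume k: "k \<in> {1, 2 :: nat}"
    show "AE y in claim_size. (case (u, t, y) of (u, t, y) \<Rightarrow> ennreal (exp (- \<delta> * t)) * w k (next_level b u i t j y)) \<le>
        (case (u, t, y) of (u, t, y) \<Rightarrow> ennreal (exp (- \<delta> * t)) * C)"
      using AE_claim_size_nonneg
    proof eventually_elim
      case (elim y)
      then have "next_level b u i t j y \<le> B"
        using B by (auto simp: next_level_def)
      then show ?case
        using w[OF k] by (auto intro!: mult_left_mono)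
    qed
  qed
  also have "\<dots> = ennreal (discount i) * C"
    using nn_integral_discount_hold[OF i]
    by (intro step_const[OF i]) (simp add: c.emeasure_space_1[simplified] nn_integral_multc)
  finally show ?thesis .
qed

lemma funpow_trans_value_bound:
  assumes B: "b 1 \<le> B" "b 2 \<le> B" "- 1 \<le> B"
    and w: "\<And>k u. k \<in> {1, 2} \<Longrightarrow> u \<le> B \<Longrightarrow> w k u \<le> C"
    and "i \<in> {1, 2}" "u \<le> B"
  shows "(trans_value b ^^ n) w i u \<le> ennreal (rho ^ n) * C"
  using assms(5,6)
proof (induction n arbitrary: i u)
  case 0
  then show ?case using w by simp
next
  case (Suc n)
  have "(trans_value b ^^ Suc n) w i u \<le> ennreal (discount i) * (ennreal (rho ^ n) * C)"
    unfolding funpow.simps comp_def using Suc.prems(1) B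
    by (intro trans_value_bound[where B = B] Suc.IH) auto
  also have "\<dots> \<le> ennreal rho * (ennreal (rho ^ n) * C)"
    using discount_bounds[OF Suc.prems(1)] by (intro mult_right_mono ennreal_leI) auto
  also have "\<dots> = ennreal (rho ^ Suc n) * C"
    using rho_bounds by (simp add: ennreal_mult' mult.assoc)
  finally show ?case .
qed

lemma trans_value_add:
  assumes [measurable]: "\<And>k. w k \<in> borel_measurable borel" "\<And>k. w' k \<in> borel_measurable borel"
  shows "trans_value b (\<lambda>k u. w k u + w' k u) i u = trans_value b w i u + trans_value b w' i u"
proof -
  interpret c: sigma_finite_measure claim_size
    by (rule sigma_finite_claim_size)
  show ?thesis
    unfolding trans_value_def step_def
    by (simp add: distrib_left nn_integral_add sum.distrib del: sum.insert)
qed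

lemma trans_value_suminf:
  assumes [measurable]: "\<And>n k. w n k \<in> borel_measurable borel"
  shows "trans_value b (\<lambda>k u. \<Sum>n. w n k u) i u = (\<Sum>n. trans_value b (w n) i u)"
proof -
  interpret c: sigma_finite_measure claim_size
    by (rule sigma_finite_claim_size)
  have "trans_value b (\<lambda>k u. \<Sum>n. w n k u) i u = (\<Sum>j\<in>{1, 2, 3} - {i}. \<Sum>k\<in>{1, 2}. \<Sum>n. jump_prob i j k *
     (\<integral>\<^sup>+t. \<integral>\<^sup>+y. ennreal (exp (- \<delta> * t)) * w n k (next_level b u i t j y) \<partial>claim_size \<partial>hold i))"
    unfolding trans_value_def step_def
    by (simp add: nn_integral_suminf flip: ennreal_suminf_cmult del: sum.insert)
  also have "\<dots> = (\<Sum>n. trans_value b (w n) i u)"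
    unfolding trans_value_def step_def by (simp add: suminf_sum del: sum.insert)
  finally show ?thesis .
qed

lemma total_value_fixpoint: "total_value b i u = reward b i u + trans_value b (total_value b) i u"
proof -
  have "total_value b i u = reward b i u + (\<Sum>n. (trans_value b ^^ Suc n) (reward b) i u)"
  proof -
    have "(\<lambda>n. (trans_value b ^^ Suc n) (reward b) i u) sums (\<Sum>n. (trans_value b ^^ Suc n) (reward b) i u)"
      by (rule summable_sums[OF summableI])
    from sums_Suc[OF this] show ?thesis
      unfolding total_value_def by (simp add: sums_iff add.commute)
  qed
  also have "(\<Sum>n. (trans_value b ^^ Suc n) (reward b) i u) = trans_value b (total_value b) i u"
    unfolding total_value_def[abs_def] by (subst trans_value_suminf) simp_all
  finally show ?thesis .
qed

lemma total_value_bound: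
  assumes B: "b 1 \<le> B" "b 2 \<le> B" "- 1 \<le> B" and "C \<ge> 0"
    and r: "\<And>k u. k \<in> {1, 2} \<Longrightarrow> u \<le> B \<Longrightarrow> reward b k u \<le> ennreal C"
    and "i \<in> {1, 2}" "u \<le> B"
  shows "total_value b i u \<le> ennreal (C / (1 - rho))"
proof -
  have "total_value b i u \<le> (\<Sum>n. ennreal (rho ^ n * C))"
    unfolding total_value_def
    using funpow_trans_value_bound[OF B r assms(6,7)] rho_bounds \<open>C \<ge> 0\<close>
    by (intro suminf_le) (simp_all add: ennreal_mult')
  also have "\<dots> = ennreal (\<Sum>n. rho ^ n * C)"
    using rho_bounds \<open>C \<ge> 0\<close>
    by (intro suminf_ennreal2) (auto intro!: summable_mult2 summable_geometric)
  also have "(\<Sum>n. rho ^ n * C) = C / (1 - rho)"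
    using rho_bounds by (subst suminf_mult2[symmetric]) (auto simp: suminf_geometric intro!: summable_geometric)
  finally show ?thesis .
qed

text \<open>Iterating the hypothesis bounds \<open>w\<close> by the value of the first \<open>n\<close> stays plus the \<open>n\<close>-th iterate
  of \<open>trans_value b\<close> at \<open>w\<close>, which is at most \<open>rho ^ n * C\<close>.\<close>

lemma policy_improvement:
  assumes B: "b 1 \<le> B" "b 2 \<le> B" "- 1 \<le> B"
    and [measurable]: "\<And>k. w k \<in> borel_measurable borel"
    and bound: "\<And>k u. k \<in> {1, 2} \<Longrightarrow> u \<le> B \<Longrightarrow> w k u \<le> ennreal C" and "C \<ge> 0"
    and sub: "\<And>k u. k \<in> {1, 2} \<Longrightarrow> w k u \<le> reward b k u + trans_value b w k u"
    and i: "i \<in> {1, 2}"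
  shows "reward b i u + trans_value b w i u \<le> total_value b i u"
proof -
  \<comment> \<open>Value of following \<open>b\<close> for \<open>n\<close> stays and collecting
    \<open>w\<close> afterwards.\<close>
  let ?v = "\<lambda>n k u. (\<Sum>m<n. (trans_value b ^^ m) (reward b) k u) + (trans_value b ^^ n) w k u"
  have expand: "reward b k u + trans_value b (?v n) k u =
      (\<Sum>m<Suc n. (trans_value b ^^ m) (reward b) k u) + (trans_value b ^^ Suc n) w k u" for k u n
  proof -
    have "trans_value b (\<lambda>k u. \<Sum>m<n. (trans_value b ^^ m) (reward b) k u) k u =
        (\<Sum>m<n. (trans_value b ^^ Suc m) (reward b) k u)" for n
    proof (induction n)
      case 0
      show ?case by (simp add: trans_value_def step_def)
    next
      case (Suc n)
      then show ?case by (simp add: trans_value_add)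
    qed
    then show ?thesis
      by (subst trans_value_add, measurable) (simp add: sum.lessThan_Suc_shift add.assoc del: sum.lessThan_Suc)
  qed
  have iterate: "w k u \<le> (\<Sum>m<n. (trans_value b ^^ m) (reward b) k u) + (trans_value b ^^ n) w k u"
    if "k \<in> {1, 2}" for n k u
    using that
  proof (induction n arbitrary: k u)
    case 0
    then show ?case by simp
  next
    case (Suc n)
    have "w k u \<le> reward b k u + trans_value b w k u"
      by (rule sub[OF Suc.prems])
    also have "\<dots> \<le> reward b k u + trans_value b (?v n) k u"
      by (intro add_left_mono trans_value_mono Suc.IH)
    finally show ?case
      unfolding expand .
  qed
  \<comment> \<open>Comparing after one stay, instead of \<open>w\<close> itself, makes the error
    uniform in \<open>u\<close>: the surplus is then at most \<open>B\<close>, where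
    \<open>w\<close> is bounded.\<close>
  have "reward b i u + trans_value b w i u \<le> total_value b i u + ennreal (rho ^ n * C)" for n
  proof -
    have "reward b i u + trans_value b w i u \<le>
        reward b i u + trans_value b (?v n) i u"
      by (intro add_left_mono trans_value_mono iterate)
    also have "\<dots> \<le> total_value b i u + (trans_value b ^^ Suc n) w i u"
      unfolding expand total_value_def by (intro add_right_mono sum_le_suminf) auto
    also have "(trans_value b ^^ Suc n) w i u \<le> ennreal (discount i) * (ennreal (rho ^ n) * ennreal C)"
      unfolding funpow.simps comp_def using i B
      by (intro trans_value_bound[where B = B] funpow_trans_value_bound[OF B bound]) auto
    also have "\<dots> \<le> 1 * ennreal (rho ^ n * C)"
      using discount_bounds[OF i] rho_bounds \<open>C \<ge> 0\<close>
      by (intro mult_mono) (auto simp: ennreal_mult')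
    finally show ?thesis
      by (simp add: add_left_mono)
  qed
  moreover have "(\<lambda>n. total_value b i u + ennreal (rho ^ n * C)) \<longlonglongrightarrow> total_value b i u + ennreal (0 * C)"
    using rho_bounds by (intro tendsto_intros tendsto_ennrealI LIMSEQ_realpow_zero) auto
  ultimately show ?thesis
    using LIMSEQ_le_const[of _ _ "reward b i u + trans_value b w i u"] by fastforce
qed

text \<open>Iterated Markov property; \<open>w\<close> is kept arbitrary because each step of the
  induction replaces it by \<open>trans_value b w\<close>.\<close>

lemma expectation_trans_value:
  assumes i: "i \<in> {1, 2}" and "\<And>k. w k \<in> borel_measurable borel"
  shows "(\<integral>\<^sup>+\<omega>. ennreal (exp (- \<delta> * epoch \<omega> n)) * w (Z n \<omega>) (state b x \<omega> n) \<partial>P i) = (trans_value b ^^ n) w i x"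
  using assms(2)
proof (induction n arbitrary: w)
  case 0
  interpret pr: prob_space "P i"
    by (rule prob_space_P[OF i])
  have "(\<integral>\<^sup>+\<omega>. ennreal (exp (- \<delta> * epoch \<omega> 0)) * w (Z 0 \<omega>) (state b x \<omega> 0) \<partial>P i) = (\<integral>\<^sup>+\<omega>. w i x \<partial>P i)"
    using AE_good[OF i, of 0] by (intro nn_integral_cong_AE) (auto simp: good_def elim!: eventually_mono)
  then show ?case
    by (simp add: pr.emeasure_space_1)
next
  case (Suc n)
  note [measurable] = Suc.prems
  have "(\<integral>\<^sup>+\<omega>. ennreal (exp (- \<delta> * epoch \<omega> (Suc n))) * w (Z (Suc n) \<omega>) (state b x \<omega> (Suc n)) \<partial>P i) =
      (\<integral>\<^sup>+\<omega>. ennreal (exp (- \<delta> * epoch \<omega> n)) * trans_value b w (Z n \<omega>) (state b x \<omega> n) \<partial>P i)"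
  proof -
    have "ennreal (exp (- \<delta> * epoch \<omega> (Suc n))) = ennreal (exp (- \<delta> * epoch \<omega> n)) * ennreal (exp (- \<delta> * S n \<omega>))" for \<omega>
      by (simp add: algebra_simps flip: exp_add ennreal_mult')
    then show ?thesis
      unfolding trans_value_def by (subst markov[OF i, symmetric]) (simp_all only: state_Suc mult.assoc prod.case, measurable)
  qed
  also have "\<dots> = (trans_value b ^^ n) (trans_value b w) i x"
    by (rule Suc.IH) measurable
  finally show ?case
    by (simp add: funpow_swap1)
qed

definition stay_term :: "(nat \<Rightarrow> real) \<Rightarrow> real \<Rightarrow> nat \<Rightarrow> 'w \<Rightarrow> ennreal" where
  "stay_term b x n \<omega> = ennreal (exp (- \<delta> * epoch \<omega> n)) *
    (if state b x \<omega> n < 0 then 0 else stay_value (b (Z n \<omega>)) (state b x \<omega> n) (S n \<omega>))"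

lemma measurable_stay_term:
  assumes i: "i \<in> {1, 2}"
  shows "stay_term b x n \<in> borel_measurable (P i)"
proof -
  note [measurable] = measurable_Z[OF i] measurable_S[OF i] measurable_epoch[OF i] measurable_state[OF i]
  show ?thesis
    unfolding stay_term_def
    by (rule measurable_compose_countable[where g = "Z n" and f = "\<lambda>k \<omega>. ennreal (exp (- \<delta> * epoch \<omega> n)) *
      (if state b x \<omega> n < 0 then 0 else stay_value (b k) (state b x \<omega> n) (S n \<omega>))"]) measurable
qed

text \<open>Integrating out the length of stay \<open>n\<close> first replaces its value by
  \<open>reward\<close>, after which only phase and surplus at the epoch remain.\<close>

lemma expectation_reward:
  assumes i: "i \<in> {1, 2}"
  shows "(\<integral>\<^sup>+\<omega>. stay_term b x n \<omega> \<partial>P i) =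
    (trans_value b ^^ n) (reward b) i x"
proof -
  interpret c: prob_space claim_size
    by (rule prob_space_claim_size)
  define \<psi> where "\<psi> = (\<lambda>(a :: nat) (j :: nat) (k :: nat) (u, t, y :: real). if u < 0 then 0 else stay_value (b a) u t)"
  have [measurable]: "\<psi> a j k \<in> borel_measurable (borel \<Otimes>\<^sub>M borel \<Otimes>\<^sub>M borel)" for a j k
    unfolding \<psi>_def by measurable
  have step: "step \<psi> a u = reward b a u" if "a \<in> {1, 2}" for a u
    by (rule step_const[OF that]) (simp add: \<psi>_def reward_def c.emeasure_space_1[simplified])
  have "(\<integral>\<^sup>+\<omega>. stay_term b x n \<omega> \<partial>P i) =
    (\<integral>\<^sup>+\<omega>. ennreal (exp (- \<delta> * epoch \<omega> n)) * step \<psi> (Z n \<omega>) (state b x \<omega> n) \<partial>P i)"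
    unfolding stay_term_def by (subst markov[OF i, symmetric]) (simp_all add: \<psi>_def)
  also have "\<dots> = (\<integral>\<^sup>+\<omega>. ennreal (exp (- \<delta> * epoch \<omega> n)) * reward b (Z n \<omega>) (state b x \<omega> n) \<partial>P i)"
  proof (rule nn_integral_cong_AE)
    show "AE \<omega> in P i. ennreal (exp (- \<delta> * epoch \<omega> n)) * step \<psi> (Z n \<omega>) (state b x \<omega> n) =
        ennreal (exp (- \<delta> * epoch \<omega> n)) * reward b (Z n \<omega>) (state b x \<omega> n)"
      using AE_good[OF i, of n] by eventually_elim (simp add: good_def step)
  qed
  also have "\<dots> = (trans_value b ^^ n) (reward b) i x"
    by (rule expectation_trans_value[OF i]) measurable
  finally show ?thesis .
qed

text \<open>The expected discount factors are dominated by a geometric series, so their sum is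
  almost surely finite and its terms tend to 0. This excludes an accumulation of events.\<close>

lemma AE_epoch_at_top:
  assumes i: "i \<in> {1, 2}"
  shows "AE \<omega> in P i. filterlim (epoch \<omega>) at_top sequentially"
proof -
  note [measurable] = measurable_epoch[OF i]
  have "(\<integral>\<^sup>+\<omega>. ennreal (exp (- \<delta> * epoch \<omega> n)) \<partial>P i) \<le> ennreal (rho ^ n)" for n
  proof -
    have "(\<integral>\<^sup>+\<omega>. ennreal (exp (- \<delta> * epoch \<omega> n)) \<partial>P i) = (trans_value (\<lambda>_. 0) ^^ n) (\<lambda>_ _. 1) i 0"
      using expectation_trans_value[OF i, of "\<lambda>_ _. 1" n "\<lambda>_. 0" 0] by simp
    also have "\<dots> \<le> ennreal (rho ^ n) * 1"
      by (rule funpow_trans_value_bound[where B = 0]) (use i in auto)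
    finally show ?thesis by simp
  qed
  then have "(\<Sum>n. \<integral>\<^sup>+\<omega>. ennreal (exp (- \<delta> * epoch \<omega> n)) \<partial>P i) \<le> (\<Sum>n. ennreal (rho ^ n))"
    by (intro suminf_le) auto
  also have "\<dots> = ennreal (\<Sum>n. rho ^ n)"
    using rho_bounds by (intro suminf_ennreal2) (auto intro!: summable_geometric)
  finally have "(\<Sum>n. \<integral>\<^sup>+\<omega>. ennreal (exp (- \<delta> * epoch \<omega> n)) \<partial>P i) \<noteq> \<infinity>"
    by (auto simp: top_unique)
  then have "(\<integral>\<^sup>+\<omega>. (\<Sum>n. ennreal (exp (- \<delta> * epoch \<omega> n))) \<partial>P i) \<noteq> \<infinity>"
    by (subst nn_integral_suminf) simp_all
  then have "AE \<omega> in P i. (\<Sum>n. ennreal (exp (- \<delta> * epoch \<omega> n))) \<noteq> \<infinity>"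
    by (intro nn_integral_PInf_AE) simp_all
  then show ?thesis
  proof eventually_elim
    case (elim \<omega>)
    then have "summable (\<lambda>n. exp (- \<delta> * epoch \<omega> n))"
      by (intro summable_suminf_not_top) auto
    then have lim: "(\<lambda>n. exp (- \<delta> * epoch \<omega> n)) \<longlonglongrightarrow> 0"
      by (rule summable_LIMSEQ_zero)
    show ?case
      unfolding filterlim_at_top_dense
    proof
      fix K
      have "\<forall>\<^sub>F n in sequentially. exp (- \<delta> * epoch \<omega> n) < exp (- \<delta> * K)"
        using lim by (rule order_tendstoD(2)) simp
      then show "\<forall>\<^sub>F n in sequentially. K < epoch \<omega> n"
        by eventually_elim (use delta_pos in simp)
    qed
  qed
qed

text \<open>Almost every path is regular, so the pathwise decomposition into stays may be integrated
  term by term.\<close>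

lemma f_eq_total_value:
  assumes i: "i \<in> {1, 2}" and b: "b 1 \<ge> 0" "b 2 \<ge> 0" and x: "x \<ge> 0"
  shows "f b i x = total_value b i x"
proof -
  have "AE \<omega> in P i. \<forall>n. good i n \<omega>"
    unfolding AE_all_countable using AE_good[OF i] by blast
  then have regular: "AE \<omega> in P i. regular \<omega>"
    using AE_epoch_at_top[OF i]
  proof eventually_elim
    case (elim \<omega>)
    then have "Z n \<omega> \<in> {1, 2} \<and> S n \<omega> > 0" for n
      using elim(1)[rule_format, of "Suc n"] by (auto simp: good_def)
    with elim show ?case
      by (simp add: regular_def)
  qed
  have "f b i x = (\<integral>\<^sup>+\<omega>. (\<Sum>n. stay_term b x n \<omega>) \<partial>P i)"
    unfolding f_def
  proof (rule nn_integral_cong_AE)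
    show "AE \<omega> in P i. (\<integral>\<^sup>+t\<in>{t. 0 \<le> t \<and> ereal t < ruin_time b x \<omega>}. ennreal (exp (- \<delta> * t)) \<partial>interval_measure (\<lambda>t. D b x t \<omega>)) =
        (\<Sum>n. stay_term b x n \<omega>)"
      using regular
    proof eventually_elim
      case (elim \<omega>)
      have "(if ruined b x \<omega> n then 0 else stay_value (b (Z n \<omega>)) (level b x \<omega> n) (S n \<omega>)) =
          (if state b x \<omega> n < 0 then 0 else stay_value (b (Z n \<omega>)) (state b x \<omega> n) (S n \<omega>))" for n
        using state_ruined[of b x \<omega> n] by auto
      then show ?case
        unfolding pathwise_value[OF b x elim] stay_term_def by simp
    qed
  qed
  also have "\<dots> = (\<Sum>n. (trans_value b ^^ n) (reward b) i x)"
    by (subst nn_integral_suminf[OF measurable_stay_term[OF i]]) (simp only: expectation_reward[OF i])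
  finally show ?thesis
    unfolding total_value_def .
qed

section \<open>Real-valued equations\<close>

text \<open>Rate at which events at surplus \<open>z\<close> bring in continuation value;
  \<open>3 - i\<close> is the other phase. Intensities instead of probabilities match the term
  \<open>H\<close> of \<open>barrier_value\<close>.\<close>

definition gain :: "(nat \<Rightarrow> real \<Rightarrow> ennreal) \<Rightarrow> nat \<Rightarrow> real \<Rightarrow> ennreal" where
  "gain w i z = ennreal (lam i (3 - i)) * w (3 - i) z + ennreal (lam i 3) *
     (ennreal (\<pi> 1) * (\<integral>\<^sup>+y. w 1 (z - y) \<partial>claim_size) + ennreal (\<pi> 2) * (\<integral>\<^sup>+y. w 2 (z - y) \<partial>claim_size))"

definition total_rate :: "nat \<Rightarrow> real" where
  "total_rate i = rate i + \<delta>"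

lemma total_rate_pos: "i \<in> {1, 2} \<Longrightarrow> total_rate i > 0"
  using rate_pos[of i] delta_pos by (simp add: total_rate_def)

lemma measurable_claim_convolution [measurable]:
  assumes [measurable]: "w \<in> borel_measurable borel"
  shows "(\<lambda>z. \<integral>\<^sup>+y. w (z - y) \<partial>claim_size) \<in> borel_measurable borel"
proof -
  interpret c: sigma_finite_measure claim_size
    by (rule sigma_finite_claim_size)
  show ?thesis
    by measurable
qed

lemma measurable_gain [measurable]:
  assumes [measurable]: "\<And>k. w k \<in> borel_measurable borel"
  shows "gain w i \<in> borel_measurable borel"
  unfolding gain_def by measurable

lemma nn_integral_hold_discounted:
  assumes i: "i \<in> {1, 2}" and [measurable]: "g \<in> borel_measurable borel"
  shows "(\<integral>\<^sup>+t. ennreal (exp (- \<delta> * t)) * g t \<partial>hold i) =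
    ennreal (rate i) * (\<integral>\<^sup>+t. ennreal (exp (- total_rate i * t)) * g t * indicator {0..} t \<partial>lborel)"
proof -
  have "(\<integral>\<^sup>+t. ennreal (exp (- \<delta> * t)) * g t \<partial>hold i) =
      (\<integral>\<^sup>+t. ennreal (rate i * exp (- rate i * t)) * (ennreal (exp (- \<delta> * t)) * g t) * indicator {0..} t \<partial>lborel)"
    by (rule nn_integral_hold[OF _ i]) measurable
  also have "\<dots> = (\<integral>\<^sup>+t. ennreal (rate i) * (ennreal (exp (- total_rate i * t)) * g t * indicator {0..} t) \<partial>lborel)"
  proof (rule nn_integral_cong)
    fix t
    have "rate i * exp (- rate i * t) * exp (- \<delta> * t) = rate i * exp (- total_rate i * t)"
      by (simp add: total_rate_def algebra_simps flip: exp_add)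
    then have "ennreal (rate i * exp (- rate i * t)) * ennreal (exp (- \<delta> * t)) = ennreal (rate i) * ennreal (exp (- total_rate i * t))"
      using rate_pos[OF i] by (simp only: ennreal_mult'[symmetric] mult_nonneg_nonneg exp_ge_zero less_imp_le)
    then show "ennreal (rate i * exp (- rate i * t)) * (ennreal (exp (- \<delta> * t)) * g t) * indicator {0..} t =
        ennreal (rate i) * (ennreal (exp (- total_rate i * t)) * g t * indicator {0..} t)"
      by (simp only: mult.assoc[symmetric])
  qed
  also have "\<dots> = ennreal (rate i) * (\<integral>\<^sup>+t. ennreal (exp (- total_rate i * t)) * g t * indicator {0..} t \<partial>lborel)"
    by (rule nn_integral_cmult) measurable
  finally show ?thesis .
qed

text \<open>The factor \<open>rate i\<close> of the exponential density cancels the denominators of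
  the jump probabilities and leaves intensities.\<close>

lemma trans_value_eq:
  assumes i: "i \<in> {1, 2}" and u: "0 \<le> u" and [measurable]: "\<And>k. w k \<in> borel_measurable borel"
  shows "trans_value b w i u =
    (\<integral>\<^sup>+t. ennreal (exp (- total_rate i * t)) * gain w i (min (u + c * t) (b i)) * indicator {0..} t \<partial>lborel)"
proof -
  interpret cl: prob_space claim_size
    by (rule prob_space_claim_size)
  define L where "L g = (\<integral>\<^sup>+t. ennreal (exp (- total_rate i * t)) * g (min (u + c * t) (b i)) * indicator {0..} t \<partial>lborel)"
    for g :: "real \<Rightarrow> ennreal"
  define C where "C k z = (\<integral>\<^sup>+y. w k (z - y) \<partial>claim_size)" for k z
  have [measurable]: "C k \<in> borel_measurable borel" for k
    unfolding C_def by measurable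
  define j where "j = 3 - i"
  have j: "j \<in> {1, 2}" "j \<noteq> 3" "{1, 2, 3} - {i} = {j, 3}"
    using i by (auto simp: j_def)
  have lam_nonneg: "lam i j \<ge> 0" "lam i 3 \<ge> 0"
    using i j intensity_nonneg[of i j] intensity_nonneg[of i 3] by (auto simp: j_def)
  have rate: "rate i > 0"
    by (rule rate_pos[OF i])
  have move: "(\<integral>\<^sup>+t. \<integral>\<^sup>+y. ennreal (exp (- \<delta> * t)) * w k (next_level b u i t j y) \<partial>claim_size \<partial>hold i) = ennreal (rate i) * L (w k)" for k
    using u j(2) unfolding L_def
    by (subst nn_integral_hold_discounted[OF i, symmetric]) (simp_all add: next_level_def cl.emeasure_space_1[simplified])
  have claim: "(\<integral>\<^sup>+t. \<integral>\<^sup>+y. ennreal (exp (- \<delta> * t)) * w k (next_level b u i t 3 y) \<partial>claim_size \<partial>hold i) = ennreal (rate i) * L (C k)" for k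
    using u unfolding L_def
    by (subst nn_integral_hold_discounted[OF i, symmetric]) (simp_all add: next_level_def C_def nn_integral_cmult)
  have rate_cancel: "ennreal (r / rate i * s) * (ennreal (rate i) * X) = ennreal r * (ennreal s * X)" if "r \<ge> 0" "s \<ge> 0" for r s X
  proof -
    have "r / rate i * s * rate i = r * s"
      using rate by simp
    then have "ennreal (r / rate i * s) * ennreal (rate i) = ennreal r * ennreal s"
      using that rate by (simp only: ennreal_mult'[symmetric] mult_nonneg_nonneg divide_nonneg_nonneg less_imp_le)
    then show ?thesis
      by (simp only: mult.assoc[symmetric])
  qed
  have pis: "\<pi> 1 \<ge> 0" "\<pi> 2 \<ge> 0"
    by (rule restart_nonneg)+
  have "trans_value b w i u =
      (\<Sum>k\<in>{1, 2}. ennreal (jump_prob i j k) * (ennreal (rate i) * L (w k))) +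
      (\<Sum>k\<in>{1, 2}. ennreal (jump_prob i 3 k) * (ennreal (rate i) * L (C k)))"
    unfolding trans_value_def step_def j(3) using j(2) by (simp only: sum.insert finite.intros insert_iff empty_iff sum.empty prod.case move claim simp_thms) simp
  also have "(\<Sum>k\<in>{1, 2}. ennreal (jump_prob i j k) * (ennreal (rate i) * L (w k))) = ennreal (lam i j) * L (w j)"
  proof -
    have "(\<Sum>k\<in>{1, 2}. ennreal (jump_prob i j k) * (ennreal (rate i) * L (w k))) =
        (\<Sum>k\<in>{1, 2}. if k = j then ennreal (lam i j / rate i * 1) * (ennreal (rate i) * L (w k)) else 0)"
      using j(2) by (intro sum.cong) (auto simp: jump_prob_def)
    also have "\<dots> = ennreal (lam i j / rate i * 1) * (ennreal (rate i) * L (w j))"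
      using j(1) by (subst sum.delta) simp_all
    finally show ?thesis
      by (simp only: rate_cancel[OF lam_nonneg(1) zero_le_one]) simp
  qed
  also have "(\<Sum>k\<in>{1, 2}. ennreal (jump_prob i 3 k) * (ennreal (rate i) * L (C k))) =
      ennreal (lam i 3) * (ennreal (\<pi> 1) * L (C 1)) + ennreal (lam i 3) * (ennreal (\<pi> 2) * L (C 2))"
  proof -
    have *: "ennreal (jump_prob i 3 k) * (ennreal (rate i) * L (C k)) = ennreal (lam i 3) * (ennreal (\<pi> k) * L (C k))"
      if "\<pi> k \<ge> 0" for k
      using rate_cancel[OF lam_nonneg(2) that] by (simp only: jump_prob_def if_True simp_thms)
    show ?thesis
      using *[OF pis(1)] *[OF pis(2)] by simp
  qed
  also have "ennreal (lam i j) * L (w j) + (ennreal (lam i 3) * (ennreal (\<pi> 1) * L (C 1)) + ennreal (lam i 3) * (ennreal (\<pi> 2) * L (C 2))) = L (gain w i)"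
  proof -
    have add: "L (\<lambda>z. g z + h z) = L g + L h" if [measurable]: "g \<in> borel_measurable borel" "h \<in> borel_measurable borel" for g h
      unfolding L_def by (subst nn_integral_add[symmetric]) (simp_all add: distrib_left distrib_right)
    have cmult: "L (\<lambda>z. r * g z) = r * L g" if [measurable]: "g \<in> borel_measurable borel" for r g
      unfolding L_def by (subst nn_integral_cmult[symmetric]) (simp_all add: mult_ac)
    have "L (gain w i) = L (\<lambda>z. ennreal (lam i j) * w j z + ennreal (lam i 3) * (ennreal (\<pi> 1) * C 1 z + ennreal (\<pi> 2) * C 2 z))"
      by (simp only: gain_def[abs_def] C_def j_def)
    also have "\<dots> = ennreal (lam i j) * L (w j) + ennreal (lam i 3) * (ennreal (\<pi> 1) * L (C 1) + ennreal (\<pi> 2) * L (C 2))"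
      by (simp add: add cmult)
    finally show ?thesis
      by (simp add: distrib_left)
  qed
  finally show ?thesis
    unfolding L_def .
qed

text \<open>The dividends counted in a stay depend on the minimum of its length and the discounting
  clock, an exponential time of rate \<open>total_rate i\<close>.\<close>

lemma reward_eq:
  assumes i: "i \<in> {1, 2}" and u: "0 \<le> u"
  shows "reward b i u = (\<integral>\<^sup>+t. ennreal (exp (- total_rate i * t)) * ennreal (total_rate i * max 0 (u + c * t - b i)) *
    indicator {0..} t \<partial>lborel)"
proof -
  have "reward b i u = (\<integral>\<^sup>+t. ennreal (rate i * exp (- rate i * t)) * stay_value (b i) u t * indicator {0..} t \<partial>lborel)"
    using u unfolding reward_def by (subst nn_integral_hold[OF _ i]) simp_all
  also have "\<dots> = (\<integral>\<^sup>+s. ennreal ((rate i + \<delta>) * exp (- (rate i + \<delta>) * s)) * ennreal (max 0 (u + c * s - b i)) * indicator {0..} s \<partial>lborel)"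
    unfolding stay_value_def by (rule nn_integral_min_exponential) (use rate_pos[OF i] delta_pos in simp_all)
  also have "\<dots> = (\<integral>\<^sup>+t. ennreal (exp (- total_rate i * t)) * ennreal (total_rate i * max 0 (u + c * t - b i)) *
    indicator {0..} t \<partial>lborel)"
    using total_rate_pos[OF i] by (intro nn_integral_cong) (simp add: total_rate_def[symmetric] ennreal_mult' mult_ac)
  finally show ?thesis .
qed

lemma one_stay_value:
  assumes i: "i \<in> {1, 2}" and u: "0 \<le> u" and b: "0 \<le> b i" and [measurable]: "\<And>k. w k \<in> borel_measurable borel"
    and gain: "\<And>z. 0 \<le> z \<Longrightarrow> z \<le> b i \<Longrightarrow> gain w i z = ennreal (H z)"
      "\<And>z. 0 \<le> z \<Longrightarrow> z \<le> b i \<Longrightarrow> 0 \<le> H z"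
    and int: "(\<lambda>z. exp (- total_rate i * (z - u) / c) * H z / c) integrable_on {u..b i}"
  shows "reward b i u + trans_value b w i u = ennreal (barrier_value c (total_rate i) H (b i) u)"
proof -
  have "reward b i u + trans_value b w i u = (\<integral>\<^sup>+t. ennreal (exp (- total_rate i * t)) *
      (ennreal (total_rate i * max 0 (u + c * t - b i)) + gain w i (min (u + c * t) (b i))) * indicator {0..} t \<partial>lborel)"
    unfolding reward_eq[OF i u] trans_value_eq[OF i u assms(4)]
    by (subst nn_integral_add[symmetric]) (simp_all add: distrib_left distrib_right)
  also have "\<dots> = ennreal (barrier_value c (total_rate i) H (b i) u)"
    by (rule nn_integral_barrier_value[OF c_pos total_rate_pos[OF i] u b _ gain int]) measurable
  finally show ?thesis .
qed

text \<open>With continuation value 0 a stay is worth a \<open>barrier_value\<close> with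
  \<open>H = 0\<close>, which is estimated explicitly.\<close>

lemma reward_bound:
  assumes i: "i \<in> {1, 2}" and b: "0 \<le> b i"
  shows "reward b i u \<le> ennreal (max 0 u + c / total_rate i)"
proof (cases "0 \<le> u")
  case False
  then show ?thesis
    by (simp add: reward_def)
next
  case True
  let ?q = "total_rate i"
  have q: "?q > 0"
    by (rule total_rate_pos[OF i])
  have "trans_value b (\<lambda>_ _. 0) i u = 0"
    by (simp add: trans_value_def step_def)
  then have "reward b i u = ennreal (barrier_value c ?q (\<lambda>_. 0) (b i) u)"
    using one_stay_value[where w = "\<lambda>_ _. 0" and H = "\<lambda>_. 0" and b = b, OF i True b] by (simp add: gain_def integrable_0)
  also have "barrier_value c ?q (\<lambda>_. 0) (b i) u \<le> max 0 u + c / ?q"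
  proof (cases "b i \<le> u")
    case True
    then show ?thesis
      using b by (simp add: barrier_value_def)
  next
    case False
    have "exp (- ?q * (b i - u) / c) * (c / ?q) \<le> 1 * (c / ?q)"
      using False q c_pos by (intro mult_right_mono) auto
    then show ?thesis
      using False \<open>0 \<le> u\<close> by (simp add: barrier_value_def)
  qed
  finally show ?thesis
    by (simp add: ennreal_leI)
qed

lemma total_value_negative: "u < 0 \<Longrightarrow> total_value b i u = 0"
proof -
  have "(trans_value b ^^ n) (reward b) i u = 0" if "u < 0" for n i u
    using that by (induction n arbitrary: i u) (simp_all add: reward_def trans_value_def step_def next_level_def)
  then show "u < 0 \<Longrightarrow> total_value b i u = 0"
    by (simp add: total_value_def)
qed

section \<open>Finite values of a fixed strategy and their equations\<close>

context
  fixes b :: "nat \<Rightarrow> real"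
  assumes b_nonneg: "0 \<le> b 1" "0 \<le> b 2"
begin

definition F :: "nat \<Rightarrow> real \<Rightarrow> real" where
  "F i u = enn2real (total_value b i u)"

definition H :: "nat \<Rightarrow> real \<Rightarrow> real" where
  "H i z = enn2real (gain (total_value b) i z)"

lemma total_value_locally_bounded:
  obtains C where "C \<ge> 0" "\<And>k u. k \<in> {1, 2} \<Longrightarrow> u \<le> B \<Longrightarrow> total_value b k u \<le> ennreal C"
proof -
  \<comment> \<open>Including the barriers makes the half-line up to \<open>B'\<close> closed under
    the steps of the surplus, as the geometric bound on the total value requires.\<close>
  define B' where "B' = Max {B, b 1, b 2}"
  define C where "C = max 0 B' + c / total_rate 1 + c / total_rate 2"
  have q: "total_rate 1 > 0" "total_rate 2 > 0"
    by (simp_all add: total_rate_pos)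
  have C: "C \<ge> 0"
    using q c_pos by (simp add: C_def)
  have B': "b 1 \<le> B'" "b 2 \<le> B'" "B \<le> B'" "- 1 \<le> B'"
    using b_nonneg by (auto simp: B'_def)
  have r: "reward b k u \<le> ennreal C" if "k \<in> {1, 2}" "u \<le> B'" for k u
  proof -
    have "0 \<le> b k"
      using that b_nonneg by auto
    moreover have "max 0 u + c / total_rate k \<le> C"
      using that q c_pos by (auto simp: C_def add_increasing2 add_increasing)
    ultimately show ?thesis
      using reward_bound[OF that(1), of b u] by (meson ennreal_leI order_trans)
  qed
  show ?thesis
  proof (rule that)
    show "C / (1 - rho) \<ge> 0"
      using C rho_bounds by simp
    show "total_value b k u \<le> ennreal (C / (1 - rho))" if "k \<in> {1, 2}" "u \<le> B" for k u
      using that B' by (intro total_value_bound[OF B'(1,2,4) C r]) auto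
  qed
qed

lemma total_value_eq_F: "i \<in> {1, 2} \<Longrightarrow> total_value b i u = ennreal (F i u)"
proof -
  assume i: "i \<in> {1, 2}"
  obtain C where "C \<ge> 0" and C: "\<And>k v. k \<in> {1, 2} \<Longrightarrow> v \<le> u \<Longrightarrow> total_value b k v \<le> ennreal C"
    using total_value_locally_bounded[of u] by blast
  from C[OF i order_refl] have "total_value b i u < top"
    using ennreal_less_top by (rule le_less_trans)
  then show ?thesis
    by (simp add: F_def)
qed

lemma F_nonneg: "F i u \<ge> 0"
  by (simp add: F_def)

lemma measurable_F [measurable]: "F i \<in> borel_measurable borel"
  unfolding F_def[abs_def] by measurable

lemma F_locally_bounded:
  obtains C where "C \<ge> 0" "\<And>k u. k \<in> {1, 2} \<Longrightarrow> u \<le> B \<Longrightarrow> F k u \<le> C"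
proof -
  obtain C where C: "C \<ge> 0" "\<And>k u. k \<in> {1, 2} \<Longrightarrow> u \<le> B \<Longrightarrow> total_value b k u \<le> ennreal C"
    using total_value_locally_bounded[of B] by blast
  show ?thesis
  proof (rule that[OF C(1)])
    show "F k u \<le> C" if "k \<in> {1, 2}" "u \<le> B" for k u
      using C(2)[OF that] C(1) by (simp add: total_value_eq_F[OF that(1)])
  qed
qed

lemma claim_convolution_integrable:
  assumes "k \<in> {1, 2}" "0 \<le> z"
  shows "(\<lambda>v. \<beta> * exp (- \<beta> * (z - v)) * F k v) integrable_on {0..z}"
proof -
  obtain C where C: "C \<ge> 0" "\<And>k u. k \<in> {1, 2} \<Longrightarrow> u \<le> z \<Longrightarrow> F k u \<le> C"
    using F_locally_bounded[of z] by blast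
  show ?thesis
  proof (rule bounded_measurable_integrable_on[where M = "\<beta> * 1 * C"])
    fix v assume "v \<in> {0..z}"
    then have "\<beta> * exp (- \<beta> * (z - v)) * F k v \<le> \<beta> * 1 * C"
      using beta_pos C assms by (intro mult_mono) (auto simp: F_nonneg)
    then show "\<bar>\<beta> * exp (- \<beta> * (z - v)) * F k v\<bar> \<le> \<beta> * 1 * C"
      using beta_pos by (simp add: F_nonneg abs_mult)
  qed measurable
qed

text \<open>Substitute \<open>v = z - y\<close>: vanishing values at negative surplus cut the
  integral at 0, nonnegative claims cut it at \<open>z\<close>.\<close>

lemma claim_convolution:
  assumes k: "k \<in> {1, 2}" and z: "0 \<le> z"
  shows "(\<integral>\<^sup>+y. total_value b k (z - y) \<partial>claim_size) =
    ennreal (integral {0..z} (\<lambda>v. \<beta> * exp (- \<beta> * (z - v)) * F k v))"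
proof -
  have "(\<integral>\<^sup>+y. total_value b k (z - y) \<partial>claim_size) =
      (\<integral>\<^sup>+y. ennreal (\<beta> * exp (- \<beta> * y)) * total_value b k (z - y) * indicator {0..} y \<partial>lborel)"
    by (rule nn_integral_claim_size) measurable
  also have "\<dots> = ennreal \<bar>- 1\<bar> * (\<integral>\<^sup>+v. ennreal (\<beta> * exp (- \<beta> * (z + - 1 * v))) *
      total_value b k (z - (z + - 1 * v)) * indicator {0..} (z + - 1 * v) \<partial>lborel)"
    by (subst nn_integral_real_affine[where c = "- 1" and t = z]) simp_all
  also have "\<dots> = (\<integral>\<^sup>+v. ennreal (\<beta> * exp (- \<beta> * (z - v)) * F k v) * indicator {0..z} v \<partial>lborel)"
    using beta_pos total_value_negative[of _ b k]
    by (auto intro!: nn_integral_cong simp: indicator_def total_value_eq_F[OF k] ennreal_mult')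
  also have "\<dots> = ennreal (integral {0..z} (\<lambda>v. \<beta> * exp (- \<beta> * (z - v)) * F k v))"
    using beta_pos
    by (intro nn_integral_has_integral_lebesgue' integrable_integral claim_convolution_integrable k z) (auto simp: F_nonneg)
  finally show ?thesis .
qed

lemma gain_eq:
  assumes i: "i \<in> {1, 2}" and z: "0 \<le> z"
  shows "gain (total_value b) i z = ennreal (H i z)"
    and "H i z = lam i (3 - i) * F (3 - i) z + lam i 3 *
      integral {0..z} (\<lambda>v. \<beta> * exp (- \<beta> * (z - v)) * (\<pi> 1 * F 1 v + \<pi> 2 * F 2 v))"
proof -
  let ?J = "integral {0..z} (\<lambda>v. \<beta> * exp (- \<beta> * (z - v)) * (\<pi> 1 * F 1 v + \<pi> 2 * F 2 v))"
  let ?I = "\<lambda>k. integral {0..z} (\<lambda>v. \<beta> * exp (- \<beta> * (z - v)) * F k v)"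
  have int: "(\<lambda>v. \<beta> * exp (- \<beta> * (z - v)) * F k v) integrable_on {0..z}" if "k \<in> {1, 2}" for k
    by (rule claim_convolution_integrable[OF that z])
  have I_nonneg: "?I k \<ge> 0" if "k \<in> {1, 2}" for k
    using beta_pos by (intro integral_nonneg int that) (auto simp: F_nonneg)
  have lam: "lam i (3 - i) \<ge> 0" "lam i 3 \<ge> 0"
    using i intensity_nonneg[of i "3 - i"] intensity_nonneg[of i 3] by auto
  have "(\<lambda>v. \<beta> * exp (- \<beta> * (z - v)) * (\<pi> 1 * F 1 v + \<pi> 2 * F 2 v)) =
      (\<lambda>v. \<pi> 1 * (\<beta> * exp (- \<beta> * (z - v)) * F 1 v) + \<pi> 2 * (\<beta> * exp (- \<beta> * (z - v)) * F 2 v))"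
    by (simp add: fun_eq_iff algebra_simps)
  then have sum: "?J = \<pi> 1 * ?I 1 + \<pi> 2 * ?I 2"
    by (simp only: Henstock_Kurzweil_Integration.integral_add integral_mult_right insertI1 insertI2
        integrable_cmul[OF int, unfolded real_scaleR_def])
  have j: "3 - i \<in> {1, 2}"
    using i by auto
  have gain: "gain (total_value b) i z = ennreal (lam i (3 - i) * F (3 - i) z + lam i 3 * (\<pi> 1 * ?I 1 + \<pi> 2 * ?I 2))"
    unfolding gain_def using lam restart_nonneg I_nonneg[of 1] I_nonneg[of 2]
    by (simp add: claim_convolution[OF _ z] total_value_eq_F[OF j] F_nonneg ennreal_mult')
  then have H: "H i z = lam i (3 - i) * F (3 - i) z + lam i 3 * (\<pi> 1 * ?I 1 + \<pi> 2 * ?I 2)"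
    unfolding H_def gain using lam restart_nonneg I_nonneg[of 1] I_nonneg[of 2]
    by (intro enn2real_ennreal) (simp add: F_nonneg)
  from gain H show "gain (total_value b) i z = ennreal (H i z)"
    by simp
  from H sum show "H i z = lam i (3 - i) * F (3 - i) z + lam i 3 *
      ?J"
    by simp
qed

lemma H_nonneg: "H i z \<ge> 0"
  by (simp add: H_def)

lemma measurable_H [measurable]: "H i \<in> borel_measurable borel"
  unfolding H_def[abs_def] by measurable

lemma H_locally_bounded:
  assumes i: "i \<in> {1, 2}"
  obtains C where "C \<ge> 0" "\<And>z. 0 \<le> z \<Longrightarrow> z \<le> B \<Longrightarrow> H i z \<le> C"
proof -
  interpret cl: prob_space claim_size
    by (rule prob_space_claim_size)
  obtain C where C: "C \<ge> 0" "\<And>k u. k \<in> {1, 2} \<Longrightarrow> u \<le> B \<Longrightarrow> total_value b k u \<le> ennreal C"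
    using total_value_locally_bounded[of B] by blast
  have lam: "lam i (3 - i) \<ge> 0" "lam i 3 \<ge> 0"
    using i intensity_nonneg[of i "3 - i"] intensity_nonneg[of i 3] by auto
  let ?M = "lam i (3 - i) * C + lam i 3 * (\<pi> 1 * C + \<pi> 2 * C)"
  have M: "?M \<ge> 0"
    using lam restart_nonneg C by simp
  show ?thesis
  proof (rule that[OF M])
    fix z assume z: "0 \<le> z" "z \<le> B"
    have conv: "(\<integral>\<^sup>+y. total_value b k (z - y) \<partial>claim_size) \<le> ennreal C" if "k \<in> {1, 2}" for k
    proof -
      have "(\<integral>\<^sup>+y. total_value b k (z - y) \<partial>claim_size) \<le> (\<integral>\<^sup>+y. ennreal C \<partial>claim_size)"
        using AE_claim_size_nonneg z
        by (intro nn_integral_mono_AE) (auto elim!: eventually_mono intro!: C(2)[OF that])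
      then show ?thesis
        by (simp add: cl.emeasure_space_1[simplified])
    qed
    have "gain (total_value b) i z \<le> ennreal (lam i (3 - i)) * ennreal C + ennreal (lam i 3) *
        (ennreal (\<pi> 1) * ennreal C + ennreal (\<pi> 2) * ennreal C)"
      unfolding gain_def using i z by (intro add_mono mult_left_mono conv C(2)) auto
    also have "\<dots> = ennreal ?M"
      using lam restart_nonneg C by (simp add: ennreal_mult')
    finally show "H i z \<le> ?M"
      using M by (simp add: gain_eq(1)[OF i z(1)])
  qed
qed

lemma damped_H_integrable:
  assumes i: "i \<in> {1, 2}" and "0 \<le> a"
  shows "(\<lambda>z. exp (- total_rate i * (z - a) / c) * H i z / c) integrable_on {a..y}"
    and "(\<lambda>z. exp (- total_rate i * z / c) * H i z / c) integrable_on {0..y}"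
proof -
  obtain C where C: "C \<ge> 0" "\<And>z. 0 \<le> z \<Longrightarrow> z \<le> y \<Longrightarrow> H i z \<le> C"
    using H_locally_bounded[OF i, of y] by blast
  have "(\<lambda>z. exp (- total_rate i * (z - a) / c) * H i z / c) integrable_on {a..y}" if "0 \<le> a" for a
  proof (rule bounded_measurable_integrable_on[where M = "1 * C / c"])
    fix z assume z: "z \<in> {a..y}"
    then have "exp (- total_rate i * (z - a) / c) \<le> 1"
      using total_rate_pos[OF i] c_pos by simp
    then have "exp (- total_rate i * (z - a) / c) * H i z / c \<le> 1 * C / c"
      using C z that c_pos by (intro divide_right_mono mult_mono) (auto simp: H_nonneg)
    then show "\<bar>exp (- total_rate i * (z - a) / c) * H i z / c\<bar> \<le> 1 * C / c"
      using c_pos by (simp add: H_nonneg abs_mult)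
  qed measurable
  from this[OF assms(2)] this[of 0] show "(\<lambda>z. exp (- total_rate i * (z - a) / c) * H i z / c) integrable_on {a..y}"
      "(\<lambda>z. exp (- total_rate i * z / c) * H i z / c) integrable_on {0..y}"
    by simp_all
qed

text \<open>The barriers \<open>b'\<close> govern the present stay while \<open>H\<close> still
  belongs to \<open>b\<close>. This puts a deviation for one stay into analytic form.\<close>

lemma one_stay_barrier_value:
  assumes i: "i \<in> {1, 2}" and u: "0 \<le> u" and b': "0 \<le> b' i"
  shows "reward b' i u + trans_value b' (total_value b) i u = ennreal (barrier_value c (total_rate i) (H i) (b' i) u)"
proof (rule one_stay_value[where b = b' and H = "H i", OF i u b'])
  show "gain (total_value b) i z = ennreal (H i z)" if "0 \<le> z" for z
    by (rule gain_eq(1)[OF i that])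
  show "(\<lambda>z. exp (- total_rate i * (z - u) / c) * H i z / c) integrable_on {u..b' i}"
    by (rule damped_H_integrable(1)[OF i u])
qed (simp_all add: H_nonneg)

lemma barrier_value_nonneg:
  assumes i: "i \<in> {1, 2}" and u: "0 \<le> u"
  shows "0 \<le> barrier_value c (total_rate i) (H i) y u"
proof -
  have "0 \<le> integral {u..y} (\<lambda>z. exp (- total_rate i * (z - u) / c) * H i z / c)"
    using c_pos by (intro integral_nonneg damped_H_integrable[OF i u]) (simp add: H_nonneg)
  then show ?thesis
    using total_rate_pos[OF i] c_pos H_nonneg[of i y] by (simp add: barrier_value_def)
qed

text \<open>The trivial deviation \<open>b' = b\<close> turns the fixed point equation into this
  one.\<close>

lemma F_eq_barrier_value:
  assumes i: "i \<in> {1, 2}" and u: "0 \<le> u"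
  shows "F i u = barrier_value c (total_rate i) (H i) (b i) u"
proof -
  have "0 \<le> b i"
    using i b_nonneg by auto
  then have "ennreal (F i u) = ennreal (barrier_value c (total_rate i) (H i) (b i) u)"
    using one_stay_barrier_value[OF i u, of b] total_value_fixpoint[of b i u] by (simp add: total_value_eq_F[OF i])
  then show ?thesis
    by (simp add: F_nonneg barrier_value_nonneg[OF i u])
qed

text \<open>Up to the barrier \<open>F i\<close> is an indefinite integral of a locally bounded
  function plus a constant, divided by an exponential; above it continues with slope 1. Local
  boundedness thus already yields continuity.\<close>

lemma F_continuous:
  assumes i: "i \<in> {1, 2}"
  shows "continuous_on {0..} (F i)"
proof -
  let ?q = "total_rate i"
  let ?K = "\<lambda>z. exp (- ?q * z / c) * H i z / c"
  define \<psi> where "\<psi> u = (integral {0..b i} ?K - integral {0..u} ?K + exp (- ?q * b i / c) * ((c + H i (b i)) / ?q)) /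
    exp (- ?q * u / c)" for u
  have bi: "0 \<le> b i"
    using i b_nonneg by auto
  have "continuous_on {0..b i} \<psi>"
    unfolding \<psi>_def[abs_def] using c_pos
    by (intro continuous_intros indefinite_integral_continuous_1 damped_H_integrable(2)[OF i order_refl]) auto
  \<comment> \<open>Composition with \<open>min\<close> extends the lower branch by a constant;
    adding the positive part of \<open>u - b i\<close> then gives the upper branch.\<close>
  then have "continuous_on {0..} (\<lambda>u. \<psi> (min u (b i)))"
    by (rule continuous_on_compose2) (use bi in \<open>auto intro!: continuous_intros\<close>)
  then have "continuous_on {0..} (\<lambda>u. \<psi> (min u (b i)) + max 0 (u - b i))"
    by (intro continuous_intros)
  then show ?thesis
  proof (rule continuous_on_eq)
    fix u :: real assume u: "u \<in> {0..}"
    have below: "F i u = \<psi> u" if "0 \<le> u" "u \<le> b i" for u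
    proof -
      have "exp (- ?q * u / c) * F i u = integral {0..b i} ?K - integral {0..u} ?K + exp (- ?q * b i / c) * ((c + H i (b i)) / ?q)"
        unfolding F_eq_barrier_value[OF i that(1)]
        by (rule barrier_value_integral) (use that c_pos damped_H_integrable(2)[OF i order_refl] in auto)
      then show ?thesis
        unfolding \<psi>_def by (metis exp_not_eq_zero nonzero_mult_div_cancel_left)
    qed
    show "\<psi> (min u (b i)) + max 0 (u - b i) = F i u"
    proof (cases "u \<le> b i")
      case True
      then show ?thesis
        using u below[of u] by simp
    next
      case False
      then show ?thesis
        using u bi below[of "b i", symmetric] by (simp add: F_eq_barrier_value[OF i] barrier_value_def)
    qed
  qed
qed

lemma F_concave:
  assumes opt: "optimal_barriers b" and b1: "0 < b 1" and b12: "b 1 < b 2"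
  shows "concave_on {b 1..} (F 2)"
proof -
  let ?W = "\<lambda>z. integral {0..z} (\<lambda>v. \<beta> * exp (- \<beta> * (z - v)) * (\<pi> 1 * F 1 v + \<pi> 2 * F 2 v))"
  interpret barrier_equations c \<beta> "total_rate 2" "lam 2 1" "lam 2 3" "\<pi> 1" "\<pi> 2" "b 1" "b 2" "F 1" "F 2" ?W "H 2"
  proof unfold_locales
    show "0 < c" "0 < \<beta>" "0 < total_rate 2" "0 < b 1" "b 1 < b 2"
      using c_pos beta_pos total_rate_pos[of 2] b1 b12 by simp_all
    \<comment> \<open>Strictness comes from \<delta>: a claim is one of the exits from phase 2, and
      \<open>\<pi> 2\<close> is at most 1.\<close>
    show "lam 2 3 * \<pi> 2 < total_rate 2"
    proof -
      have "{1, 2, 3} - {2} = {1, 3 :: nat}"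
        by auto
      then have "rate 2 = lam 2 1 + lam 2 3"
        by (simp add: rate_def)
      moreover have "0 \<le> lam 2 1" "0 \<le> lam 2 3"
        by (simp_all add: intensity_nonneg)
      moreover have "\<pi> 2 \<le> 1"
        using restart_nonneg restart_sum by linarith
      then have "lam 2 3 * \<pi> 2 \<le> lam 2 3 * 1"
        using \<open>0 \<le> lam 2 3\<close> by (rule mult_left_mono)
      ultimately show ?thesis
        using delta_pos by (simp add: total_rate_def)
    qed
    show "continuous_on {0..} (F 1)" "continuous_on {0..} (F 2)"
      by (simp_all add: F_continuous)
    show "F 1 u = F 1 (b 1) + (u - b 1)" if "b 1 \<le> u" for u
      using that b1 by (simp add: F_eq_barrier_value barrier_value_def)
    show "H 2 z = lam 2 1 * F 1 z + lam 2 3 * ?W z" if "0 \<le> z" for z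
      using gain_eq(2)[of 2 z] that by simp
    show "F 2 u = barrier_value c (total_rate 2) (H 2) (b 2) u" if "0 \<le> u" for u
      using that by (simp add: F_eq_barrier_value)
    fix y :: real assume y: "0 \<le> y" and improve: "\<And>u. 0 \<le> u \<Longrightarrow> F 2 u \<le> barrier_value c (total_rate 2) (H 2) y u"
    \<comment> \<open>Phase 1 keeps its barrier and its equation, so the hypothesis of
      \<open>policy_improvement\<close> holds with equality there; in phase 2 it is the assumed
      domination.\<close>
    define b' where "b' = b(2 := y)"
    have b': "0 \<le> b' 1" "0 \<le> b' 2" "b' 1 = b 1" "b' 2 = y"
      using b_nonneg y by (simp_all add: b'_def)
    define B where "B = max (b' 1) (b' 2)"
    obtain C where C: "C \<ge> 0" "\<And>k u. k \<in> {1, 2} \<Longrightarrow> u \<le> B \<Longrightarrow> total_value b k u \<le> ennreal C"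
      using total_value_locally_bounded[of B] by blast
    have "reward b' 2 0 + trans_value b' (total_value b) 2 0 \<le> total_value b' 2 0"
    proof (rule policy_improvement[where B = B, OF _ _ _ _ C(2) C(1)])
      fix k :: nat and u :: real assume k: "k \<in> {1, 2}"
      show "total_value b k u \<le> reward b' k u + trans_value b' (total_value b) k u"
      proof (cases "0 \<le> u")
        case True
        have "F k u \<le> barrier_value c (total_rate k) (H k) (b' k) u"
          using k True improve[of u] b' by (auto simp: F_eq_barrier_value)
        moreover have "0 \<le> b' k"
          using k b' by auto
        ultimately show ?thesis
          by (simp add: one_stay_barrier_value[OF k True] total_value_eq_F[OF k] ennreal_leI)
      qed (simp add: total_value_negative)
    qed (use b' in \<open>auto simp: B_def\<close>)
    also have "total_value b' 2 0 = f b' 2 0"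
      using b' by (simp add: f_eq_total_value)
    also have "\<dots> \<le> (SUP b'\<in>{1, 2} \<rightarrow> {0..}. f b' 2 0)"
      using b' by (intro SUP_upper) auto
    \<comment> \<open>Surplus 0 lies in \<open>{0..b 2}\<close>, where
      \<open>optimal_barriers\<close> asserts that \<open>b\<close> attains the supremum.\<close>
    also have "\<dots> = f b 2 0"
      using opt b_nonneg by (auto simp: optimal_barriers_def)
    also have "\<dots> = ennreal (F 2 0)"
      using b_nonneg by (simp add: f_eq_total_value total_value_eq_F)
    finally show "barrier_value c (total_rate 2) (H 2) y 0 \<le> F 2 0"
      using b' F_nonneg[of 2 0] by (simp add: one_stay_barrier_value)
  qed simp
  show ?thesis
    by (rule F2_concave)
qed

end

end

theorem theorem4p1:
  fixes c \<beta> \<delta> :: real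
    and \<pi> :: "nat \<Rightarrow> real"
    and lam :: "nat \<Rightarrow> nat \<Rightarrow> real"
    and P :: "nat \<Rightarrow> 'w measure"
    and Z :: "nat \<Rightarrow> 'w \<Rightarrow> nat"
    and S :: "nat \<Rightarrow> 'w \<Rightarrow> real"
    and E :: "nat \<Rightarrow> 'w \<Rightarrow> nat"
    and Y :: "nat \<Rightarrow> 'w \<Rightarrow> real"
    and b :: "nat \<Rightarrow> real"
  assumes "phase_type_risk_model c \<beta> \<delta> \<pi> lam P Z S E Y"
    and "phase_type_risk_model.optimal_barriers c \<delta> P Z S E Y b"
    and "0 < b 1" and "b 1 < b 2"
  shows "concave_on {b 1..} (\<lambda>x. enn2real (phase_type_risk_model.f c \<delta> P Z S E Y b 2 x))"
proof -
  interpret phase_type_risk_model c \<beta> \<delta> \<pi> lam P Z S E Y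
    by fact
  have b: "0 \<le> b 1" "0 \<le> b 2"
    using assms(3,4) by simp_all
  have eq: "enn2real (f b 2 x) = F b 2 x" if "x \<in> {b 1..}" for x
    using that b by (simp add: f_eq_total_value F_def[OF b])
  have concave: "concave_on {b 1..} (F b 2)"
    by (rule F_concave[OF b assms(2-4)])
  show ?thesis
    unfolding concave_on_iff
  proof (intro conjI ballI allI impI)
    show "convex {b 1..}"
      by (rule convex_real_interval)
    fix x y u v :: real
    assume *: "x \<in> {b 1..}" "y \<in> {b 1..}" "0 \<le> u" "0 \<le> v" "u + v = 1"
    then have "u *\<^sub>R x + v *\<^sub>R y \<in> {b 1..}"
      by (intro convexD[OF convex_real_interval(1)])
    then show "u * enn2real (f b 2 x) + v * enn2real (f b 2 y) \<le> enn2real (f b 2 (u *\<^sub>R x + v *\<^sub>R y))"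
      using concave * by (simp only: eq concave_on_iff)
  qed
qed

end
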